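(* Let $(\mathcal G,V^{\mathcal G},\mathfrak g)$ and $(\mathcal K,V^{\mathcal K},\mathfrak k)$ be processes with a common multiplicity space $\mathcal P$ and let $\gamma:\mathcal E^{\mathfrak k}_*\to\mathcal E^{\mathfrak g}$ be a contraction. Then the $\gamma$-extension $(\mathcal G,V^{\mathcal G},\mathfrak g)\oplus_\gamma(\mathcal K,V^{\mathcal K},\mathfrak k)$ is a process, inside it $$\gamma=P_{\mathcal E^{\mathfrak g}}|_{\mathcal E^{\mathfrak k}_*}=P_{\mathcal G}|_{\mathcal E^{\mathfrak k}_*},\qquad \gamma^*=P_{\mathcal E^{\mathfrak k}_*}|_{\mathcal E^{\mathfrak g}}=P_{\mathcal K}|_{\mathcal E^{\mathfrak g}},$$ and there is a short exact sequence $$0\to(\mathcal G,V^{\mathcal G},\mathfrak g)\xrightarrow{1_{\mathfrak g}}(\mathcal G,V^{\mathcal G},\mathfrak g)\oplus_\gamma(\mathcal K,V^{\mathcal K},\mathfrak k)\xrightarrow{P_{\mathfrak k}}(\mathcal K,V^{\mathcal K},\mathfrak k)\to0,$$ i.e. $(\mathcal G,V^{\mathcal G},\mathfrak g)$ is a subprocess and $(\mathcal K,V^{\mathcal K},\mathfrak k)$ is a quotient process of the $\gamma$-extension. Conversely, given a short exact sequence $$0\to(\mathcal G,V^{\mathcal G},\mathfrak g)\xrightarrow{1'_{\mathfrak g}}(\mathcal H',V',\mathfrak h')\xrightarrow{P'_{\mathfrak k}}(\mathcal K,V^{\mathcal K},\mathfrak k)\to0$$ where $1'_{\mathfrak g}$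 is an isometric and $P'_{\mathfrak k}$ a coisometric morphism, there is a contraction $\gamma:\mathcal E^{\mathfrak k}_*\to\mathcal E^{\mathfrak g}$ and an isomorphism $j$ from the $\gamma$-extension $(\mathcal G,V^{\mathcal G},\mathfrak g)\oplus_\gamma(\mathcal K,V^{\mathcal K},\mathfrak k)$ to $(\mathcal H',V',\mathfrak h')$ such that the two extensions are equivalent via $j$, i.e. $j\circ1_{\mathfrak g}=1'_{\mathfrak g}$ and $P'_{\mathfrak k}\circ j=P_{\mathfrak k}$. Two such extensions given by $\gamma_1,\gamma_2:\mathcal E^{\mathfrak k}_*\to\mathcal E^{\mathfrak g}$ are equivalent if and only if $\gamma_1=\gamma_2$.
   Context: Let $\mathcal P$ be a separable Hilbert space with orthonormal basis $(\epsilon_k)_{k=1}^d$ ($d\in\mathbb N$ or $d=\infty$), and let $F_d^+$ be the free semigroup of words in the letters $1,\dots,d$, including the empty word $0$. A row isometry on a separable Hilbert space $\mathcal H$ is an isometry $V:\mathcal H\otimes\mathcal P\to\mathcal H$; put $V_k\xi=V(\xi\otimes\epsilon_k)$ and $V_\alpha=V_{\alpha_1}\cdots V_{\alpha_n}$ for $\alpha=\alpha_1\dots\alpha_n$, $V_0=1$. A closed subspace $\mathfrak h$ is co-invariant for $V$ if $V_k^*\mathfrak h\subset\mathfrak h$ for all $k$. A process (= minimal discrete weak Markov process) is a triple $(\mathcal H,V,\mathfrak h)$ where $V$ is a row isometry on $\mathcal H$, $\mathfrak h\subset\mathcal H$ is a co-invariant closed subspace, and $\mathcal H=\overline{\mathrm{span}}\{V_\alpha\mathfrak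 h:\alpha\in F_d^+\}$. $P_{\mathcal L}$ is the orthogonal projection onto a closed subspace $\mathcal L$. Subprocess: $\mathfrak g\subset\mathfrak h$ closed and co-invariant for $V$, $\mathcal G=\overline{\mathrm{span}}\{V_\alpha\mathfrak g\}$, $V^{\mathcal G}=V|_{\mathcal G\otimes\mathcal P}$. Corresponding quotient process: $\mathfrak k=\mathfrak h\ominus\mathfrak g$, $\mathcal K=\overline{\mathrm{span}}\{V_\alpha\mathfrak k\}$, $V^{\mathcal K}=V|_{\mathcal K\otimes\mathcal P}$. Category: a morphism from $(\mathcal R,V^{\mathcal R},\mathfrak r)$ to $(\mathcal S,V^{\mathcal S},\mathfrak s)$ (same $\mathcal P$) is a contraction $t:\mathfrak r\to\mathfrak s$ with $V^{\mathcal S*}t=(t\otimes1_{\mathcal P})V^{\mathcal R*}|_{\mathfrak r}$, equivalently $V_k^{\mathcal S*}t=tV_k^{\mathcal R*}|_{\mathfrak r}$ for all $k$. An isomorphism is a unitary morphism. A short exact sequence $0\to(\mathcal G,V^{\mathcal G},\mathfrak g)\to(\mathcal H,V,\mathfrak h)\to(\mathcal K,V^{\mathcal K},\mathfrak k)\to0$ of processes consists of an isometric morphism from $(\mathcal G,V^{\mathcal G},\mathfrak g)$ to $(\mathcal H,V,\mathfrak h)$ and a coisometric morphism from $(\mathcal H,V,\mathfrak h)$ to $(\mathcal K,V^{\mathcal K},\mathfrak k)$ such that the image of the first equals the kernel of the second (here $0$ stands for the process on the $0$-dimensional space); $1_{\mathfrak g}$ denotes the embedding of $\mathfrak g$ into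 $\mathfrak h$ and $P_{\mathfrak k}$ the orthogonal projection of $\mathfrak h$ onto $\mathfrak k$. Two short exact sequences with the same $(\mathcal G,V^{\mathcal G},\mathfrak g)$ and $(\mathcal K,V^{\mathcal K},\mathfrak k)$ are equivalent extensions if there is an isomorphism $j$ between the middle processes commuting with the embeddings of $\mathfrak g$ and with the projections to $\mathfrak k$. Put $\mathcal E^{\mathfrak g}=\overline{\mathrm{span}}(\mathfrak g,V^{\mathcal G}(\mathfrak g\otimes\mathcal P))\ominus\mathfrak g$ and $\mathcal E^{\mathfrak k}_*=\overline{\mathrm{span}}(\mathfrak k,V^{\mathcal K}(\mathfrak k\otimes\mathcal P))\ominus V^{\mathcal K}(\mathfrak k\otimes\mathcal P)$. For a contraction $\gamma:\mathcal E^{\mathfrak k}_*\to\mathcal E^{\mathfrak g}$ let $D_{\gamma^*}=\sqrt{1-\gamma\gamma^*}$ and let $\mathcal D_{\gamma^*}\subset\mathcal E^{\mathfrak g}$ be the closure of its range. The $\gamma$-extension $(\mathcal G,V^{\mathcal G},\mathfrak g)\oplus_\gamma(\mathcal K,V^{\mathcal K},\mathfrak k)$ is $(\mathcal H,V,\mathfrak h)$ with $$\mathfrak h=\mathfrak g\oplus\mathfrak k,\qquad\mathcal H=\mathfrak g\oplus\mathcal K\oplus\bigoplus_{\alpha\in F_d^+}(\mathcal D_{\gamma^*})_\alpha,$$ where $(\mathcal D_{\gamma^*})_\alpha$ are copies of $\mathcal D_{\gamma^*}$, and $V:\mathcal H\otimes\mathcal P\to\mathcal H$ given as follows. On $\mathfrak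 g\otimes\mathcal P$: $V=\big(1_{\mathfrak g}\oplus\binom{\gamma^*}{D_{\gamma^*}}\big)V^{\mathcal G}$, where $V^{\mathcal G}$ maps $\mathfrak g\otimes\mathcal P$ into $\mathfrak g\oplus\mathcal E^{\mathfrak g}$, $1_{\mathfrak g}$ is the identity on $\mathfrak g$, $\gamma^*$ maps $\mathcal E^{\mathfrak g}$ into $\mathcal E^{\mathfrak k}_*\subset\mathcal K$, and $D_{\gamma^*}$ maps $\mathcal E^{\mathfrak g}$ into $(\mathcal D_{\gamma^*})_0$. On $\mathcal K\otimes\mathcal P$: $V=V^{\mathcal K}$. On the last summand $V$ is the canonical row shift, $V_k$ mapping the copy $(\mathcal D_{\gamma^*})_\alpha$ identically onto $(\mathcal D_{\gamma^*})_{k\alpha}$. Inside the $\gamma$-extension, $\mathcal G$ is identified with $\overline{\mathrm{span}}\{V_\alpha\mathfrak g\}$, with $\mathfrak g$ embedded identically and $e\in\mathcal E^{\mathfrak g}$ identified with $\gamma^*e\oplus D_{\gamma^*}e\in\mathcal E^{\mathfrak k}_*\oplus(\mathcal D_{\gamma^*})_0$ (and $V^{\mathcal G}_\alpha e$ with $V_\alpha(\gamma^*e\oplus D_{\gamma^*}e)$). *)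

theory Defs
  imports "HOL-Analysis.Analysis"
begin

section \<open>Complex Hilbert spaces\<close>

class scaleC =
  fixes scaleC :: "complex \<Rightarrow> 'a \<Rightarrow> 'a"  (infixr \<open>*\<^sub>C\<close> 75)

class complex_vector = real_vector + scaleC +
  assumes scaleC_add_right: "a *\<^sub>C (x + y) = a *\<^sub>C x + a *\<^sub>C y"
    and scaleC_add_left: "(a + b) *\<^sub>C x = a *\<^sub>C x + b *\<^sub>C x"
    and scaleC_scaleC: "a *\<^sub>C b *\<^sub>C x = (a * b) *\<^sub>C x"
    and scaleR_scaleC: "scaleR r x = of_real r *\<^sub>C x"

text \<open>The complex inner product is conjugate-linear in the first argument; its real part is the
  inner product of the library, so norm and topology are those of \<^class>\<open>real_inner\<close>.\<close>

class complex_inner = complex_vector + real_inner +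
  fixes cinner :: "'a \<Rightarrow> 'a \<Rightarrow> complex"
  assumes cinner_commute: "cinner x y = cnj (cinner y x)"
    and cinner_add_left: "cinner (x + y) z = cinner x z + cinner y z"
    and cinner_scaleC_left: "cinner (c *\<^sub>C x) y = cnj c * cinner x y"
    and inner_eq_Re_cinner: "inner x y = Re (cinner x y)"

class complex_hilbert = complex_inner + complete_space

global_interpretation complex_vector: vector_space "scaleC :: complex \<Rightarrow> 'a \<Rightarrow> 'a::complex_vector"
  defines csubspace = complex_vector.subspace
    and cspan = complex_vector.span
proof
  fix x :: 'a
  have "1 *\<^sub>C x = scaleR 1 x"
    by (simp only: scaleR_scaleC of_real_1)
  then show "1 *\<^sub>C x = x" by simp
qed (rule scaleC_add_right scaleC_add_left scaleC_scaleC)+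

lemma cinner_add_right: "cinner x (y + z) = cinner x y + cinner x (z::'a::complex_inner)"
  by (metis cinner_add_left cinner_commute complex_cnj_add)

lemma cinner_scaleC_right: "cinner x (c *\<^sub>C y) = c * cinner x (y::'a::complex_inner)"
  by (metis cinner_commute cinner_scaleC_left complex_cnj_cnj complex_cnj_mult)

lemma Im_cinner_self: "Im (cinner x x) = 0" for x :: "'a::complex_inner"
proof -
  have "Im (cinner x x) = Im (cnj (cinner x x))" by (metis cinner_commute)
  then show ?thesis by simp
qed

lemma cinner_self: "cinner x x = of_real ((norm x)\<^sup>2)" for x :: "'a::complex_inner"
  by (simp add: complex_eq_iff Im_cinner_self power2_norm_eq_inner inner_eq_Re_cinner)

lemma norm_scaleC: "norm (c *\<^sub>C x) = cmod c * norm x" for x :: "'a::complex_inner"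
proof -
  have "cinner (c *\<^sub>C x) (c *\<^sub>C x) = (c * cnj c) * cinner x x"
    by (simp add: cinner_scaleC_left cinner_scaleC_right)
  then have "complex_of_real ((norm (c *\<^sub>C x))\<^sup>2) = of_real ((cmod c * norm x)\<^sup>2)"
    by (simp only: cinner_self complex_norm_square[symmetric] of_real_mult[symmetric]
        power_mult_distrib)
  then have "(norm (c *\<^sub>C x))\<^sup>2 = (cmod c * norm x)\<^sup>2"
    by (simp only: of_real_eq_iff)
  then show ?thesis by (simp add: power2_eq_iff_nonneg)
qed

lemma cmod_cinner_le: "cmod (cinner x y) \<le> norm x * norm y" for x y :: "'a::complex_inner"
proof (cases "cinner x y = 0")
  case False
  define c where "c = sgn (cinner x y)"
  have c: "cmod c = 1" using False by (simp add: c_def norm_sgn)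
  have "cmod (cinner x y) = Re (cnj c * cinner x y)"
  proof -
    have "cnj c * cinner x y = of_real (cmod (cinner x y))"
      using False
      by (simp add: c_def sgn_eq complex_norm_square[symmetric] mult.commute[of "cnj _"]
          power2_eq_square)
    then show ?thesis by simp
  qed
  also have "\<dots> = inner (c *\<^sub>C x) y"
    by (simp add: inner_eq_Re_cinner cinner_scaleC_left)
  also have "\<dots> \<le> norm (c *\<^sub>C x) * norm y" by (rule norm_cauchy_schwarz)
  finally show ?thesis by (simp add: norm_scaleC c)
qed simp

instantiation prod :: (complex_vector, complex_vector) complex_vector
begin
definition scaleC_prod :: "complex \<Rightarrow> 'a \<times> 'b \<Rightarrow> 'a \<times> 'b"
  where "scaleC_prod c x = (c *\<^sub>C fst x, c *\<^sub>C snd x)"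
instance
  by standard
     (simp_all add: scaleC_prod_def scaleC_add_right scaleC_add_left scaleC_scaleC scaleR_scaleC
       prod_eq_iff)
end

instantiation prod :: (complex_inner, complex_inner) complex_inner
begin
definition cinner_prod :: "'a \<times> 'b \<Rightarrow> 'a \<times> 'b \<Rightarrow> complex"
  where "cinner_prod x y = cinner (fst x) (fst y) + cinner (snd x) (snd y)"
instance
proof
  fix x y z :: "'a \<times> 'b" and c :: complex
  show "cinner x y = cnj (cinner y x)"
    by (simp add: cinner_prod_def flip: cinner_commute)
  show "cinner (x + y) z = cinner x z + cinner y z"
    by (simp add: cinner_prod_def cinner_add_left)
  show "cinner (c *\<^sub>C x) y = cnj c * cinner x y"
    by (simp add: cinner_prod_def scaleC_prod_def cinner_scaleC_left distrib_left)
  show "inner x y = Re (cinner x y)"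
    by (simp add: cinner_prod_def inner_prod_def inner_eq_Re_cinner)
qed
end

instance prod :: (complex_hilbert, complex_hilbert) complex_hilbert ..


section \<open>Hilbert direct sums of copies of a space\<close>

text \<open>The square-summable families indexed by \<open>'i\<close>. This is the Hilbert space
  \<open>\<Oplus>\<^sub>i 'a = 'a \<otimes> \<ell>\<^sup>2('i)\<close>.\<close>

typedef (overloaded) ('i, 'a::complex_inner) l2 =
  "{f :: 'i \<Rightarrow> 'a. (\<lambda>i. (norm (f i))\<^sup>2) summable_on UNIV}"
  morphisms coord Abs_l2
  by (rule exI[of _ "\<lambda>_. 0"]) simp

setup_lifting type_definition_l2

lemma l2_eqI: "(\<And>i. coord x i = coord y i) \<Longrightarrow> x = y"
  by (metis coord_inject ext)

lemma summable_coord: "(\<lambda>i. (norm (coord x i))\<^sup>2) summable_on UNIV"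
  using coord[of x] by simp

lemma coord_Abs_l2: "(\<lambda>i. (norm (f i))\<^sup>2) summable_on UNIV \<Longrightarrow> coord (Abs_l2 f) = f"
  by (simp add: Abs_l2_inverse)

lemma norm_add_sq_le: "(norm (a + b))\<^sup>2 \<le> 2 * (norm a)\<^sup>2 + 2 * (norm (b::'a::real_inner))\<^sup>2"
proof -
  have "(norm (a + b))\<^sup>2 \<le> (norm a + norm b)\<^sup>2"
    by (simp add: norm_triangle_ineq power_mono)
  also have "\<dots> \<le> 2 * (norm a)\<^sup>2 + 2 * (norm b)\<^sup>2"
    using sum_squares_bound[of "norm a" "norm b"] by (simp add: power2_sum)
  finally show ?thesis .
qed

lemma summable_sq_add:
  fixes f g :: "'i \<Rightarrow> 'a::real_inner"
  assumes "(\<lambda>i. (norm (f i))\<^sup>2) summable_on UNIV" "(\<lambda>i. (norm (g i))\<^sup>2) summable_on UNIV"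
  shows "(\<lambda>i. (norm (f i + g i))\<^sup>2) summable_on UNIV"
proof (rule summable_on_comparison_test)
  show "(\<lambda>i. 2 * (norm (f i))\<^sup>2 + 2 * (norm (g i))\<^sup>2) summable_on UNIV"
    by (intro summable_on_add summable_on_cmult_right assms)
qed (auto simp: norm_add_sq_le)

lemma summable_cinner:
  fixes f g :: "'i \<Rightarrow> 'a::complex_inner"
  assumes "(\<lambda>i. (norm (f i))\<^sup>2) summable_on UNIV" "(\<lambda>i. (norm (g i))\<^sup>2) summable_on UNIV"
  shows "(\<lambda>i. cinner (f i) (g i)) summable_on UNIV"
proof (rule Infinite_Sum.abs_summable_summable)
  have "cmod (cinner (f i) (g i)) \<le> (norm (f i))\<^sup>2 + (norm (g i))\<^sup>2" for i
  proof -
    have "cmod (cinner (f i) (g i)) \<le> norm (f i) * norm (g i)" by (rule cmod_cinner_le)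
    also have "\<dots> \<le> (norm (f i))\<^sup>2 + (norm (g i))\<^sup>2"
      using sum_squares_bound[of "norm (f i)" "norm (g i)"]
        mult_nonneg_nonneg[OF norm_ge_zero[of "f i"] norm_ge_zero[of "g i"]]
      by linarith
    finally show ?thesis .
  qed
  then show "(\<lambda>i. norm (cinner (f i) (g i))) summable_on UNIV"
    by (intro summable_on_comparison_test[OF summable_on_add[OF assms]]) auto
qed

instantiation l2 :: (type, complex_inner) complex_inner
begin

lift_definition zero_l2 :: "('a, 'b) l2" is "\<lambda>_. 0" by simp

lift_definition plus_l2 :: "('a, 'b) l2 \<Rightarrow> ('a, 'b) l2 \<Rightarrow> ('a, 'b) l2"
  is "\<lambda>f g i. f i + g i" by (rule summable_sq_add)

lift_definition uminus_l2 :: "('a, 'b) l2 \<Rightarrow> ('a, 'b) l2"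
  is "\<lambda>f i. - f i" by simp

lift_definition minus_l2 :: "('a, 'b) l2 \<Rightarrow> ('a, 'b) l2 \<Rightarrow> ('a, 'b) l2"
  is "\<lambda>f g i. f i - g i"
  subgoal for f g using summable_sq_add[of f "\<lambda>i. - g i"] by simp
  done

lift_definition scaleC_l2 :: "complex \<Rightarrow> ('a, 'b) l2 \<Rightarrow> ('a, 'b) l2"
  is "\<lambda>c f i. c *\<^sub>C f i"
  by (simp add: norm_scaleC power_mult_distrib summable_on_cmult_right)

definition scaleR_l2 :: "real \<Rightarrow> ('a, 'b) l2 \<Rightarrow> ('a, 'b) l2"
  where "scaleR_l2 r x = of_real r *\<^sub>C x"

definition cinner_l2 :: "('a, 'b) l2 \<Rightarrow> ('a, 'b) l2 \<Rightarrow> complex"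
  where "cinner_l2 x y = (\<Sum>\<^sub>\<infinity>i. cinner (coord x i) (coord y i))"

definition inner_l2 :: "('a, 'b) l2 \<Rightarrow> ('a, 'b) l2 \<Rightarrow> real"
  where "inner_l2 x y = Re (cinner x y)"

definition norm_l2 :: "('a, 'b) l2 \<Rightarrow> real"
  where "norm_l2 x = sqrt (inner x x)"

definition sgn_l2 :: "('a, 'b) l2 \<Rightarrow> ('a, 'b) l2"
  where "sgn_l2 x = scaleR (inverse (norm x)) x"

definition dist_l2 :: "('a, 'b) l2 \<Rightarrow> ('a, 'b) l2 \<Rightarrow> real"
  where "dist_l2 x y = norm (x - y)"

definition uniformity_l2 :: "(('a, 'b) l2 \<times> ('a, 'b) l2) filter"
  where "uniformity_l2 = (INF e\<in>{0 <..}. principal {(x, y). dist x y < e})"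

definition open_l2 :: "('a, 'b) l2 set \<Rightarrow> bool"
  where "open_l2 U = (\<forall>x\<in>U. \<forall>\<^sub>F (x', y) in uniformity. x' = x \<longrightarrow> y \<in> U)"

instance
proof
  fix x y z :: "('a, 'b) l2" and a b :: complex and r s :: real
  note [simp] = zero_l2.rep_eq plus_l2.rep_eq uminus_l2.rep_eq minus_l2.rep_eq scaleC_l2.rep_eq
  have sm: "(\<lambda>i. cinner (coord u i) (coord v i)) summable_on UNIV" for u v :: "('a, 'b) l2"
    by (intro summable_cinner summable_coord)
  have self: "inner x x = (\<Sum>\<^sub>\<infinity>i. (norm (coord x i))\<^sup>2)"
    unfolding inner_l2_def cinner_l2_def infsum_Re[OF sm, symmetric] by (simp only: cinner_self Re_complex_of_real)
  have comm: "cinner u v = cnj (cinner v u)" for u v :: "('a, 'b) l2"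
    by (simp add: cinner_l2_def flip: infsum_cnj cinner_commute)
  have addl: "cinner (u + v) w = cinner u w + cinner v w" for u v w :: "('a, 'b) l2"
    by (simp add: cinner_l2_def cinner_add_left infsum_add sm)
  have scl: "cinner (c *\<^sub>C u) v = cnj c * cinner u v" for c and u v :: "('a, 'b) l2"
    by (simp add: cinner_l2_def cinner_scaleC_left infsum_cmult_right sm)
  show "x + y + z = x + (y + z)" by (rule l2_eqI) (simp add: add.assoc)
  show "x + y = y + x" by (rule l2_eqI) (simp add: add.commute)
  show "0 + x = x" by (rule l2_eqI) simp
  show "- x + x = 0" by (rule l2_eqI) simp
  show "x - y = x + - y" by (rule l2_eqI) simp
  show "r *\<^sub>R (x + y) = r *\<^sub>R x + r *\<^sub>R y"
    by (rule l2_eqI) (simp add: scaleR_l2_def scaleC_add_right)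
  show "(r + s) *\<^sub>R x = r *\<^sub>R x + s *\<^sub>R x"
    by (rule l2_eqI) (simp add: scaleR_l2_def scaleC_add_left)
  show "r *\<^sub>R s *\<^sub>R x = (r * s) *\<^sub>R x"
    by (rule l2_eqI) (simp add: scaleR_l2_def scaleC_scaleC)
  show "1 *\<^sub>R x = x"
    by (rule l2_eqI) (simp add: scaleR_l2_def)
  show "a *\<^sub>C (x + y) = a *\<^sub>C x + a *\<^sub>C y"
    by (rule l2_eqI) (simp add: scaleC_add_right)
  show "(a + b) *\<^sub>C x = a *\<^sub>C x + b *\<^sub>C x"
    by (rule l2_eqI) (simp add: scaleC_add_left)
  show "a *\<^sub>C b *\<^sub>C x = (a * b) *\<^sub>C x"
    by (rule l2_eqI) (simp add: scaleC_scaleC)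
  show "r *\<^sub>R x = of_real r *\<^sub>C x" by (rule scaleR_l2_def)
  show "sgn x = scaleR (inverse (norm x)) x" by (rule sgn_l2_def)
  show "dist x y = norm (x - y)" by (rule dist_l2_def)
  show "uniformity = (INF e\<in>{0 <..}. principal {(x, y :: ('a, 'b) l2). dist x y < e})"
    by (rule uniformity_l2_def)
  show "open U = (\<forall>x\<in>U. \<forall>\<^sub>F (x', y) in uniformity. x' = x \<longrightarrow> y \<in> U)" for U :: "('a, 'b) l2 set"
    by (rule open_l2_def)
  show "inner x y = inner y x"
    by (simp add: inner_l2_def comm[of x y])
  show "inner (x + y) z = inner x z + inner y z"
    by (simp add: inner_l2_def addl)
  show "inner (r *\<^sub>R x) y = r * inner x y"
    by (simp add: inner_l2_def scaleR_l2_def scl)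
  show "0 \<le> inner x x"
    unfolding self by (rule infsum_nonneg) simp
  show "(inner x x = 0) = (x = 0)"
  proof
    assume "inner x x = 0"
    then have "(norm (coord x i))\<^sup>2 = 0" for i
      using nonneg_infsum_le_0D[of "\<lambda>i. (norm (coord x i))\<^sup>2" UNIV i] summable_coord[of x]
      unfolding self by simp
    then show "x = 0" by (intro l2_eqI) simp
  next
    assume "x = 0"
    then show "inner x x = 0" unfolding self by simp
  qed
  show "norm x = sqrt (inner x x)" by (rule norm_l2_def)
  show "cinner x y = cnj (cinner y x)" by (rule comm)
  show "cinner (x + y) z = cinner x z + cinner y z" by (rule addl)
  show "cinner (a *\<^sub>C x) y = cnj a * cinner x y" by (rule scl)
  show "inner x y = Re (cinner x y)" by (rule inner_l2_def)
qed

end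

lemma norm_l2_sq: "(norm x)\<^sup>2 = (\<Sum>\<^sub>\<infinity>i. (norm (coord x i))\<^sup>2)"
proof -
  have "(\<lambda>i. cinner (coord x i) (coord x i)) summable_on UNIV"
    by (intro summable_cinner summable_coord)
  then have "(\<Sum>\<^sub>\<infinity>i. Re (cinner (coord x i) (coord x i))) = Re (cinner x x)"
    unfolding cinner_l2_def by (rule infsum_Re)
  then show ?thesis by (simp only: cinner_self Re_complex_of_real)
qed

lemma sum_coord_le: "finite F \<Longrightarrow> (\<Sum>i\<in>F. (norm (coord x i))\<^sup>2) \<le> (norm x)\<^sup>2"
  unfolding norm_l2_sq by (rule finite_sum_le_infsum) (auto simp: summable_coord)

lemma norm_coord_le: "norm (coord x i) \<le> norm x"
  using sum_coord_le[of "{i}" x] by (simp add: power2_le_iff_abs_le)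

instance l2 :: (type, complex_hilbert) complex_hilbert
proof
  fix X :: "nat \<Rightarrow> ('a, 'b) l2"
  assume X: "Cauchy X"
  have "Cauchy (\<lambda>n. coord (X n) i)" for i
  proof (rule metric_CauchyI)
    fix e :: real assume "0 < e"
    with X obtain M where M: "\<And>m n. m \<ge> M \<Longrightarrow> n \<ge> M \<Longrightarrow> dist (X m) (X n) < e"
      unfolding Cauchy_def by blast
    show "\<exists>M. \<forall>m\<ge>M. \<forall>n\<ge>M. dist (coord (X m) i) (coord (X n) i) < e"
    proof (intro exI allI impI)
      fix m n assume "m \<ge> M" "n \<ge> M"
      then show "dist (coord (X m) i) (coord (X n) i) < e"
        using M[of m n] norm_coord_le[of "X m - X n" i]
        by (simp add: dist_norm minus_l2.rep_eq)
    qed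
  qed
  then have "\<exists>l. (\<lambda>n. coord (X n) i) \<longlonglongrightarrow> l" for i
    by (metis Cauchy_convergent convergent_def)
  then obtain g where g: "\<And>i. (\<lambda>n. coord (X n) i) \<longlonglongrightarrow> g i" by metis
  have bound: "\<exists>M. \<forall>m\<ge>M. \<forall>F. finite F \<longrightarrow> (\<Sum>i\<in>F. (norm (coord (X m) i - g i))\<^sup>2) \<le> e\<^sup>2"
    if "0 < e" for e :: real
  proof -
    from X that obtain M where M: "\<And>m n. m \<ge> M \<Longrightarrow> n \<ge> M \<Longrightarrow> dist (X m) (X n) < e"
      unfolding Cauchy_def by blast
    show ?thesis
    proof (intro exI allI impI)
      fix m and F :: "'a set" assume m: "m \<ge> M" and F: "finite F"
      show "(\<Sum>i\<in>F. (norm (coord (X m) i - g i))\<^sup>2) \<le> e\<^sup>2"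
      proof (rule LIMSEQ_le_const2)
        show "(\<lambda>n. \<Sum>i\<in>F. (norm (coord (X m) i - coord (X n) i))\<^sup>2)
            \<longlonglongrightarrow> (\<Sum>i\<in>F. (norm (coord (X m) i - g i))\<^sup>2)"
          by (intro tendsto_intros g)
        show "\<exists>N. \<forall>n\<ge>N. (\<Sum>i\<in>F. (norm (coord (X m) i - coord (X n) i))\<^sup>2) \<le> e\<^sup>2"
        proof (intro exI allI impI)
          fix n assume "n \<ge> M"
          then have "(norm (X m - X n))\<^sup>2 \<le> e\<^sup>2"
            using M[OF m, of n] by (simp add: dist_norm power_mono)
          then show "(\<Sum>i\<in>F. (norm (coord (X m) i - coord (X n) i))\<^sup>2) \<le> e\<^sup>2"
            using sum_coord_le[OF F, of "X m - X n"] by (simp add: minus_l2.rep_eq)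
        qed
      qed
    qed
  qed
  have diff: "(\<lambda>i. (norm (coord (X m) i - g i))\<^sup>2) summable_on UNIV"
    if "\<forall>F. finite F \<longrightarrow> (\<Sum>i\<in>F. (norm (coord (X m) i - g i))\<^sup>2) \<le> e\<^sup>2" for m e
    by (rule nonneg_bdd_above_summable_on) (use that in \<open>auto intro!: bdd_aboveI[of _ "e\<^sup>2"]\<close>)
  obtain M where M: "\<forall>F. finite F \<longrightarrow> (\<Sum>i\<in>F. (norm (coord (X M) i - g i))\<^sup>2) \<le> 1\<^sup>2"
    using bound[of 1] by auto
  have "(\<lambda>i. (norm (coord (X M) i + - (coord (X M) i - g i)))\<^sup>2) summable_on UNIV"
    by (rule summable_sq_add[OF summable_coord]) (use diff[OF M] in \<open>simp only: norm_minus_cancel\<close>)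
  then have gs: "(\<lambda>i. (norm (g i))\<^sup>2) summable_on UNIV" by simp
  have "X \<longlonglongrightarrow> Abs_l2 g"
  proof (rule metric_LIMSEQ_I)
    fix r :: real assume r: "0 < r"
    then obtain N where
      N: "\<And>m. m \<ge> N \<Longrightarrow> \<forall>F. finite F \<longrightarrow> (\<Sum>i\<in>F. (norm (coord (X m) i - g i))\<^sup>2) \<le> (r/2)\<^sup>2"
      using bound[of "r/2"] by auto
    show "\<exists>no. \<forall>n\<ge>no. dist (X n) (Abs_l2 g) < r"
    proof (intro exI allI impI)
      fix n assume n: "n \<ge> N"
      have "(norm (X n - Abs_l2 g))\<^sup>2 \<le> (r/2)\<^sup>2"
        unfolding norm_l2_sq minus_l2.rep_eq coord_Abs_l2[OF gs]
        by (rule infsum_le_finite_sums[OF diff[OF N[OF n]]]) (use N[OF n] in auto)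
      then have "norm (X n - Abs_l2 g) \<le> r/2"
        using r by (simp add: power2_le_iff_abs_le)
      then show "dist (X n) (Abs_l2 g) < r" using r by (simp add: dist_norm)
    qed
  qed
  then show "convergent X" by (rule convergentI)
qed

definition single :: "'i \<Rightarrow> 'a \<Rightarrow> ('i, 'a::complex_inner) l2"
  where "single i x = Abs_l2 (\<lambda>j. if j = i then x else 0)"

definition l2_map :: "('a \<Rightarrow> 'b) \<Rightarrow> ('i, 'a::complex_inner) l2 \<Rightarrow> ('i, 'b::complex_inner) l2"
  where "l2_map f x = Abs_l2 (\<lambda>i. f (coord x i))"

definition l2_of :: "'a set \<Rightarrow> ('i, 'a::complex_inner) l2 set"
  where "l2_of S = {x. \<forall>i. coord x i \<in> S}"


section \<open>Operators between closed subspaces\<close>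

text \<open>Hilbert spaces are represented as closed complex subspaces of types of class
  \<^class>\<open>complex_hilbert\<close>, and operators as functions of which only the values on the stated
  domain matter.\<close>

definition clinear_on :: "'a::complex_vector set \<Rightarrow> ('a \<Rightarrow> 'b::complex_vector) \<Rightarrow> bool"
  where "clinear_on A f \<longleftrightarrow>
    (\<forall>x\<in>A. \<forall>y\<in>A. f (x + y) = f x + f y) \<and> (\<forall>c. \<forall>x\<in>A. f (c *\<^sub>C x) = c *\<^sub>C f x)"

definition contraction ::
  "'a::complex_inner set \<Rightarrow> 'b::complex_inner set \<Rightarrow> ('a \<Rightarrow> 'b) \<Rightarrow> bool"
  where "contraction A B t \<longleftrightarrow> clinear_on A t \<and> t ` A \<subseteq> B \<and> (\<forall>x\<in>A. norm (t x) \<le> norm x)"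

definition isometric ::
  "'a::complex_inner set \<Rightarrow> 'b::complex_inner set \<Rightarrow> ('a \<Rightarrow> 'b) \<Rightarrow> bool"
  where "isometric A B t \<longleftrightarrow> clinear_on A t \<and> t ` A \<subseteq> B \<and> (\<forall>x\<in>A. norm (t x) = norm x)"

definition unitary ::
  "'a::complex_inner set \<Rightarrow> 'b::complex_inner set \<Rightarrow> ('a \<Rightarrow> 'b) \<Rightarrow> bool"
  where "unitary A B t \<longleftrightarrow> isometric A B t \<and> t ` A = B"

definition adj :: "'a::complex_inner set \<Rightarrow> ('a \<Rightarrow> 'b::complex_inner) \<Rightarrow> 'b \<Rightarrow> 'a"
  where "adj A t y = (THE x. x \<in> A \<and> (\<forall>a\<in>A. cinner a x = cinner (t a) y))"

definition coisometric ::
  "'a::complex_inner set \<Rightarrow> 'b::complex_inner set \<Rightarrow> ('a \<Rightarrow> 'b) \<Rightarrow> bool"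
  where "coisometric A B t \<longleftrightarrow> contraction A B t \<and> isometric B A (adj A t)"

definition proj :: "'a::complex_inner set \<Rightarrow> 'a \<Rightarrow> 'a"
  where "proj S x = (THE y. y \<in> S \<and> (\<forall>s\<in>S. cinner s (x - y) = 0))"

definition ominus :: "'a::complex_inner set \<Rightarrow> 'a set \<Rightarrow> 'a set"  (infixl \<open>\<ominus>\<close> 65)
  where "S \<ominus> T = {x \<in> S. \<forall>y\<in>T. cinner y x = 0}"

definition ccspan :: "'a::complex_inner set \<Rightarrow> 'a set"
  where "ccspan S = closure (cspan S)"

definition positive_on :: "'a::complex_inner set \<Rightarrow> ('a \<Rightarrow> 'a) \<Rightarrow> bool"
  where "positive_on S R \<longleftrightarrow> clinear_on S R \<and> R ` S \<subseteq> S \<and>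
    (\<exists>c. \<forall>x\<in>S. norm (R x) \<le> c * norm x) \<and>
    (\<forall>x\<in>S. Im (cinner x (R x)) = 0 \<and> 0 \<le> Re (cinner x (R x)))"

text \<open>The positive square root; extensionality makes it unique as a function.\<close>

definition op_sqrt :: "'a::complex_inner set \<Rightarrow> ('a \<Rightarrow> 'a) \<Rightarrow> 'a \<Rightarrow> 'a"
  where "op_sqrt S T =
    (THE R. R \<in> extensional S \<and> positive_on S R \<and> (\<forall>x\<in>S. R (R x) = T x))"


section \<open>Processes\<close>

text \<open>The orthonormal basis identifies the multiplicity space \<open>\<P>\<close> with \<open>\<ell>\<^sup>2('d)\<close>, where the type
  \<open>'d\<close> of letters is finite or countably infinite, and hence \<open>\<H> \<otimes> \<P>\<close> with \<^term>\<open>l2_of \<H>\<close>, where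
  \<open>\<xi> \<otimes> \<epsilon>\<^sub>k\<close> becomes \<^term>\<open>single k \<xi>\<close>. Words are lists of letters.\<close>

record (overloaded) ('d, 'h::complex_inner) process =
  hspace :: "'h set"
  row :: "('d, 'h) l2 \<Rightarrow> 'h"
  base :: "'h set"

definition letter :: "('d, 'h::complex_inner) process \<Rightarrow> 'd \<Rightarrow> 'h \<Rightarrow> 'h"
  where "letter X k \<xi> = row X (single k \<xi>)"

definition word :: "('d, 'h::complex_inner) process \<Rightarrow> 'd list \<Rightarrow> 'h \<Rightarrow> 'h"
  where "word X \<alpha> = foldr (letter X) \<alpha>"

definition coinvariant :: "('d, 'h::complex_inner) process \<Rightarrow> 'h set \<Rightarrow> bool"
  where "coinvariant X S \<longleftrightarrow> (\<forall>k. adj (hspace X) (letter X k) ` S \<subseteq> S)"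

definition generated :: "('d, 'h::complex_inner) process \<Rightarrow> 'h set \<Rightarrow> 'h set"
  where "generated X S = ccspan (\<Union>\<alpha>. word X \<alpha> ` S)"

definition is_process :: "('d, 'h::complex_hilbert) process \<Rightarrow> bool"
  where "is_process X \<longleftrightarrow>
    csubspace (hspace X) \<and> closed (hspace X) \<and> separable_space (top_of_set (hspace X)) \<and>
    isometric (l2_of (hspace X)) (hspace X) (row X) \<and>
    csubspace (base X) \<and> closed (base X) \<and> base X \<subseteq> hspace X \<and>
    coinvariant X (base X) \<and>
    hspace X = generated X (base X)"

definition subprocess_base :: "('d, 'h::complex_hilbert) process \<Rightarrow> 'h set \<Rightarrow> bool"
  where "subprocess_base X S \<longleftrightarrow>
    csubspace S \<and> closed S \<and> S \<subseteq> base X \<and> coinvariant X S"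

definition subprocess :: "('d, 'h::complex_hilbert) process \<Rightarrow> 'h set \<Rightarrow> ('d, 'h) process"
  where "subprocess X S = \<lparr>hspace = generated X S, row = row X, base = S\<rparr>"

definition quotient_process :: "('d, 'h::complex_hilbert) process \<Rightarrow> 'h set \<Rightarrow> ('d, 'h) process"
  where "quotient_process X S =
    \<lparr>hspace = generated X (base X \<ominus> S), row = row X, base = base X \<ominus> S\<rparr>"

text \<open>\<open>U\<close> identifies the triples \<open>R\<close> and \<open>S\<close> on the level of the large Hilbert spaces.\<close>

definition identifies ::
  "('d, 'a::complex_hilbert) process \<Rightarrow> ('d, 'b::complex_hilbert) process \<Rightarrow> ('a \<Rightarrow> 'b) \<Rightarrow> bool"
  where "identifies R S U \<longleftrightarrow>
    unitary (hspace R) (hspace S) U \<and> U ` base R = base S \<and>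
    (\<forall>x\<in>l2_of (hspace R). U (row R x) = row S (l2_map U x))"


section \<open>The category of processes\<close>

definition morphism ::
  "('d, 'r::complex_hilbert) process \<Rightarrow> ('d, 's::complex_hilbert) process \<Rightarrow> ('r \<Rightarrow> 's) \<Rightarrow> bool"
  where "morphism R S t \<longleftrightarrow> contraction (base R) (base S) t \<and>
    (\<forall>k. \<forall>x\<in>base R. adj (hspace S) (letter S k) (t x) = t (adj (hspace R) (letter R k) x))"

definition isomorphism ::
  "('d, 'r::complex_hilbert) process \<Rightarrow> ('d, 's::complex_hilbert) process \<Rightarrow> ('r \<Rightarrow> 's) \<Rightarrow> bool"
  where "isomorphism R S t \<longleftrightarrow> morphism R S t \<and> unitary (base R) (base S) t"

definition short_exact ::
  "('d, 'g::complex_hilbert) process \<Rightarrow> ('g \<Rightarrow> 'h) \<Rightarrow> ('d, 'h::complex_hilbert) process \<Rightarrow>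
    ('h \<Rightarrow> 'k) \<Rightarrow> ('d, 'k::complex_hilbert) process \<Rightarrow> bool"
  where "short_exact G i H p K \<longleftrightarrow>
    is_process G \<and> is_process H \<and> is_process K \<and>
    morphism G H i \<and> isometric (base G) (base H) i \<and>
    morphism H K p \<and> coisometric (base H) (base K) p \<and>
    i ` base G = {x \<in> base H. p x = 0}"

definition extension_equivalence ::
  "('d, 'g::complex_hilbert) process \<Rightarrow>
    ('g \<Rightarrow> 'a) \<Rightarrow> ('d, 'a::complex_hilbert) process \<Rightarrow> ('a \<Rightarrow> 'k) \<Rightarrow>
    ('g \<Rightarrow> 'b) \<Rightarrow> ('d, 'b::complex_hilbert) process \<Rightarrow> ('b \<Rightarrow> 'k) \<Rightarrow> ('a \<Rightarrow> 'b) \<Rightarrow> bool"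
  where "extension_equivalence G i1 H1 p1 i2 H2 p2 j \<longleftrightarrow>
    isomorphism H1 H2 j \<and>
    (\<forall>x\<in>base G. j (i1 x) = i2 x) \<and> (\<forall>y\<in>base H1. p2 (j y) = p1 y)"


section \<open>The \<open>\<gamma>\<close>-extension\<close>

definition \<E> :: "('d, 'h::complex_hilbert) process \<Rightarrow> 'h set"
  where "\<E> X = ccspan (base X \<union> row X ` l2_of (base X)) \<ominus> base X"

definition \<E>_star :: "('d, 'h::complex_hilbert) process \<Rightarrow> 'h set"
  where "\<E>_star X = ccspan (base X \<union> row X ` l2_of (base X)) \<ominus> row X ` l2_of (base X)"

definition \<gamma>_adj ::
  "('d, 'k::complex_hilbert) process \<Rightarrow> ('k \<Rightarrow> 'g::complex_hilbert) \<Rightarrow> 'g \<Rightarrow> 'k"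
  where "\<gamma>_adj K \<gamma> = adj (\<E>_star K) \<gamma>"

definition defect_op ::
  "('d, 'g::complex_hilbert) process \<Rightarrow> ('d, 'k::complex_hilbert) process \<Rightarrow> ('k \<Rightarrow> 'g) \<Rightarrow> 'g \<Rightarrow> 'g"
  where "defect_op G K \<gamma> = op_sqrt (\<E> G) (\<lambda>e. e - \<gamma> (\<gamma>_adj K \<gamma> e))"

definition defect_space ::
  "('d, 'g::complex_hilbert) process \<Rightarrow> ('d, 'k::complex_hilbert) process \<Rightarrow> ('k \<Rightarrow> 'g) \<Rightarrow> 'g set"
  where "defect_space G K \<gamma> = closure (defect_op G K \<gamma> ` \<E> G)"

text \<open>In an element \<open>(x, y, z)\<close> of the large space, \<open>z\<close> collects the components in the copies of
  the defect space. The row operator decomposes its value \<open>w\<close> of \<open>V\<^sup>\<G>\<close> as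
  \<open>P\<^sub>\<gg> w + P\<^sub>\<E> w\<close>; in its last component, the empty word carries the contribution of the defect
  operator and the word \<open>k # \<beta>\<close> that of the row shift.\<close>

definition \<gamma>_extension ::
  "('d, 'g::complex_hilbert) process \<Rightarrow> ('d, 'k::complex_hilbert) process \<Rightarrow> ('k \<Rightarrow> 'g) \<Rightarrow>
    ('d, 'g \<times> 'k \<times> ('d list, 'g) l2) process"
  where "\<gamma>_extension G K \<gamma> =
    \<lparr>hspace = {(x, y, z). x \<in> base G \<and> y \<in> hspace K \<and> z \<in> l2_of (defect_space G K \<gamma>)},
     row = (\<lambda>\<Xi>. let w = row G (l2_map fst \<Xi>); e = proj (\<E> G) w in
       (proj (base G) w,
        \<gamma>_adj K \<gamma> e + row K (l2_map (\<lambda>(x, y, z). y) \<Xi>),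
        Abs_l2 (\<lambda>\<alpha>. case \<alpha> of
            [] \<Rightarrow> defect_op G K \<gamma> e
          | k # \<beta> \<Rightarrow> coord (snd (snd (coord \<Xi> k))) \<beta>))),
     base = {(x, y, z). x \<in> base G \<and> y \<in> base K \<and> z = 0}\<rparr>"

definition emb_g :: "'g::complex_hilbert \<Rightarrow> 'g \<times> 'k::complex_hilbert \<times> ('d list, 'g) l2"
  where "emb_g x = (x, 0, 0)"

definition emb_K :: "'k::complex_hilbert \<Rightarrow> 'g::complex_hilbert \<times> 'k \<times> ('d list, 'g) l2"
  where "emb_K y = (0, y, 0)"

definition proj_k :: "'g::complex_hilbert \<times> 'k::complex_hilbert \<times> ('d list, 'g) l2 \<Rightarrow> 'k"
  where "proj_k = (\<lambda>(x, y, z). y)"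

text \<open>The identification of \<open>\<G>\<close> with the closed span of the \<open>V\<^sub>\<alpha> \<gg>\<close> inside the \<open>\<gamma>\<close>-extension.\<close>

definition \<gamma>_identification ::
  "('d, 'g::complex_hilbert) process \<Rightarrow> ('d, 'k::complex_hilbert) process \<Rightarrow> ('k \<Rightarrow> 'g) \<Rightarrow>
    ('g \<Rightarrow> 'g \<times> 'k \<times> ('d list, 'g) l2) \<Rightarrow> bool"
  where "\<gamma>_identification G K \<gamma> U \<longleftrightarrow>
    unitary (hspace G) (generated (\<gamma>_extension G K \<gamma>) (emb_g ` base G)) U \<and>
    (\<forall>x\<in>base G. U x = emb_g x) \<and>
    (\<forall>e\<in>\<E> G. \<forall>\<alpha>. U (word G \<alpha> e) =
      word (\<gamma>_extension G K \<gamma>) \<alpha> (0, \<gamma>_adj K \<gamma> e, single [] (defect_op G K \<gamma> e)))"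

end

theory Submission
  imports Defs
begin

text \<open>A row isometry \<open>V\<close> with orthogonal letters is controlled by its adjoints \<open>V\<^sub>k\<^sup>*\<close>: the space
  \<open>span(\<hh>, V(\<hh> \<otimes> \<P>))\<close> consists of the vectors that all \<open>V\<^sub>k\<^sup>*\<close> map into \<open>\<hh>\<close>, and \<open>\<E>\<^sub>*\<close> of those that
  all \<open>V\<^sub>k\<^sup>*\<close> annihilate. In the \<open>\<gamma>\<close>-extension this gives
  \<open>V\<^sub>k\<^sup>*(x \<oplus> y) = V\<^sub>k\<^sup>*(x + \<gamma> P y) \<oplus> V\<^sub>k\<^sup>* y\<close> on \<open>\<gg> \<oplus> \<kk>\<close>, where \<open>P\<close> is the projection onto \<open>\<E>\<^sub>*\<close>, so the
  process structure on the base spaces determines \<open>\<gamma>\<close>. Conversely, in an extension both \<open>\<G>\<close> and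
  \<open>\<K>\<close> embed isometrically, by \<open>U\<^sub>\<G>\<close> and \<open>U\<^sub>\<K>\<close>, because the Gram matrices of the vectors \<open>V\<^sub>\<alpha> x\<close>
  are determined on the base; then \<open>\<gamma> = U\<^sub>\<G>\<^sup>* U\<^sub>\<K>\<close> on \<open>\<E>\<^sub>*\<close>.\<close>

section \<open>Complex Hilbert spaces\<close>

text \<open>Equivalences act on base spaces only, so both comparisons reduce to the
  \<open>V_k^*\<close> on the bases; the large spaces enter through minimality: a vector orthogonal
  to the base and killed by all \<open>V_k^*\<close> is zero. The summand
  \<open>\<gamma> P y\<close> arises by moving \<gamma>^* and the projection onto
  \<open>\<E> G\<close> across the inner product; the defect part of the row drops out because base
  vectors have third component 0. The defect operator has other tasks: with \<gamma>^* it forms an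
  isometric column, so the new row is isometric, and the closure of its range is the shift space for
  which the extension is minimal. The adjoint formula pins down \<gamma> because only 0 in
  \<open>\<E> G\<close> is killed by all \<open>V_k^*\<close> and because the projected base of
  \<open>K\<close> spans a dense subspace of \<open>\<E>_star K\<close>. Adjoints, projections and
  square roots are definite descriptions relative to subspaces given as sets, so the Riesz
  representation and the existence and uniqueness of positive square roots are proved in that form
  first.\<close>

lemma bounded_bilinear_cinner: "bounded_bilinear (cinner :: 'a::complex_inner \<Rightarrow> 'a \<Rightarrow> complex)"
proof
  show "\<exists>K. \<forall>a b::'a. norm (cinner a b) \<le> norm a * norm b * K"
    by (rule exI[of _ 1]) (simp add: cmod_cinner_le)
qed (simp_all add: cinner_add_left cinner_add_right scaleR_scaleC cinner_scaleC_left
      cinner_scaleC_right scaleR_conv_of_real)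

interpretation cinner: bounded_bilinear "cinner :: 'a::complex_inner \<Rightarrow> 'a \<Rightarrow> complex"
  by (rule bounded_bilinear_cinner)

lemmas [simp] = cinner.zero_left cinner.zero_right

interpretation scaleC: bounded_bilinear "scaleC :: complex \<Rightarrow> 'a \<Rightarrow> 'a::complex_inner"
proof
  fix r :: real and a :: complex and b :: 'a
  show "(r *\<^sub>R a) *\<^sub>C b = r *\<^sub>R a *\<^sub>C b"
    by (simp add: scaleR_scaleC scaleC_scaleC scaleR_conv_of_real)
  show "a *\<^sub>C r *\<^sub>R b = r *\<^sub>R a *\<^sub>C b"
    by (simp add: scaleR_scaleC scaleC_scaleC mult.commute)
  show "\<exists>K. \<forall>a (b::'a). norm (a *\<^sub>C b) \<le> norm a * norm b * K"
    by (rule exI[of _ 1]) (simp add: norm_scaleC)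
qed (simp_all add: scaleC_add_right scaleC_add_left)

lemma Im_cinner: "Im (cinner x y) = inner (\<i> *\<^sub>C x) y"
  by (simp add: inner_eq_Re_cinner cinner_scaleC_left)

text \<open>Lets Riesz representation and polarization be carried out over the reals: the imaginary
  part of the inner product is the real inner product with \<i> times the first vector.\<close>

lemma cinner_eqI:
  assumes "inner x y = inner u v" "inner (\<i> *\<^sub>C x) y = inner (\<i> *\<^sub>C u) v"
  shows "cinner x y = cinner u v"
  using assms by (simp add: complex_eq_iff Im_cinner inner_eq_Re_cinner[symmetric])

lemma cinner_eq_0_commute: "cinner x y = 0 \<longleftrightarrow> cinner y x = 0"
  by (metis cinner_commute complex_cnj_zero)

lemma cinner_self_eq_0 [simp]: "cinner x x = 0 \<longleftrightarrow> x = 0"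
  by (simp add: cinner_self)

lemma csubspace_imp_subspace: "csubspace S \<Longrightarrow> subspace S"
  unfolding subspace_def complex_vector.subspace_def by (auto simp: scaleR_scaleC)

lemmas csubspace_intros =
  complex_vector.subspace_0 complex_vector.subspace_neg complex_vector.subspace_add complex_vector.subspace_diff
  complex_vector.subspace_scale

lemma csubspaceI:
  "0 \<in> S \<Longrightarrow> (\<And>x y. x \<in> S \<Longrightarrow> y \<in> S \<Longrightarrow> x + y \<in> S) \<Longrightarrow> (\<And>c x. x \<in> S \<Longrightarrow> c *\<^sub>C x \<in> S) \<Longrightarrow>
    csubspace S"
  by (auto simp: complex_vector.subspace_def)

lemma csubspace_closure:
  fixes S :: "'a::complex_inner set"
  assumes S: "csubspace S"
  shows "csubspace (closure S)"
proof (rule csubspaceI)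
  show "0 \<in> closure S"
    using S by (intro subsetD[OF closure_subset] complex_vector.subspace_0)
  fix x y assume "x \<in> closure S" "y \<in> closure S"
  then obtain X Y where "\<forall>n. X n \<in> S" "X \<longlonglongrightarrow> x" "\<forall>n. Y n \<in> S" "Y \<longlonglongrightarrow> y"
    by (auto simp: closure_sequential)
  then have "\<forall>n. X n + Y n \<in> S" "(\<lambda>n. X n + Y n) \<longlonglongrightarrow> x + y"
    using S by (simp_all add: csubspace_intros tendsto_add)
  then show "x + y \<in> closure S" unfolding closure_sequential by (intro exI conjI)
next
  fix c and x assume "x \<in> closure S"
  then obtain X where "\<forall>n. X n \<in> S" "X \<longlonglongrightarrow> x"
    by (auto simp: closure_sequential)
  then have "\<forall>n. c *\<^sub>C X n \<in> S" "(\<lambda>n. c *\<^sub>C X n) \<longlonglongrightarrow> c *\<^sub>C x"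
    using S by (simp_all add: csubspace_intros scaleC.tendsto)
  then show "c *\<^sub>C x \<in> closure S" unfolding closure_sequential by (intro exI conjI)
qed

lemma csubspace_ccspan [simp]: "csubspace (ccspan B)"
  unfolding ccspan_def by (rule csubspace_closure) (rule complex_vector.subspace_span)

lemma closed_ccspan [simp]: "closed (ccspan B)"
  by (simp add: ccspan_def)

lemma ccspan_superset: "B \<subseteq> ccspan B"
  unfolding ccspan_def using closure_subset complex_vector.span_superset by blast

lemma ccspan_minimal: "B \<subseteq> S \<Longrightarrow> csubspace S \<Longrightarrow> closed S \<Longrightarrow> ccspan B \<subseteq> S"
  unfolding ccspan_def by (intro closure_minimal complex_vector.span_minimal)

lemma ccspan_eqI: "B \<subseteq> S \<Longrightarrow> csubspace S \<Longrightarrow> closed S \<Longrightarrow> S \<subseteq> ccspan B \<Longrightarrow> ccspan B = S"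
  by (rule antisym[OF ccspan_minimal])

lemma csubspace_Int: "csubspace S \<Longrightarrow> csubspace T \<Longrightarrow> csubspace (S \<inter> T)"
  by (rule complex_vector.subspace_inter)

lemma csubspace_orth: "csubspace {x. \<forall>y\<in>T. cinner y x = 0}"
  by (rule csubspaceI) (auto simp: cinner_add_right cinner_scaleC_right)

lemma closed_orth: "closed {x. \<forall>y\<in>T. cinner y x = (0::complex)}"
proof -
  have "{x. \<forall>y\<in>T. cinner y x = (0::complex)} = (\<Inter>y\<in>T. {x. cinner y x = 0})" by auto
  also have "closed \<dots>"
    by (intro closed_INT ballI closed_Collect_eq cinner.continuous_on continuous_intros)
  finally show ?thesis .
qed

lemma ominus_eq: "S \<ominus> T = S \<inter> {x. \<forall>y\<in>T. cinner y x = 0}"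
  by (auto simp: ominus_def)

lemma csubspace_ominus: "csubspace S \<Longrightarrow> csubspace (S \<ominus> T)"
  unfolding ominus_eq by (intro csubspace_Int csubspace_orth)

lemma closed_ominus: "closed S \<Longrightarrow> closed (S \<ominus> T)"
  unfolding ominus_eq by (intro closed_Int closed_orth)

lemma orth_ccspan:
  assumes "x \<in> ccspan B" "\<And>b. b \<in> B \<Longrightarrow> cinner y b = 0"
  shows "cinner y x = 0"
proof -
  have "ccspan B \<subseteq> {x. \<forall>z\<in>{y}. cinner z x = 0}"
    by (rule ccspan_minimal[OF _ csubspace_orth closed_orth]) (use assms in auto)
  then show ?thesis using assms by auto
qed

subsection \<open>Bounded operators on subspaces\<close>

text \<open>Operators have arbitrary values off their domain, so boundedness is imposed on
  \<open>A\<close> only, and continuity is obtained along sequences in \<open>A\<close>.\<close>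

definition bclinear_on :: "'a::complex_inner set \<Rightarrow> ('a \<Rightarrow> 'b::complex_inner) \<Rightarrow> bool"
  where "bclinear_on A f \<longleftrightarrow> clinear_on A f \<and> (\<exists>c. \<forall>x\<in>A. norm (f x) \<le> c * norm x)"

lemma clinear_onI:
  "(\<And>x y. x \<in> A \<Longrightarrow> y \<in> A \<Longrightarrow> f (x + y) = f x + f y) \<Longrightarrow>
    (\<And>c x. x \<in> A \<Longrightarrow> f (c *\<^sub>C x) = c *\<^sub>C f x) \<Longrightarrow> clinear_on A f"
  by (auto simp: clinear_on_def)

lemma clinear_on_add: "clinear_on A f \<Longrightarrow> x \<in> A \<Longrightarrow> y \<in> A \<Longrightarrow> f (x + y) = f x + f y"
  by (auto simp: clinear_on_def)

lemma clinear_on_scaleC: "clinear_on A f \<Longrightarrow> x \<in> A \<Longrightarrow> f (c *\<^sub>C x) = c *\<^sub>C f x"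
  by (auto simp: clinear_on_def)

lemma clinear_on_zero: "clinear_on A f \<Longrightarrow> 0 \<in> A \<Longrightarrow> f 0 = 0"
  by (metis clinear_on_scaleC complex_vector.scale_zero_left)

lemma clinear_on_diff:
  assumes "clinear_on A f" "csubspace A" "x \<in> A" "y \<in> A"
  shows "f (x - y) = f x - f y"
proof -
  have "f ((x - y) + y) = f (x - y) + f y"
    using assms by (intro clinear_on_add[of A]) (auto intro: csubspace_intros)
  then show ?thesis by simp
qed

lemma clinear_on_scaleR: "clinear_on A f \<Longrightarrow> x \<in> A \<Longrightarrow> f (r *\<^sub>R x) = r *\<^sub>R f x"
  by (simp add: clinear_on_scaleC scaleR_scaleC)

lemma clinear_on_subset: "clinear_on A f \<Longrightarrow> B \<subseteq> A \<Longrightarrow> clinear_on B f"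
  unfolding clinear_on_def by blast

lemma clinear_on_compose:
  "clinear_on A f \<Longrightarrow> clinear_on B g \<Longrightarrow> f ` A \<subseteq> B \<Longrightarrow> clinear_on A (\<lambda>x. g (f x))"
  by (auto simp: clinear_on_def image_subset_iff)

lemma bclinear_onI: "clinear_on A f \<Longrightarrow> (\<And>x. x \<in> A \<Longrightarrow> norm (f x) \<le> c * norm x) \<Longrightarrow> bclinear_on A f"
  by (auto simp: bclinear_on_def)

lemma bclinear_on_imp_clinear_on: "bclinear_on A f \<Longrightarrow> clinear_on A f"
  by (simp add: bclinear_on_def)

text \<open>If \<open>A\<close> has no nonzero vector, the constant in \<open>bclinear_on\<close>
  may be negative; \<open>max c 0\<close> repairs this.\<close>

lemma bclinear_on_bound:
  assumes "bclinear_on A f"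
  shows "\<exists>c\<ge>0. \<forall>x\<in>A. norm (f x) \<le> c * norm x"
proof -
  from assms obtain c where c: "\<forall>x\<in>A. norm (f x) \<le> c * norm x"
    by (auto simp: bclinear_on_def)
  have "norm (f x) \<le> max c 0 * norm x" if "x \<in> A" for x
    using c[rule_format, OF that] mult_right_mono[of c "max c 0" "norm x"] by simp
  then show ?thesis by (intro exI[of _ "max c 0"]) auto
qed

lemma bclinear_on_subset: "bclinear_on A f \<Longrightarrow> B \<subseteq> A \<Longrightarrow> bclinear_on B f"
  using clinear_on_subset[of A f B] unfolding bclinear_on_def by blast

lemma bclinear_on_compose:
  assumes f: "bclinear_on A f" and g: "bclinear_on B g" and fA: "f ` A \<subseteq> B"
  shows "bclinear_on A (\<lambda>x. g (f x))"
proof -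
  obtain c where c: "c \<ge> 0" "\<And>x. x \<in> A \<Longrightarrow> norm (f x) \<le> c * norm x" using bclinear_on_bound[OF f] by blast
  obtain d where d: "d \<ge> 0" "\<And>x. x \<in> B \<Longrightarrow> norm (g x) \<le> d * norm x"
    using bclinear_on_bound[OF g] by blast
  show ?thesis
  proof (rule bclinear_onI)
    show "clinear_on A (\<lambda>x. g (f x))"
      by (rule clinear_on_compose[OF bclinear_on_imp_clinear_on[OF f]
            bclinear_on_imp_clinear_on[OF g] fA])
    fix x assume x: "x \<in> A"
    have "norm (g (f x)) \<le> d * norm (f x)" using fA x by (intro d(2)) (rule image_subset_iff[THEN iffD1, rule_format])
    also have "\<dots> \<le> d * (c * norm x)" using c(2)[OF x] d(1) by (rule mult_left_mono)
    finally show "norm (g (f x)) \<le> (d * c) * norm x" by (simp add: mult.assoc)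
  qed
qed

lemma bclinear_on_tendsto:
  assumes f: "bclinear_on A f" and A: "csubspace A" and X: "\<And>n. X n \<in> A" "x \<in> A" "X \<longlonglongrightarrow> x"
  shows "(\<lambda>n. f (X n)) \<longlonglongrightarrow> f x"
proof -
  obtain c where c: "c \<ge> 0" "\<And>x. x \<in> A \<Longrightarrow> norm (f x) \<le> c * norm x" using bclinear_on_bound[OF f] by blast
  have "(\<lambda>n. norm (X n - x)) \<longlonglongrightarrow> 0"
    using X(3) by (intro tendsto_norm_zero) (simp add: LIM_zero)
  then have "(\<lambda>n. c * norm (X n - x)) \<longlonglongrightarrow> 0" by (rule tendsto_mult_right_zero)
  moreover have "norm (f (X n) - f x) \<le> c * norm (X n - x)" for n
    using c(2)[of "X n - x"] X(1,2) A clinear_on_diff[of A f "X n" x] f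
    by (simp add: bclinear_on_def csubspace_intros)
  ultimately have "(\<lambda>n. f (X n) - f x) \<longlonglongrightarrow> 0"
    by (intro Lim_null_comparison[of "\<lambda>n. f (X n) - f x"] always_eventually) simp_all
  then show ?thesis by (simp add: LIM_zero_iff)
qed

lemma csubspace_vimage:
  assumes f: "clinear_on A f" and A: "csubspace A" and B: "csubspace B"
  shows "csubspace {x \<in> A. f x \<in> B}"
proof (rule csubspaceI)
  show "0 \<in> {x \<in> A. f x \<in> B}"
    using clinear_on_zero[OF f] A B by (simp add: csubspace_intros)
qed (use A B in \<open>auto intro: csubspace_intros simp: clinear_on_add[OF f] clinear_on_scaleC[OF f]\<close>)

lemma closed_vimage_bclinear:
  assumes f: "bclinear_on A f" and A: "csubspace A" "closed A" and B: "closed B"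
  shows "closed {x \<in> A. f x \<in> B}"
  unfolding closed_sequential_limits
proof (intro allI impI)
  fix X l assume X: "(\<forall>n. X n \<in> {x \<in> A. f x \<in> B}) \<and> X \<longlonglongrightarrow> l"
  then have l: "l \<in> A" using A(2) unfolding closed_sequential_limits by blast
  then have "(\<lambda>n. f (X n)) \<longlonglongrightarrow> f l"
    using X by (intro bclinear_on_tendsto[OF f A(1)]) auto
  moreover have "f (X n) \<in> B" for n using X by auto
  ultimately have "f l \<in> B" using closed_sequentially[OF B, of "\<lambda>n. f (X n)" "f l"] by simp
  with l show "l \<in> {x \<in> A. f x \<in> B}" by simp
qed

lemma bclinear_on_diff_fun:
  assumes f: "bclinear_on A f" and g: "bclinear_on A g"
  shows "bclinear_on A (\<lambda>x. f x - g x)"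
proof -
  obtain c where c: "c \<ge> 0" "\<And>x. x \<in> A \<Longrightarrow> norm (f x) \<le> c * norm x" using bclinear_on_bound[OF f] by blast
  obtain d where d: "d \<ge> 0" "\<And>x. x \<in> A \<Longrightarrow> norm (g x) \<le> d * norm x" using bclinear_on_bound[OF g] by blast
  show ?thesis
  proof (rule bclinear_onI)
    show "clinear_on A (\<lambda>x. f x - g x)"
      using f g by (auto simp: bclinear_on_def clinear_on_def complex_vector.scale_right_diff_distrib)
    show "norm (f x - g x) \<le> (c + d) * norm x" if "x \<in> A" for x
      using c(2)[OF that] d(2)[OF that] norm_triangle_ineq4[of "f x" "g x"] by (simp add: distrib_right)
  qed
qed

text \<open>The vectors of \<open>A\<close> on which \<open>f\<close> and \<open>g\<close> agree
  form a closed subspace, so agreement on generators suffices. Later identifications of operators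
  rest on this density argument.\<close>

lemma bclinear_on_eq_ccspan:
  assumes f: "bclinear_on A f" and g: "bclinear_on A g" and A: "csubspace A" "closed A"
    and B: "B \<subseteq> A" "\<And>b. b \<in> B \<Longrightarrow> f b = g b" and x: "x \<in> ccspan B"
  shows "f x = g x"
proof -
  have "ccspan B \<subseteq> {x \<in> A. f x - g x \<in> {0}}"
    using B A bclinear_on_diff_fun[OF f g]
    by (intro ccspan_minimal csubspace_vimage closed_vimage_bclinear)
       (auto simp: bclinear_on_def)
  then show ?thesis using x by auto
qed

lemma bclinear_on_image_ccspan:
  assumes f: "bclinear_on (ccspan B) f" and "f ` B \<subseteq> T" "csubspace T" "closed T"
  shows "f ` ccspan B \<subseteq> T"
proof -
  have "ccspan B \<subseteq> {x \<in> ccspan B. f x \<in> T}"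
    using assms ccspan_superset[of B]
    by (intro ccspan_minimal csubspace_vimage closed_vimage_bclinear)
       (auto simp: bclinear_on_def)
  then show ?thesis by auto
qed

lemma contraction_bclinear_on: "contraction A B f \<Longrightarrow> bclinear_on A f"
  by (rule bclinear_onI[of _ _ 1]) (auto simp: contraction_def)

lemma isometric_contraction: "isometric A B f \<Longrightarrow> contraction A B f"
  by (auto simp: contraction_def isometric_def)

lemma isometric_bclinear_on: "isometric A B f \<Longrightarrow> bclinear_on A f"
  by (intro contraction_bclinear_on isometric_contraction)

lemma isometric_in: "isometric A B f \<Longrightarrow> x \<in> A \<Longrightarrow> f x \<in> B"
  by (auto simp: isometric_def)

lemma contraction_in: "contraction A B f \<Longrightarrow> x \<in> A \<Longrightarrow> f x \<in> B"
  by (auto simp: contraction_def)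

lemma isometric_clinear_on: "isometric A B f \<Longrightarrow> clinear_on A f"
  by (auto simp: isometric_def)

text \<open>Polarization: norms of sums give the real part, and the same applied to \<i> times
  \<open>x\<close> gives the imaginary part.\<close>

lemma isometric_cinner:
  assumes f: "isometric A B f" and A: "csubspace A" and xy: "x \<in> A" "y \<in> A"
  shows "cinner (f x) (f y) = cinner x y"
proof -
  have L: "clinear_on A f" and N: "\<And>x. x \<in> A \<Longrightarrow> norm (f x) = norm x"
    using f by (auto simp: isometric_def)
  have R: "inner (f x) (f y) = inner x y" if "x \<in> A" "y \<in> A" for x y
  proof -
    have "(norm (f x + f y))\<^sup>2 = (norm (x + y))\<^sup>2"
      using N[of "x + y"] A that by (simp add: clinear_on_add[OF L] csubspace_intros)
    moreover have "inner (f x) (f x) = inner x x" "inner (f y) (f y) = inner y y"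
      using N that by (metis power2_norm_eq_inner)+
    ultimately show ?thesis
      by (simp add: power2_norm_eq_inner inner_simps inner_commute)
  qed
  have "inner (\<i> *\<^sub>C f x) (f y) = inner (\<i> *\<^sub>C x) y"
    using R[of "\<i> *\<^sub>C x" y] xy A by (simp add: clinear_on_scaleC[OF L] csubspace_intros)
  then show ?thesis using R[OF xy] by (intro cinner_eqI)
qed

text \<open>An isometry preserves distances, so a convergent sequence of images comes from a Cauchy
  sequence in the complete set \<open>A\<close>.\<close>

lemma closed_isometric_image:
  fixes f :: "'a::complex_hilbert \<Rightarrow> 'b::complex_inner"
  assumes f: "isometric A B f" and A: "csubspace A" "closed A"
  shows "closed (f ` A)"
  unfolding closed_sequential_limits
proof (intro allI impI)
  fix Y l assume Y: "(\<forall>n. Y n \<in> f ` A) \<and> Y \<longlonglongrightarrow> l"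
  then have "\<forall>n. \<exists>x. x \<in> A \<and> Y n = f x" by auto
  then obtain X where X: "\<And>n. X n \<in> A" "\<And>n. Y n = f (X n)" by metis
  have "dist (X m) (X n) = dist (Y m) (Y n)" for m n
  proof -
    have "norm (f (X m - X n)) = norm (X m - X n)"
      using f A X(1) by (simp add: isometric_def csubspace_intros)
    then show ?thesis
      using clinear_on_diff[of A f "X m" "X n"] f A X by (simp add: isometric_def dist_norm)
  qed
  moreover have "Cauchy Y" using Y by (auto intro: LIMSEQ_imp_Cauchy)
  ultimately have "Cauchy X" unfolding Cauchy_def by simp
  then obtain x where x: "X \<longlonglongrightarrow> x" using Cauchy_convergent convergent_def by blast
  then have "x \<in> A" using A(2) X(1) unfolding closed_sequential_limits by blast
  then have "Y \<longlonglongrightarrow> f x"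
    using bclinear_on_tendsto[OF isometric_bclinear_on[OF f] A(1) X(1) _ x] X(2)[abs_def] by simp
  then have "l = f x" using Y LIMSEQ_unique by blast
  with \<open>x \<in> A\<close> show "l \<in> f ` A" by simp
qed

lemma csubspace_image: "clinear_on A f \<Longrightarrow> csubspace A \<Longrightarrow> csubspace (f ` A)"
proof (rule csubspaceI)
  assume *: "clinear_on A f" "csubspace A"
  then show "0 \<in> f ` A" by (metis clinear_on_zero complex_vector.subspace_0 imageI)
  show "x + y \<in> f ` A" if "x \<in> f ` A" "y \<in> f ` A" for x y
    using that * by (auto simp: csubspace_intros clinear_on_add[OF *(1), symmetric])
  show "c *\<^sub>C x \<in> f ` A" if "x \<in> f ` A" for c x
    using that * by (auto simp: csubspace_intros clinear_on_scaleC[OF *(1), symmetric])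
qed

subsection \<open>Adjoints and projections\<close>

text \<open>The first-order condition at a minimum: for small \<open>t\<close> of sign opposite to
  \<open>a\<close> the linear term would outweigh the quadratic one.\<close>

lemma linear_coeff_zero:
  fixes a b :: real
  assumes "\<And>t. 0 \<le> t * a + t\<^sup>2 * b"
  shows "a = 0"
proof (rule ccontr)
  assume a: "a \<noteq> 0"
  \<comment> \<open>At \<open>t = - s * a\<close> the expression equals
    \<open>s * a\<^sup>2 * (s * b - 1)\<close>, and this choice of \<open>s\<close> forces
    \<open>s * b < 1\<close>.\<close>
  define s where "s = 1 / (1 + \<bar>b\<bar>)"
  have s: "s > 0" "s * b < 1"
    by (auto simp: s_def divide_simps)
  have "0 \<le> (- s * a) * a + (- s * a)\<^sup>2 * b" by (rule assms)
  also have "\<dots> = s * a\<^sup>2 * (s * b - 1)" by (simp add: power2_eq_square algebra_simps)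
  also have "\<dots> < 0" using a s by (intro mult_pos_neg) auto
  finally show False by simp
qed

text \<open>The representing vector minimizes \<open>\<parallel>s\<parallel>\<^sup>2 - 2 g s\<close>; a minimizing sequence is Cauchy by the
  parallelogram law.\<close>

lemma riesz_real:
  fixes g :: "'a::{real_inner,complete_space} \<Rightarrow> real"
  assumes S: "subspace S" "closed S"
    and add: "\<And>x y. x \<in> S \<Longrightarrow> y \<in> S \<Longrightarrow> g (x + y) = g x + g y"
    and scale: "\<And>r x. x \<in> S \<Longrightarrow> g (r *\<^sub>R x) = r * g x"
    and bound: "\<And>x. x \<in> S \<Longrightarrow> \<bar>g x\<bar> \<le> c * norm x"
  shows "\<exists>y\<in>S. \<forall>s\<in>S. inner s y = g s"
proof -
  define J where "J s = (norm s)\<^sup>2 - 2 * g s" for s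
  have lower: "- c\<^sup>2 \<le> J s" if "s \<in> S" for s
  proof -
    \<comment> \<open>Completing the square bounds \<open>J\<close> from below on \<open>S\<close>,
      so that the infimum exists.\<close>
    have "0 \<le> (norm s - c)\<^sup>2" by simp
    then have "2 * (c * norm s) \<le> (norm s)\<^sup>2 + c\<^sup>2" by (simp add: power2_diff mult_ac)
    moreover have "g s \<le> c * norm s" using bound[OF that] by linarith
    ultimately show ?thesis unfolding J_def by linarith
  qed
  define m where "m = Inf (J ` S)"
  have bdd: "bdd_below (J ` S)" using lower by (intro bdd_belowI[of _ "- c\<^sup>2"]) auto
  have ne: "S \<noteq> {}" using subspace_0[OF S(1)] by auto
  have m_le: "m \<le> J s" if "s \<in> S" for s
    unfolding m_def using bdd that by (intro cINF_lower)
  have "\<exists>s\<in>S. J s < m + 1 / real (Suc n)" for n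
  proof -
    have "\<exists>v\<in>J ` S. v < m + 1 / real (Suc n)"
      unfolding m_def using cInf_lessD[of "J ` S" "Inf (J ` S) + 1 / real (Suc n)"] ne by auto
    then show ?thesis by auto
  qed
  then obtain X where X: "\<And>n. X n \<in> S" "\<And>n. J (X n) < m + 1 / real (Suc n)" by metis
  have par: "(norm (s - t))\<^sup>2 \<le> 2 * (J s - m) + 2 * (J t - m)" if st: "s \<in> S" "t \<in> S" for s t
  proof -
    have mid: "(1/2) *\<^sub>R (s + t) \<in> S" using st S by (simp add: subspace_add subspace_scale)
    have "g ((1/2) *\<^sub>R (s + t)) = (g s + g t) / 2"
      using st S by (simp add: scale add subspace_add)
    then have "4 * J ((1/2) *\<^sub>R (s + t)) = (norm (s + t))\<^sup>2 - 4 * (g s + g t)"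
      by (simp add: J_def power_divide)
    moreover have "(norm (s - t))\<^sup>2 = 2 * (norm s)\<^sup>2 + 2 * (norm t)\<^sup>2 - (norm (s + t))\<^sup>2"
      by (simp add: power2_norm_eq_inner inner_simps inner_commute)
    ultimately show ?thesis using m_le[OF mid] by (simp add: J_def)
  qed
  have "Cauchy X"
  proof (rule metric_CauchyI)
    fix e :: real assume e: "0 < e"
    \<comment> \<open>Each of the two excesses over \<open>m\<close> is below \<open>1 / N\<close>
      and enters \<open>par\<close> with factor 2, hence \<open>4 / N\<close> against
      \<open>e\<^sup>2\<close>.\<close>
    obtain N where N: "4 / e\<^sup>2 < real N" using reals_Archimedean2 by blast
    have "dist (X i) (X j) < e" if "i \<ge> N" "j \<ge> N" for i j
    proof -
      have Npos: "real N > 0" using N e by (meson divide_pos_pos less_trans zero_less_numeral zero_less_power)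
      have small: "J (X k) - m < 1 / real N" if "k \<ge> N" for k
      proof -
        have "1 / real (Suc k) \<le> 1 / real N"
          using that Npos by (intro divide_left_mono) auto
        then show ?thesis using X(2)[of k] by linarith
      qed
      have "(norm (X i - X j))\<^sup>2 < 4 / real N"
        using par[OF X(1) X(1), of i j] small[OF that(1)] small[OF that(2)] by (simp add: field_simps)
      also have "\<dots> < e\<^sup>2" using N Npos e by (simp add: field_simps)
      finally show ?thesis using e by (simp add: dist_norm power2_less_imp_less)
    qed
    then show "\<exists>M. \<forall>m\<ge>M. \<forall>n\<ge>M. dist (X m) (X n) < e" by blast
  qed
  then obtain y where y: "X \<longlonglongrightarrow> y" using Cauchy_convergent convergent_def by blast
  have yS: "y \<in> S" using S(2) X(1) y unfolding closed_sequential_limits by blast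
  have gX: "(\<lambda>n. g (X n)) \<longlonglongrightarrow> g y"
  proof -
    have "(\<lambda>n. norm (X n - y)) \<longlonglongrightarrow> 0"
      using y by (intro tendsto_norm_zero) (simp add: LIM_zero)
    then have "(\<lambda>n. c * norm (X n - y)) \<longlonglongrightarrow> 0" by (rule tendsto_mult_right_zero)
    moreover have "norm (g (X n) - g y) \<le> c * norm (X n - y)" for n
    proof -
      have "g (X n - y) = g (X n) - g y"
        using add[of "X n - y" y] X(1) yS S by (simp add: subspace_diff)
      then show ?thesis using bound[of "X n - y"] X(1) yS S by (simp add: subspace_diff)
    qed
    ultimately have "(\<lambda>n. g (X n) - g y) \<longlonglongrightarrow> 0"
      by (intro Lim_null_comparison[of "\<lambda>n. g (X n) - g y"] always_eventually) simp_all
    then show ?thesis by (simp add: LIM_zero_iff)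
  qed
  have "(\<lambda>n. J (X n)) \<longlonglongrightarrow> J y"
    unfolding J_def by (intro tendsto_intros y gX)
  moreover have "(\<lambda>n. J (X n)) \<longlonglongrightarrow> m"
  proof (rule tendsto_sandwich[of "\<lambda>_. m" _ _ "\<lambda>n. m + 1 / real (Suc n)"])
    show "(\<lambda>n. m + 1 / real (Suc n)) \<longlonglongrightarrow> m"
      using tendsto_add[OF tendsto_const LIMSEQ_inverse_real_of_nat, of m]
      by (simp add: inverse_eq_divide)
    show "(\<lambda>_. m) \<longlonglongrightarrow> m" by simp
    show "\<forall>\<^sub>F n in sequentially. m \<le> J (X n)" using X(1) m_le by simp
    show "\<forall>\<^sub>F n in sequentially. J (X n) \<le> m + 1 / real (Suc n)"
      using X(2) by (intro always_eventually allI less_imp_le)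
  qed
  ultimately have Jy: "J y = m" using LIMSEQ_unique by blast
  have "inner s y = g s" if s: "s \<in> S" for s
  proof -
    \<comment> \<open>Minimality of \<open>J\<close> at \<open>y\<close> along the line through
      \<open>y\<close> in direction \<open>s\<close>; the linear coefficient is twice the difference
      that has to vanish.\<close>
    have "0 \<le> t * (2 * (inner s y - g s)) + t\<^sup>2 * (norm s)\<^sup>2" for t
    proof -
      have "J y \<le> J (y + t *\<^sub>R s)"
        unfolding Jy using m_le yS s S by (simp add: subspace_add subspace_scale)
      also have "J (y + t *\<^sub>R s) = J y + t * (2 * (inner s y - g s)) + t\<^sup>2 * (norm s)\<^sup>2"
      proof -
        have "(norm (y + t *\<^sub>R s))\<^sup>2 = (norm y)\<^sup>2 + 2 * t * inner s y + t\<^sup>2 * (norm s)\<^sup>2"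
          by (simp only: power2_norm_eq_inner inner_add_left inner_add_right inner_scaleR_left
              inner_scaleR_right inner_commute[of y s] power2_eq_square[of t])
             (simp add: algebra_simps)
        then show ?thesis
          using yS s S by (simp add: J_def add scale subspace_scale algebra_simps)
      qed
      finally show ?thesis by simp
    qed
    then have "2 * (inner s y - g s) = 0" by (rule linear_coeff_zero)
    then show ?thesis by simp
  qed
  with yS show ?thesis by blast
qed

text \<open>Two representing vectors differ by an element of \<open>A\<close> orthogonal to
  \<open>A\<close>, hence to itself; any one of them therefore settles the description in
  \<open>adj\<close>.\<close>

lemma adj_eqI:
  assumes A: "csubspace A" and x: "x \<in> A" "\<And>a. a \<in> A \<Longrightarrow> cinner a x = cinner (t a) y"
  shows "adj A t y = x"
  unfolding adj_def
proof (rule the_equality)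
  show "x \<in> A \<and> (\<forall>a\<in>A. cinner a x = cinner (t a) y)" using x by simp
  fix z assume z: "z \<in> A \<and> (\<forall>a\<in>A. cinner a z = cinner (t a) y)"
  then have "cinner (z - x) (z - x) = 0"
    using A x by (subst cinner.diff_right) (auto simp: csubspace_intros)
  then show "z = x" by simp
qed

context
  fixes A :: "'a::complex_hilbert set" and t :: "'a \<Rightarrow> 'b::complex_inner"
  assumes A: "csubspace A" "closed A" and t: "bclinear_on A t"
begin

text \<open>Riesz representation of the real functional \<open>\<lambda>a. inner (t a) y\<close>;
  complex linearity of \<open>t\<close> upgrades the result by testing with \<i> times
  \<open>a\<close>.\<close>

lemma adj_ex: "\<exists>x\<in>A. \<forall>a\<in>A. cinner a x = cinner (t a) y"
proof -
  obtain c where c: "c \<ge> 0" "\<And>x. x \<in> A \<Longrightarrow> norm (t x) \<le> c * norm x"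
    using bclinear_on_bound[OF t] by blast
  have L: "clinear_on A t" using t by (simp add: bclinear_on_def)
  have "\<exists>x\<in>A. \<forall>a\<in>A. inner a x = inner (t a) y"
  proof (rule riesz_real)
    show "\<bar>inner (t x) y\<bar> \<le> (c * norm y) * norm x" if "x \<in> A" for x
    proof -
      have "\<bar>inner (t x) y\<bar> \<le> norm (t x) * norm y" by (rule Cauchy_Schwarz_ineq2)
      also have "\<dots> \<le> (c * norm x) * norm y" using c(2)[OF that] by (rule mult_right_mono) simp
      finally show ?thesis by (simp add: mult_ac)
    qed
  qed (use A in \<open>auto simp: csubspace_imp_subspace clinear_on_add[OF L] clinear_on_scaleR[OF L]
        inner_simps\<close>)
  then obtain x where x: "x \<in> A" "\<And>a. a \<in> A \<Longrightarrow> inner a x = inner (t a) y" by blast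
  have "cinner a x = cinner (t a) y" if a: "a \<in> A" for a
    using x(2)[of a] x(2)[of "\<i> *\<^sub>C a"] a A
    by (intro cinner_eqI) (simp_all add: csubspace_intros clinear_on_scaleC[OF L])
  with x(1) show ?thesis by blast
qed

lemma adj_in: "adj A t y \<in> A"
  using adj_ex[of y] adj_eqI[OF A(1)] by metis

lemma cinner_adj: "a \<in> A \<Longrightarrow> cinner a (adj A t y) = cinner (t a) y"
  using adj_ex[of y] adj_eqI[OF A(1)] by metis

lemma cinner_adj': "a \<in> A \<Longrightarrow> cinner (adj A t y) a = cinner y (t a)"
  by (metis cinner_adj cinner_commute)

lemma clinear_on_adj: "clinear_on B (adj A t)"
proof (rule clinear_onI)
  show "adj A t (x + y) = adj A t x + adj A t y" for x y
    by (rule adj_eqI) (auto simp: A adj_in cinner_adj cinner_add_right csubspace_intros)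
  show "adj A t (c *\<^sub>C x) = c *\<^sub>C adj A t x" for c x
    by (rule adj_eqI) (auto simp: A adj_in cinner_adj cinner_scaleC_right csubspace_intros)
qed

lemma norm_adj_le:
  assumes "c \<ge> 0" "\<And>x. x \<in> A \<Longrightarrow> norm (t x) \<le> c * norm x"
  shows "norm (adj A t y) \<le> c * norm y"
proof (cases "adj A t y = 0")
  case False
  let ?x = "adj A t y"
  have "of_real ((norm ?x)\<^sup>2) = cinner (t ?x) y"
    unfolding cinner_self[symmetric] by (rule cinner_adj) (rule adj_in)
  then have "cmod (of_real ((norm ?x)\<^sup>2)) \<le> norm (t ?x) * norm y"
    by (simp only: cmod_cinner_le)
  then have "(norm ?x)\<^sup>2 \<le> norm (t ?x) * norm y" by (simp only: norm_of_real abs_power2) 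
  also have "\<dots> \<le> (c * norm ?x) * norm y"
    by (intro mult_right_mono assms adj_in) auto
  finally show ?thesis using False by (simp add: power2_eq_square mult_ac)
qed (use assms in auto)

lemma bclinear_on_adj: "bclinear_on B (adj A t)"
proof -
  obtain c where "c \<ge> 0" "\<And>x. x \<in> A \<Longrightarrow> norm (t x) \<le> c * norm x"
    using bclinear_on_bound[OF t] by blast
  then show ?thesis by (intro bclinear_onI[OF clinear_on_adj norm_adj_le])
qed

end

text \<open>Makes existence, linearity and the norm bound of projections special cases of those of
  adjoints.\<close>

lemma proj_eq_adj: "proj S x = adj S (\<lambda>a. a) x"
proof -
  have "cinner s (x - y) = 0 \<longleftrightarrow> cinner s y = cinner s x" for s y
    by (auto simp: cinner.diff_right)
  then show ?thesis unfolding proj_def adj_def by simp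
qed

lemma bclinear_on_id: "bclinear_on A (\<lambda>x. x)"
  by (rule bclinear_onI[of _ _ 1]) (auto simp: clinear_on_def)

lemma proj_eqI:
  assumes "csubspace S" "y \<in> S" "\<And>s. s \<in> S \<Longrightarrow> cinner s y = cinner s x"
  shows "proj S x = y"
  unfolding proj_eq_adj by (rule adj_eqI) (use assms in auto)

lemma proj_id: "csubspace S \<Longrightarrow> x \<in> S \<Longrightarrow> proj S x = x"
  by (rule proj_eqI) auto

lemma proj_zero: "csubspace S \<Longrightarrow> (\<And>s. s \<in> S \<Longrightarrow> cinner s x = 0) \<Longrightarrow> proj S x = 0"
  by (rule proj_eqI) (auto simp: csubspace_intros)

context
  fixes S :: "'a::complex_hilbert set"
  assumes S: "csubspace S" "closed S"
begin

lemma proj_in: "proj S x \<in> S"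
  unfolding proj_eq_adj by (rule adj_in[OF S bclinear_on_id])

lemma cinner_proj: "s \<in> S \<Longrightarrow> cinner s (proj S x) = cinner s x"
  unfolding proj_eq_adj by (rule cinner_adj[OF S bclinear_on_id])

lemma cinner_proj': "s \<in> S \<Longrightarrow> cinner (proj S x) s = cinner x s"
  unfolding proj_eq_adj by (rule cinner_adj'[OF S bclinear_on_id])

lemma clinear_on_proj: "clinear_on B (proj S)"
  using clinear_on_adj[OF S bclinear_on_id] by (simp add: clinear_on_def proj_eq_adj)

lemma norm_proj_le: "norm (proj S x) \<le> norm x"
  using norm_adj_le[OF S bclinear_on_id, of 1 x] by (simp add: proj_eq_adj)

text \<open>The residual \<open>x - proj S x\<close> lies in \<open>T\<close> and is orthogonal to
  \<open>S\<close>. Descriptions of closed spans are reduced by this to a trivial orthogonal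
  complement.\<close>

lemma closed_csubspace_eqI:
  assumes T: "csubspace T" "S \<subseteq> T"
    and orth: "\<And>x. x \<in> T \<Longrightarrow> (\<And>s. s \<in> S \<Longrightarrow> cinner s x = 0) \<Longrightarrow> x = 0"
  shows "S = T"
proof
  show "T \<subseteq> S"
  proof
    fix x assume x: "x \<in> T"
    have "x - proj S x = 0"
    proof (rule orth)
      show "x - proj S x \<in> T"
        by (rule complex_vector.subspace_diff[OF T(1) x subsetD[OF T(2) proj_in]])
    qed (simp add: cinner.diff_right cinner_proj)
    then show "x \<in> S" using proj_in[of x] by simp
  qed
qed (rule T)

end

lemma norm_add_sq_orth:
  fixes x y :: "'a::complex_inner"
  assumes "cinner x y = 0"
  shows "(norm (x + y))\<^sup>2 = (norm x)\<^sup>2 + (norm y)\<^sup>2"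
proof -
  have "inner x y = 0" using assms by (simp only: inner_eq_Re_cinner zero_complex.sel)
  then show ?thesis by (simp add: power2_norm_eq_inner inner_simps inner_commute)
qed

text \<open>The graph of the unitary is the closed span of the pairs \<open>(a i, b i)\<close>.\<close>

lemma unitary_from_gram:
  fixes a :: "'i \<Rightarrow> 'a::complex_hilbert" and b :: "'i \<Rightarrow> 'b::complex_hilbert"
  assumes gram: "\<And>i j. i \<in> I \<Longrightarrow> j \<in> I \<Longrightarrow> cinner (a i) (a j) = cinner (b i) (b j)"
  shows "\<exists>U. unitary (ccspan (a ` I)) (ccspan (b ` I)) U \<and> (\<forall>i\<in>I. U (a i) = b i)"
proof -
  define L where "L = ccspan ((\<lambda>i. (a i, b i)) ` I)"
  have L: "csubspace L" "closed L" by (auto simp: L_def)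
  have gen: "(a i, b i) \<in> L" if "i \<in> I" for i
    using that ccspan_superset unfolding L_def by fastforce
  \<comment> \<open>\<open>(u, - v)\<close> is orthogonal to \<open>L\<close> whenever \<open>(u, v) \<in> L\<close>, hence both have equal norm.\<close>
  have g1: "cinner (a i, - b i) p = 0" if "i \<in> I" "p \<in> L" for i p
    using that(2) unfolding L_def
    by (rule orth_ccspan) (auto simp: cinner_prod_def gram that cinner.minus_left)
  have g2: "cinner (fst p, - snd p) q = 0" if p: "p \<in> L" and q: "q \<in> L" for p q
  proof -
    have "cinner (fst q, - snd q) p = 0"
      using p unfolding L_def
    proof (rule orth_ccspan)
      fix r assume "r \<in> (\<lambda>i. (a i, b i)) ` I"
      then obtain i where i: "i \<in> I" "r = (a i, b i)" by auto
      show "cinner (fst q, - snd q) r = 0"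
        using g1[OF i(1) q] i(2)
        by (metis (no_types, lifting) cinner_commute cinner_eq_0_commute cinner_prod_def
            cinner.minus_left cinner.minus_right fst_conv snd_conv)
    qed
    then show ?thesis
      by (metis (no_types, lifting) cinner_commute cinner_eq_0_commute cinner_prod_def
            cinner.minus_left cinner.minus_right fst_conv snd_conv)
  qed
  have N: "norm u = norm v" if "(u, v) \<in> L" for u v
  proof -
    have "cinner u u = cinner v v"
      using g2[OF that that] by (simp add: cinner_prod_def cinner.minus_left)
    then have "(norm u)\<^sup>2 = (norm v)\<^sup>2" by (simp only: cinner_self of_real_eq_iff)
    then show ?thesis by simp
  qed
  have uniq: "v = w" if "(u, v) \<in> L" "(u, w) \<in> L" for u v w
  proof -
    \<comment> \<open>Linearity of \<open>L\<close> reduces uniqueness to a pair with first entry 0,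
      whose second entry has norm 0 by \<open>N\<close>.\<close>
    have "(u, v) - (u, w) \<in> L" using that L by (blast intro: csubspace_intros)
    then have "norm (0::'a) = norm (v - w)" by (intro N) simp
    then show ?thesis by simp
  qed
  define U where "U u = (THE v. (u, v) \<in> L)" for u
  have U: "U u = v" if "(u, v) \<in> L" for u v
    unfolding U_def using that uniq by blast
  \<comment> \<open>Both entries of a pair in \<open>L\<close> have the same norm, so the pair has
    norm \<open>sqrt 2\<close> times that of either; the scaled coordinate is isometric and has a
    closed image.\<close>
  have fst_iso: "isometric L UNIV (\<lambda>p. sqrt 2 *\<^sub>R fst p)"
  proof -
    have "norm (sqrt 2 *\<^sub>R fst p) = norm p" if "p \<in> L" for p
      using N[of "fst p" "snd p"] that by (simp add: norm_prod_def real_sqrt_mult)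
    then show ?thesis
      by (auto simp: isometric_def clinear_on_def scaleC_prod_def scaleR_add_right scaleR_scaleC
          scaleC_scaleC mult.commute scaleC_add_right)
  qed
  have snd_iso: "isometric L UNIV (\<lambda>p. sqrt 2 *\<^sub>R snd p)"
  proof -
    have "norm (sqrt 2 *\<^sub>R snd p) = norm p" if "p \<in> L" for p
      using N[of "fst p" "snd p"] that by (simp add: norm_prod_def real_sqrt_mult)
    then show ?thesis
      by (auto simp: isometric_def clinear_on_def scaleC_prod_def scaleR_add_right scaleR_scaleC
          scaleC_scaleC mult.commute scaleC_add_right)
  qed
  \<comment> \<open>Closedness of the image makes it the full closed span of the generators and not
    just a dense part; this gives domain and range of \<open>U\<close>.\<close>
  have cl: "f ` L = ccspan ((f \<circ> (\<lambda>i. (a i, b i))) ` I)"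
    if iso: "isometric L UNIV (\<lambda>p. sqrt 2 *\<^sub>R f p)" and lin: "clinear_on UNIV f"
    for f :: "'a \<times> 'b \<Rightarrow> 'c::complex_inner"
  proof (rule ccspan_eqI[symmetric])
    have "closed ((\<lambda>x. (1 / sqrt 2) *\<^sub>R x) ` ((\<lambda>p. sqrt 2 *\<^sub>R f p) ` L))"
      using closed_isometric_image[OF iso L] by (rule closed_scaling)
    then show "closed (f ` L)" by (simp add: image_image)
    show "csubspace (f ` L)" using lin L by (auto intro!: csubspace_image elim: clinear_on_subset)
    show "(f \<circ> (\<lambda>i. (a i, b i))) ` I \<subseteq> f ` L" using gen by auto
    have bl: "bclinear_on L f"
    proof (rule bclinear_onI[of _ _ 1])
      show "clinear_on L f" using lin by (rule clinear_on_subset) simp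
      show "norm (f p) \<le> 1 * norm p" if "p \<in> L" for p
      proof -
        have "sqrt 2 * norm (f p) = norm p" using iso that by (simp add: isometric_def)
        moreover have "1 * norm (f p) \<le> sqrt 2 * norm (f p)" by (rule mult_right_mono) auto
        ultimately show ?thesis by simp
      qed
    qed
    show "f ` L \<subseteq> ccspan ((f \<circ> (\<lambda>i. (a i, b i))) ` I)"
      using bl unfolding L_def
      by (rule bclinear_on_image_ccspan) (auto simp: image_image image_comp intro!: ccspan_superset)
  qed
  have D: "fst ` L = ccspan (a ` I)"
    using cl[OF fst_iso] by (simp add: o_def clinear_on_def scaleC_prod_def)
  have R: "snd ` L = ccspan (b ` I)"
    using cl[OF snd_iso] by (simp add: o_def clinear_on_def scaleC_prod_def)
  show ?thesis
  proof (intro exI conjI ballI)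
    show "unitary (ccspan (a ` I)) (ccspan (b ` I)) U"
      unfolding unitary_def isometric_def D[symmetric] R[symmetric]
    proof (intro conjI ballI clinear_onI)
      fix x y assume "x \<in> fst ` L" "y \<in> fst ` L"
      then obtain x' y' where *: "(x, x') \<in> L" "(y, y') \<in> L" by auto
      then have "(x, x') + (y, y') \<in> L" using L by (intro csubspace_intros)
      then show "U (x + y) = U x + U y" using * U by (simp add: U)
    next
      fix x c assume "x \<in> fst ` L"
      then obtain x' where *: "(x, x') \<in> L" by auto
      then have "c *\<^sub>C (x, x') \<in> L" using L by (intro csubspace_intros)
      then show "U (c *\<^sub>C x) = c *\<^sub>C U x" using * U by (simp add: U scaleC_prod_def)
    next
      show eq: "U ` fst ` L = snd ` L" using U by force
      then show "U ` fst ` L \<subseteq> snd ` L" by simp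
      show "norm (U x) = norm x" if "x \<in> fst ` L" for x using that U N by force
    qed
    show "U (a i) = b i" if "i \<in> I" for i using gen[OF that] by (rule U)
  qed
qed

subsection \<open>Positive square roots\<close>

text \<open>\<open>positive_on\<close> demands a real quadratic form in place of symmetry;
  evaluating that form at \<open>x + \<i> *\<^sub>C y\<close> yields the symmetry.\<close>

lemma positive_on_inner:
  assumes R: "positive_on S R" and S: "csubspace S" and xy: "x \<in> S" "y \<in> S"
  shows "inner (R x) y = inner x (R y)"
proof -
  have L: "clinear_on S R" using R by (simp add: positive_on_def)
  have im: "Im (cinner z (R z)) = 0" if "z \<in> S" for z
    using R that by (simp add: positive_on_def)
  have "x + \<i> *\<^sub>C y \<in> S" "\<i> *\<^sub>C y \<in> S"
    using S xy by (simp_all add: csubspace_intros)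
  then have "Im (cinner (x + \<i> *\<^sub>C y) (R x + \<i> *\<^sub>C R y)) = 0"
    using im[of "x + \<i> *\<^sub>C y"] xy by (simp add: clinear_on_add[OF L] clinear_on_scaleC[OF L])
  then have "Re (cinner x (R y)) = Re (cinner y (R x))"
    using im[OF xy(1)] im[OF xy(2)]
    by (simp add: cinner_add_left cinner_add_right cinner_scaleC_left cinner_scaleC_right)
  then show ?thesis by (simp add: inner_eq_Re_cinner[symmetric] inner_commute)
qed

text \<open>Perturbing \<open>y\<close> by \<open>t\<close> times \<open>R y\<close> keeps the form
  nonnegative, while its linear coefficient is twice the squared norm of \<open>R y\<close>.\<close>

lemma positive_on_eq_0:
  assumes R: "positive_on S R" and S: "csubspace S" and y: "y \<in> S" "inner y (R y) = 0"
  shows "R y = 0"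
proof -
  have L: "clinear_on S R" and RS: "\<And>x. x \<in> S \<Longrightarrow> R x \<in> S"
    and pos: "\<And>x. x \<in> S \<Longrightarrow> 0 \<le> inner x (R x)"
    using R by (auto simp: positive_on_def inner_eq_Re_cinner)
  have "0 \<le> t * (2 * (norm (R y))\<^sup>2) + t\<^sup>2 * inner (R y) (R (R y))" for t
  proof -
    have "y + t *\<^sub>R R y \<in> S"
      using S y RS by (simp add: csubspace_intros scaleR_scaleC)
    then have "0 \<le> inner (y + t *\<^sub>R R y) (R (y + t *\<^sub>R R y))" by (rule pos)
    also have "R (y + t *\<^sub>R R y) = R y + t *\<^sub>R R (R y)"
      using S y RS by (simp add: clinear_on_add[OF L] clinear_on_scaleC[OF L] csubspace_intros scaleR_scaleC)
    also have "inner (y + t *\<^sub>R R y) (R y + t *\<^sub>R R (R y)) =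
        t * (2 * (norm (R y))\<^sup>2) + t\<^sup>2 * inner (R y) (R (R y))"
      using positive_on_inner[OF R S y(1) RS[OF y(1)]] y(2)
      by (simp add: inner_simps power2_norm_eq_inner) (simp add: power2_eq_square algebra_simps)
    finally show ?thesis .
  qed
  then have "2 * (norm (R y))\<^sup>2 = 0" by (rule linear_coeff_zero)
  then show ?thesis by simp
qed

text \<open>For \<open>y = R x - R' x\<close>, commutation gives
  \<open>R y + R' y = R (R x) - R' (R' x) = 0\<close>, so both nonnegative forms vanish at
  \<open>y\<close>, hence so do \<open>R y\<close> and \<open>R' y\<close>. By symmetry the squared
  norm of \<open>y\<close> is then 0.\<close>

lemma positive_on_sqrt_unique:
  assumes S: "csubspace S" and R: "positive_on S R" and R': "positive_on S R'"
    and sq: "\<And>x. x \<in> S \<Longrightarrow> R (R x) = R' (R' x)"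
    and comm: "\<And>x. x \<in> S \<Longrightarrow> R (R' x) = R' (R x)" and x: "x \<in> S"
  shows "R x = R' x"
proof -
  have L: "clinear_on S R" "clinear_on S R'"
    and RS: "\<And>x. x \<in> S \<Longrightarrow> R x \<in> S" "\<And>x. x \<in> S \<Longrightarrow> R' x \<in> S"
    and pos: "\<And>x. x \<in> S \<Longrightarrow> 0 \<le> inner x (R x)" "\<And>x. x \<in> S \<Longrightarrow> 0 \<le> inner x (R' x)"
    using R R' by (auto simp: positive_on_def inner_eq_Re_cinner)
  define y where "y = R x - R' x"
  have y: "y \<in> S" using S RS x by (simp add: y_def csubspace_intros)
  have "R y + R' y = 0"
    using RS x S by (simp add: y_def clinear_on_diff[OF L(1)] clinear_on_diff[OF L(2)] sq comm)
  then have "inner y (R y) + inner y (R' y) = 0" by (simp flip: inner_add_right)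
  then have "inner y (R y) = 0" "inner y (R' y) = 0"
    using pos[OF y] by linarith+
  then have 0: "R y = 0" "R' y = 0"
    using positive_on_eq_0[OF R S y] positive_on_eq_0[OF R' S y] by auto
  have "inner y y = inner (R x) y - inner (R' x) y" by (simp add: y_def inner_simps)
  also have "\<dots> = inner x (R y) - inner x (R' y)"
    using positive_on_inner[OF R S x y] positive_on_inner[OF R' S x y] by simp
  finally show ?thesis using 0 by (simp add: y_def)
qed

text \<open>If \<open>B = (A + B\<^sup>2) / 2\<close> then \<open>(1 - B)\<^sup>2 = 1 - A\<close>; such a \<open>B\<close> is found by iteration, which is
  majorized by the same iteration on scalars with \<open>A = 1\<close>.\<close>

fun sqrt_iter :: "('a::real_vector \<Rightarrow> 'a) \<Rightarrow> nat \<Rightarrow> 'a \<Rightarrow> 'a" where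
  "sqrt_iter A 0 x = 0"
| "sqrt_iter A (Suc n) x = (1/2) *\<^sub>R (A x + sqrt_iter A n (sqrt_iter A n x))"

fun sqrt_major :: "nat \<Rightarrow> real" where
  "sqrt_major 0 = 0"
| "sqrt_major (Suc n) = (1 + (sqrt_major n)\<^sup>2) / 2"

lemma sqrt_major_bounds: "0 \<le> sqrt_major n \<and> sqrt_major n \<le> 1"
  by (induction n) (auto simp: power_le_one)

text \<open>The increment is half the square of \<open>sqrt_major n - 1\<close>.\<close>

lemma sqrt_major_mono: "sqrt_major n \<le> sqrt_major (Suc n)"
proof -
  have "0 \<le> (sqrt_major n - 1)\<^sup>2" by simp
  then show ?thesis by (simp add: power2_diff)
qed

lemma sqrt_major_incseq: "incseq sqrt_major"
  by (rule incseq_SucI) (rule sqrt_major_mono)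

lemma Cauchy_sqrt_major: "Cauchy sqrt_major"
proof -
  obtain L where "sqrt_major \<longlonglongrightarrow> L"
    using incseq_convergent[OF sqrt_major_incseq, of 1] sqrt_major_bounds by blast
  then show ?thesis by (rule LIMSEQ_imp_Cauchy)
qed

text \<open>Used with \<open>A\<close> equal to \<gamma> \<gamma>^* on \<open>\<E> G\<close>, so
  that the root of \<open>1 - A\<close> is the defect operator.\<close>

locale sqrt_iteration =
  fixes S :: "'a::complex_hilbert set" and A :: "'a \<Rightarrow> 'a"
  assumes S: "csubspace S" "closed S"
    and A: "contraction S S A"
    and sa: "\<And>x y. x \<in> S \<Longrightarrow> y \<in> S \<Longrightarrow> inner (A x) y = inner x (A y)"
begin

abbreviation "B \<equiv> sqrt_iter A"

lemma A_lin: "clinear_on S A" and A_in: "x \<in> S \<Longrightarrow> A x \<in> S" and A_norm: "x \<in> S \<Longrightarrow> norm (A x) \<le> norm x"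
  using A by (auto simp: contraction_def)

lemma S_scaleR: "x \<in> S \<Longrightarrow> r *\<^sub>R x \<in> S"
  using S by (simp add: scaleR_scaleC csubspace_intros)

lemma B_in: "x \<in> S \<Longrightarrow> B n x \<in> S"
  by (induction n arbitrary: x) (simp_all add: S S_scaleR A_in csubspace_intros)

lemma B_lin: "clinear_on S (B n)"
proof (induction n)
  case 0
  show ?case by (rule clinear_onI) simp_all
next
  case (Suc n)
  show ?case
    by (rule clinear_onI)
      (simp_all add: clinear_on_add[OF A_lin] clinear_on_add[OF Suc] clinear_on_scaleC[OF A_lin]
        clinear_on_scaleC[OF Suc] B_in scaleR_add_right scaleC_add_right scaleR_scaleC
        scaleC_scaleC mult.commute)
qed

lemma B_norm: "x \<in> S \<Longrightarrow> norm (B n x) \<le> sqrt_major n * norm x"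
proof (induction n arbitrary: x)
  case (Suc n)
  have "norm (B n (B n x)) \<le> sqrt_major n * norm (B n x)" using Suc B_in by blast
  also have "\<dots> \<le> sqrt_major n * (sqrt_major n * norm x)"
    using Suc sqrt_major_bounds by (intro mult_left_mono) auto
  finally have "norm (A x + B n (B n x)) \<le> norm x + sqrt_major n * (sqrt_major n * norm x)"
    using A_norm[OF Suc.prems] norm_triangle_ineq[of "A x" "B n (B n x)"] by linarith
  then have "norm (B (Suc n) x) \<le> (norm x + sqrt_major n * (sqrt_major n * norm x)) / 2" by simp
  also have "\<dots> = sqrt_major (Suc n) * norm x" by (simp add: power2_eq_square algebra_simps)
  finally show ?case .
qed simp

lemma B_norm1: "x \<in> S \<Longrightarrow> norm (B n x) \<le> norm x"
  using B_norm[of x n] sqrt_major_bounds[of n] mult_right_mono[of "sqrt_major n" 1 "norm x"] by auto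

text \<open>Every iterate is a polynomial in \<open>A\<close>, so whatever commutes with
  \<open>A\<close> commutes with it.\<close>

lemma commute_B:
  assumes C: "clinear_on S C" "\<And>x. x \<in> S \<Longrightarrow> C x \<in> S" "\<And>x. x \<in> S \<Longrightarrow> C (A x) = A (C x)"
    and x: "x \<in> S"
  shows "C (B n x) = B n (C x)"
  using x
proof (induction n arbitrary: x)
  case 0
  then show ?case using clinear_on_zero[OF C(1)] S by (simp add: csubspace_intros)
next
  case (Suc n)
  then show ?case
    by (simp add: clinear_on_scaleR[OF C(1)] clinear_on_add[OF C(1)] A_in B_in S csubspace_intros C)
qed

lemma B_commute_A: "x \<in> S \<Longrightarrow> A (B n x) = B n (A x)"
  by (rule commute_B) (auto simp: A_lin A_in)

lemma B_commute: "x \<in> S \<Longrightarrow> B m (B n x) = B n (B m x)"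
  by (rule commute_B) (auto simp: B_lin B_in B_commute_A)

text \<open>Since the iterates commute, the difference of their squares factors as difference times
  sum; the induction hypothesis is applied to \<open>?u\<close>, the sum evaluated at
  \<open>x\<close>. The scalar iteration factors in the same way, which matches the bounds.\<close>

lemma B_diff_Suc:
  "x \<in> S \<Longrightarrow> norm (B (Suc n) x - B n x) \<le> (sqrt_major (Suc n) - sqrt_major n) * norm x"
proof (induction n arbitrary: x)
  case 0
  then show ?case using A_norm[of x] by simp
next
  case (Suc n)
  let ?u = "B (Suc n) x + B n x"
  have u: "?u \<in> S" using Suc.prems S B_in[OF Suc.prems] by (intro csubspace_intros)
  have in_S: "B (Suc n) x \<in> S" "B n x \<in> S" using Suc.prems B_in by blast+
  have "B (Suc (Suc n)) x - B (Suc n) x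
      = (1/2) *\<^sub>R (B (Suc n) (B (Suc n) x) - B n (B n x))"
    by (simp add: sqrt_iter.simps(2)[of A "Suc n"] sqrt_iter.simps(2)[of A n x]
        del: sqrt_iter.simps flip: scaleR_diff_right)
  also have "B (Suc n) (B (Suc n) x) - B n (B n x) = B (Suc n) ?u - B n ?u"
    using in_S B_commute[OF Suc.prems, of "Suc n" n]
    by (simp del: sqrt_iter.simps add: clinear_on_add[OF B_lin])
  finally have "norm (B (Suc (Suc n)) x - B (Suc n) x) = norm (B (Suc n) ?u - B n ?u) / 2"
    by simp
  also have "\<dots> \<le> (sqrt_major (Suc n) - sqrt_major n) * norm ?u / 2"
    using Suc.IH[OF u] by simp
  also have "\<dots> \<le> (sqrt_major (Suc n) - sqrt_major n) * ((sqrt_major (Suc n) + sqrt_major n) * norm x) / 2"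
  proof -
    have "norm ?u \<le> (sqrt_major (Suc n) + sqrt_major n) * norm x"
      using norm_triangle_ineq[of "B (Suc n) x" "B n x"] B_norm[OF Suc.prems, of "Suc n"]
        B_norm[OF Suc.prems, of n] by (simp add: distrib_right del: sqrt_iter.simps sqrt_major.simps)
    then show ?thesis
      using sqrt_major_mono[of n] by (intro divide_right_mono mult_left_mono) simp_all
  qed
  also have "\<dots> = (sqrt_major (Suc (Suc n)) - sqrt_major (Suc n)) * norm x"
  proof -
    have "sqrt_major (Suc (Suc n)) - sqrt_major (Suc n) = ((sqrt_major (Suc n))\<^sup>2 - (sqrt_major n)\<^sup>2) / 2"
      by (simp add: sqrt_major.simps(2)[of "Suc n"] sqrt_major.simps(2)[of n] del: sqrt_major.simps)
         (simp add: field_simps)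
    then show ?thesis by (simp only:) (simp add: power2_eq_square algebra_simps del: sqrt_major.simps)
  qed
  finally show ?case .
qed

lemma B_diff:
  assumes x: "x \<in> S" and mn: "m \<le> n"
  shows "norm (B n x - B m x) \<le> (sqrt_major n - sqrt_major m) * norm x"
  using mn
proof (induction n rule: dec_induct)
  case (step n)
  have "norm (B (Suc n) x - B m x) \<le> norm (B (Suc n) x - B n x) + norm (B n x - B m x)"
    using norm_triangle_ineq[of "B (Suc n) x - B n x" "B n x - B m x"] by simp
  also have "\<dots> \<le> (sqrt_major (Suc n) - sqrt_major n) * norm x + (sqrt_major n - sqrt_major m) * norm x"
    using step.IH B_diff_Suc[OF x, of n] by (rule add_mono[rotated])
  finally show ?case by (simp add: algebra_simps del: sqrt_iter.simps sqrt_major.simps)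
qed simp

lemma Cauchy_B:
  assumes x: "x \<in> S"
  shows "Cauchy (\<lambda>n. B n x)"
proof (rule metric_CauchyI)
  fix e :: real assume e: "0 < e"
  \<comment> \<open>The summand 1 keeps the denominator positive when \<open>x = 0\<close>.\<close>
  define d where "d = e / (norm x + 1)"
  have d: "d > 0" using e by (simp add: d_def add_nonneg_pos)
  obtain N where N: "\<And>m n. m \<ge> N \<Longrightarrow> n \<ge> N \<Longrightarrow> dist (sqrt_major m) (sqrt_major n) < d"
    using Cauchy_sqrt_major d unfolding Cauchy_def by blast
  have *: "dist (B m x) (B n x) < e" if "m \<ge> N" "n \<ge> N" "n \<le> m" for m n
  proof -
    have "dist (B m x) (B n x) \<le> (sqrt_major m - sqrt_major n) * norm x"
      unfolding dist_norm using B_diff[OF x that(3)] .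
    also have "\<dots> \<le> d * norm x"
      using N[OF that(1,2)] by (intro mult_right_mono) (auto simp: dist_real_def)
    also have "\<dots> < d * (norm x + 1)" using d by simp
    also have "\<dots> = e"
    proof -
      have "norm x + 1 \<noteq> 0" using norm_ge_zero[of x] by linarith
      then show ?thesis by (simp add: d_def)
    qed
    finally show ?thesis .
  qed
  show "\<exists>M. \<forall>m\<ge>M. \<forall>n\<ge>M. dist (B m x) (B n x) < e"
    using * by (metis dist_commute nle_le)
qed

definition Binf :: "'a \<Rightarrow> 'a" where "Binf x = lim (\<lambda>n. B n x)"

lemma tendsto_Binf: "x \<in> S \<Longrightarrow> (\<lambda>n. B n x) \<longlonglongrightarrow> Binf x"
  unfolding Binf_def using Cauchy_B Cauchy_convergent convergent_LIMSEQ_iff by blast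

lemma Binf_in: "x \<in> S \<Longrightarrow> Binf x \<in> S"
  using closed_sequentially[OF S(2) B_in tendsto_Binf] by blast

lemma Binf_lin: "clinear_on S Binf"
proof (rule clinear_onI)
  fix x y assume xy: "x \<in> S" "y \<in> S"
  have "(\<lambda>n. B n (x + y)) \<longlonglongrightarrow> Binf x + Binf y"
    using tendsto_add[OF tendsto_Binf tendsto_Binf] xy by (simp add: clinear_on_add[OF B_lin])
  moreover have "(\<lambda>n. B n (x + y)) \<longlonglongrightarrow> Binf (x + y)"
    using xy S by (intro tendsto_Binf csubspace_intros)
  ultimately show "Binf (x + y) = Binf x + Binf y" using LIMSEQ_unique by blast
next
  fix c x assume x: "x \<in> S"
  have "(\<lambda>n. B n (c *\<^sub>C x)) \<longlonglongrightarrow> c *\<^sub>C Binf x"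
    using scaleC.tendsto[OF tendsto_const tendsto_Binf] x by (simp add: clinear_on_scaleC[OF B_lin])
  moreover have "(\<lambda>n. B n (c *\<^sub>C x)) \<longlonglongrightarrow> Binf (c *\<^sub>C x)"
    using x S by (intro tendsto_Binf csubspace_intros)
  ultimately show "Binf (c *\<^sub>C x) = c *\<^sub>C Binf x" using LIMSEQ_unique by blast
qed

lemma Binf_norm: "x \<in> S \<Longrightarrow> norm (Binf x) \<le> norm x"
  using LIMSEQ_le_const2[OF tendsto_norm[OF tendsto_Binf]] B_norm1 by blast

text \<open>The limit of the recursion. The composed iterates converge because each
  \<open>B n\<close> is a contraction and does not enlarge the error of its argument.\<close>

lemma Binf_eq: "x \<in> S \<Longrightarrow> 2 *\<^sub>R Binf x = A x + Binf (Binf x)"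
proof -
  assume x: "x \<in> S"
  have "(\<lambda>n. B n (B n x)) \<longlonglongrightarrow> Binf (Binf x)"
  proof -
    have "(\<lambda>n. B n (B n x) - B n (Binf x)) \<longlonglongrightarrow> 0"
    proof (rule Lim_null_comparison)
      show "\<forall>\<^sub>F n in sequentially. norm (B n (B n x) - B n (Binf x)) \<le> norm (B n x - Binf x)"
      proof (intro always_eventually allI)
        fix n
        have "B n (B n x) - B n (Binf x) = B n (B n x - Binf x)"
          using clinear_on_diff[OF B_lin S(1)] B_in Binf_in x by metis
        then show "norm (B n (B n x) - B n (Binf x)) \<le> norm (B n x - Binf x)"
          using B_norm1[of "B n x - Binf x" n] B_in[OF x] Binf_in[OF x] S
          by (simp add: csubspace_intros)
      qed
      show "(\<lambda>n. norm (B n x - Binf x)) \<longlonglongrightarrow> 0"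
        using tendsto_Binf[OF x] by (intro tendsto_norm_zero) (simp add: LIM_zero)
    qed
    from tendsto_add[OF this tendsto_Binf[OF Binf_in[OF x]]] show ?thesis by simp
  qed
  then have "(\<lambda>n. (1/2) *\<^sub>R (A x + B n (B n x))) \<longlonglongrightarrow> (1/2) *\<^sub>R (A x + Binf (Binf x))"
    by (intro tendsto_intros)
  then have "(\<lambda>n. B (Suc n) x) \<longlonglongrightarrow> (1/2) *\<^sub>R (A x + Binf (Binf x))" by simp
  moreover have "(\<lambda>n. B (Suc n) x) \<longlonglongrightarrow> Binf x"
    using LIMSEQ_Suc[OF tendsto_Binf[OF x]] .
  ultimately have "Binf x = (1/2) *\<^sub>R (A x + Binf (Binf x))" using LIMSEQ_unique by blast
  then have "2 *\<^sub>R Binf x = 2 *\<^sub>R ((1/2) *\<^sub>R (A x + Binf (Binf x)))" by simp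
  then show ?thesis by simp
qed

lemma B_sa: "x \<in> S \<Longrightarrow> y \<in> S \<Longrightarrow> inner (B n x) y = inner x (B n y)"
  by (induction n arbitrary: x y) (simp_all add: inner_simps sa B_in)

lemma Binf_sa: "x \<in> S \<Longrightarrow> y \<in> S \<Longrightarrow> inner (Binf x) y = inner x (Binf y)"
proof -
  assume xy: "x \<in> S" "y \<in> S"
  have "(\<lambda>n. inner (B n x) y) \<longlonglongrightarrow> inner (Binf x) y"
    by (intro tendsto_intros tendsto_Binf xy)
  moreover have "(\<lambda>n. inner x (B n y)) \<longlonglongrightarrow> inner x (Binf y)"
    by (intro tendsto_intros tendsto_Binf xy)
  ultimately show ?thesis using B_sa[OF xy] LIMSEQ_unique by fastforce
qed

text \<open>Restricted to \<open>S\<close> because \<open>op_sqrt\<close> singles out an extensional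
  function.\<close>

definition root :: "'a \<Rightarrow> 'a" where "root = restrict (\<lambda>x. x - Binf x) S"

lemma root_sq: "x \<in> S \<Longrightarrow> root (root x) = x - A x"
proof -
  assume x: "x \<in> S"
  then have *: "x - Binf x \<in> S" "Binf x \<in> S" using S by (simp_all add: csubspace_intros Binf_in)
  have "root (root x) = x - (2 *\<^sub>R Binf x - Binf (Binf x))"
    using x * clinear_on_diff[OF Binf_lin S(1) x *(2)] by (simp add: root_def scaleR_2)
  also have "\<dots> = x - A x" using Binf_eq[OF x] by simp
  finally show ?thesis .
qed

lemma root_positive: "positive_on S root"
  unfolding positive_on_def
proof (intro conjI ballI)
  show "clinear_on S root"
    by (rule clinear_onI)
      (simp_all add: root_def S csubspace_intros clinear_on_add[OF Binf_lin]
        clinear_on_scaleC[OF Binf_lin] complex_vector.scale_right_diff_distrib)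
  show "root ` S \<subseteq> S" using S by (auto simp: root_def Binf_in intro: csubspace_intros)
  show "\<exists>c. \<forall>x\<in>S. norm (root x) \<le> c * norm x"
  proof (intro exI ballI)
    show "norm (root x) \<le> 2 * norm x" if "x \<in> S" for x
      using norm_triangle_ineq4[of x "Binf x"] Binf_norm[OF that] that by (simp add: root_def)
  qed
  fix x assume x: "x \<in> S"
  \<comment> \<open>Symmetry of \<open>Binf\<close> for the real inner product, together with
    complex linearity, makes its quadratic form real.\<close>
  have "inner (\<i> *\<^sub>C x) (Binf x) = 0"
  proof -
    have ix: "\<i> *\<^sub>C x \<in> S" using x S by (simp add: csubspace_intros)
    have "inner (\<i> *\<^sub>C x) (Binf x) = inner x (\<i> *\<^sub>C Binf x)"
      using Binf_sa[OF ix x] clinear_on_scaleC[OF Binf_lin x, of \<i>] Binf_sa[OF x ix]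
        Binf_sa[OF ix x] by (simp add: inner_commute)
    then show ?thesis
      by (simp add: inner_eq_Re_cinner cinner_scaleC_left cinner_scaleC_right)
  qed
  then show "Im (cinner x (root x)) = 0"
    using x by (simp add: root_def cinner.diff_right Im_cinner_self Im_cinner)
  have "inner x (Binf x) \<le> norm x * norm (Binf x)" by (rule norm_cauchy_schwarz)
  also have "\<dots> \<le> norm x * norm x" using Binf_norm[OF x] by (rule mult_left_mono) simp
  finally have "inner x (Binf x) \<le> inner x x" by (simp flip: power2_norm_eq_inner add: power2_eq_square)
  then show "0 \<le> Re (cinner x (root x))"
    using x by (simp add: root_def inner_simps flip: inner_eq_Re_cinner)
qed

text \<open>\<open>R\<close> commutes with its square \<open>1 - A\<close>, hence with
  \<open>A\<close>, with the iterates and, by continuity, with their limit; uniqueness among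
  commuting roots then applies.\<close>

lemma root_unique:
  assumes R: "positive_on S R" and sq: "\<And>x. x \<in> S \<Longrightarrow> R (R x) = x - A x" and x: "x \<in> S"
  shows "R x = root x"
proof (rule positive_on_sqrt_unique[OF S(1) R root_positive _ _ x])
  have L: "clinear_on S R" and RS: "\<And>x. x \<in> S \<Longrightarrow> R x \<in> S" and Rb: "bclinear_on S R"
    using R by (auto simp: positive_on_def bclinear_on_def)
  have RA: "R (A x) = A (R x)" if "x \<in> S" for x
  proof -
    have "A (R x) = R x - R (R (R x))" using sq[of "R x"] RS[OF that] by simp
    also have "\<dots> = R (x - R (R x))"
      using clinear_on_diff[OF L S(1) that, of "R (R x)"] RS that by simp
    also have "\<dots> = R (A x)" using sq[OF that] by simp
    finally show ?thesis by simp
  qed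
  show "R (root x) = root (R x)" if x: "x \<in> S" for x
  proof -
    have "(\<lambda>n. R (B n x)) \<longlonglongrightarrow> R (Binf x)"
      using bclinear_on_tendsto[OF Rb S(1) B_in[OF x] Binf_in[OF x] tendsto_Binf[OF x]] .
    moreover have "(\<lambda>n. R (B n x)) \<longlonglongrightarrow> Binf (R x)"
      using tendsto_Binf[OF RS[OF x]] by (simp add: commute_B[OF L RS RA x])
    ultimately have "R (Binf x) = Binf (R x)" using LIMSEQ_unique by blast
    then show ?thesis
      using clinear_on_diff[OF L S(1) x Binf_in[OF x]] x RS by (simp add: root_def)
  qed
qed (simp add: sq root_sq)

lemma op_sqrt_props:
  "positive_on S (op_sqrt S (\<lambda>x. x - A x))"
  "x \<in> S \<Longrightarrow> op_sqrt S (\<lambda>x. x - A x) (op_sqrt S (\<lambda>x. x - A x) x) = x - A x"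
proof -
  have "op_sqrt S (\<lambda>x. x - A x) = root"
    unfolding op_sqrt_def
  proof (rule the_equality)
    show "root \<in> extensional S \<and> positive_on S root \<and> (\<forall>x\<in>S. root (root x) = x - A x)"
      using root_positive root_sq by (simp add: root_def[abs_def])
    fix R assume R: "R \<in> extensional S \<and> positive_on S R \<and> (\<forall>x\<in>S. R (R x) = x - A x)"
    then show "R = root"
      using root_unique[of R] by (intro extensionalityI[of R S root]) (auto simp: root_def)
  qed
  then show "positive_on S (op_sqrt S (\<lambda>x. x - A x))"
    "x \<in> S \<Longrightarrow> op_sqrt S (\<lambda>x. x - A x) (op_sqrt S (\<lambda>x. x - A x) x) = x - A x"
    using root_positive root_sq by simp_all
qed

end

subsection \<open>Direct sums\<close>

lemmas coord_simps [simp] =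
  zero_l2.rep_eq plus_l2.rep_eq minus_l2.rep_eq uminus_l2.rep_eq scaleC_l2.rep_eq

lemma coord_single: "coord (single i x) j = (if j = i then x else 0)"
proof -
  have "(\<lambda>j. (norm (if j = i then x else 0))\<^sup>2) summable_on UNIV"
    by (rule finite_nonzero_values_imp_summable_on) (rule finite_subset[of _ "{i}"], auto)
  then show ?thesis by (simp add: single_def coord_Abs_l2)
qed

lemma single_add: "single i (x + y) = single i x + single i y"
  by (rule l2_eqI) (simp add: coord_single)

lemma single_scaleC: "single i (c *\<^sub>C x) = c *\<^sub>C single i x"
  by (rule l2_eqI) (simp add: coord_single)

lemma single_zero [simp]: "single i 0 = 0"
  by (rule l2_eqI) (simp add: coord_single)

lemma cinner_single: "cinner (single i x) y = cinner x (coord y i)"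
proof -
  have "((\<lambda>j. cinner (coord (single i x) j) (coord y j)) has_sum (cinner x (coord y i))) UNIV"
    by (rule has_sum_finite_neutralI[of "{i}"]) (auto simp: coord_single)
  then show ?thesis by (simp add: cinner_l2_def infsumI)
qed

lemma norm_single [simp]: "norm (single i x) = norm x"
proof -
  have "cinner (single i x) (single i x) = cinner x x"
    by (simp add: cinner_single coord_single)
  then have "(norm (single i x))\<^sup>2 = (norm x)\<^sup>2" by (simp only: cinner_self of_real_eq_iff)
  then show ?thesis by simp
qed

lemma isometric_single: "isometric A UNIV (single i)"
  by (simp add: isometric_def clinear_on_def single_add single_scaleC)

lemma clinear_on_coord: "clinear_on A (\<lambda>x. coord x i)"
  by (simp add: clinear_on_def)

lemma bclinear_on_coord: "bclinear_on A (\<lambda>x. coord x i)"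
  by (rule bclinear_onI[where c = 1, OF clinear_on_coord]) (simp add: norm_coord_le)

text \<open>\<open>l2_map\<close> passes through \<open>Abs_l2\<close>, so its coordinates are known
  only once the image family is square-summable, which the linear bound ensures.\<close>

lemma coord_l2_map:
  assumes "\<And>i. norm (f (coord x i)) \<le> c * norm (coord x i)"
  shows "coord (l2_map f x) i = f (coord x i)"
proof -
  have "(\<lambda>i. (norm (f (coord x i)))\<^sup>2) summable_on UNIV"
  proof (rule summable_on_comparison_test)
    show "(\<lambda>i. c\<^sup>2 * (norm (coord x i))\<^sup>2) summable_on UNIV"
      by (intro summable_on_cmult_right summable_coord)
    show "(norm (f (coord x i)))\<^sup>2 \<le> c\<^sup>2 * (norm (coord x i))\<^sup>2" for i
      using power_mono[OF assms[of i] norm_ge_zero, of 2] by (simp add: power_mult_distrib)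
  qed auto
  then show ?thesis by (simp add: l2_map_def coord_Abs_l2)
qed

lemma coord_l2_map_bclinear:
  assumes "bclinear_on A f" "x \<in> l2_of A"
  shows "coord (l2_map f x) i = f (coord x i)"
proof -
  obtain c where "\<forall>x\<in>A. norm (f x) \<le> c * norm x" using assms(1) by (auto simp: bclinear_on_def)
  then show ?thesis using assms(2) by (intro coord_l2_map[of _ _ c]) (auto simp: l2_of_def)
qed

lemma l2_ofD: "x \<in> l2_of S \<Longrightarrow> coord x i \<in> S"
  by (simp add: l2_of_def)

lemma l2_ofI: "(\<And>i. coord x i \<in> S) \<Longrightarrow> x \<in> l2_of S"
  by (simp add: l2_of_def)

lemma l2_of_mono: "S \<subseteq> T \<Longrightarrow> l2_of S \<subseteq> l2_of T"
  by (auto simp: l2_of_def)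

lemma single_in_l2_of: "csubspace S \<Longrightarrow> x \<in> S \<Longrightarrow> single i x \<in> l2_of S"
  by (simp add: l2_of_def coord_single csubspace_intros)

lemma csubspace_l2_of: "csubspace S \<Longrightarrow> csubspace (l2_of S)"
  by (rule csubspaceI) (auto simp: l2_of_def csubspace_intros)

lemma closed_l2_of:
  assumes "closed S"
  shows "closed (l2_of S :: ('i, 'a::complex_inner) l2 set)"
proof -
  have "closed {x \<in> UNIV :: ('i, 'a) l2 set. coord x i \<in> S}" for i
    by (rule closed_vimage_bclinear[OF bclinear_on_coord _ _ assms]) auto
  then have "closed (\<Inter>i. {x \<in> UNIV :: ('i, 'a) l2 set. coord x i \<in> S})" by blast
  also have "(\<Inter>i. {x \<in> UNIV :: ('i, 'a) l2 set. coord x i \<in> S}) = l2_of S"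
    by (auto simp: l2_of_def)
  finally show ?thesis .
qed

text \<open>A member of the left side orthogonal to all single-coordinate families over
  \<open>S\<close> has every coordinate orthogonal to itself. This reduces statements on rows to
  statements on letters.\<close>

lemma l2_of_eq_ccspan:
  fixes S :: "'a::complex_hilbert set"
  assumes S: "csubspace S" "closed S"
  shows "l2_of S = ccspan (\<Union>i. single i ` S)"
proof (rule closed_csubspace_eqI[symmetric])
  show "ccspan (\<Union>i. single i ` S) \<subseteq> l2_of S"
    using S by (intro ccspan_minimal csubspace_l2_of closed_l2_of) (auto simp: single_in_l2_of)
  show "csubspace (l2_of S)" by (rule csubspace_l2_of[OF S(1)])
  fix x :: "('b, 'a) l2"
  assume x: "x \<in> l2_of S" and orth: "\<And>s. s \<in> ccspan (\<Union>i. single i ` S) \<Longrightarrow> cinner s x = 0"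
  show "x = 0"
  proof (rule l2_eqI)
    fix i
    have "single i (coord x i) \<in> ccspan (\<Union>i. single i ` S)"
      by (rule subsetD[OF ccspan_superset]) (use l2_ofD[OF x] in auto)
    then show "coord x i = coord 0 i" using orth by (fastforce simp: cinner_single)
  qed
qed auto

lemma l2_map_single:
  assumes "clinear_on A f" "0 \<in> A"
  shows "l2_map f (single i x) = single i (f x)"
proof (rule l2_eqI)
  have "(\<lambda>j. f (coord (single i x) j)) = (\<lambda>j. if j = i then f x else 0)"
    using clinear_on_zero[OF assms] by (auto simp: coord_single)
  then show "coord (l2_map f (single i x)) j = coord (single i (f x)) j" for j
    by (simp add: l2_map_def single_def)
qed

lemma l2_map_in:
  assumes "bclinear_on A f" "f ` A \<subseteq> B" "x \<in> l2_of A"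
  shows "l2_map f x \<in> l2_of B"
  using assms(2) l2_ofD[OF assms(3)]
  by (intro l2_ofI) (auto simp: coord_l2_map_bclinear[OF assms(1,3)])

lemma norm_l2_map_le:
  assumes "\<And>i. norm (f (coord x i)) \<le> c * norm (coord x i)" "c \<ge> 0"
  shows "norm (l2_map f x) \<le> c * norm x"
proof -
  have "(\<Sum>\<^sub>\<infinity>i. (norm (coord (l2_map f x) i))\<^sup>2) \<le> (\<Sum>\<^sub>\<infinity>i. c\<^sup>2 * (norm (coord x i))\<^sup>2)"
  proof (rule infsum_mono[OF summable_coord])
    show "(\<lambda>i. c\<^sup>2 * (norm (coord x i))\<^sup>2) summable_on UNIV"
      by (intro summable_on_cmult_right summable_coord)
    show "(norm (coord (l2_map f x) i))\<^sup>2 \<le> c\<^sup>2 * (norm (coord x i))\<^sup>2" for i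
      using power_mono[OF assms(1)[of i] norm_ge_zero, of 2]
      by (simp only: power_mult_distrib coord_l2_map[OF assms(1)])
  qed
  also have "\<dots> = c\<^sup>2 * (\<Sum>\<^sub>\<infinity>i. (norm (coord x i))\<^sup>2)"
    by (rule infsum_cmult_right) (use summable_coord in blast)
  finally have "(norm (l2_map f x))\<^sup>2 \<le> (c * norm x)\<^sup>2"
    by (simp add: norm_l2_sq power_mult_distrib)
  then show ?thesis using assms(2) by (simp add: power2_le_iff_abs_le)
qed

lemma bclinear_on_l2_map:
  assumes f: "bclinear_on A f" and A: "csubspace A"
  shows "bclinear_on (l2_of A :: ('i, 'a::complex_inner) l2 set) (l2_map f)"
proof -
  obtain c where c: "c \<ge> 0" "\<forall>x\<in>A. norm (f x) \<le> c * norm x" using bclinear_on_bound[OF f] by blast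
  have L: "clinear_on A f" using f by (rule bclinear_on_imp_clinear_on)
  show ?thesis
  proof (rule bclinear_onI)
    show "clinear_on (l2_of A :: ('i, 'a) l2 set) (l2_map f)"
    proof (rule clinear_onI)
      fix x y :: "('i, 'a) l2" assume "x \<in> l2_of A" "y \<in> l2_of A"
      moreover from this have "x + y \<in> l2_of A" by (intro csubspace_intros csubspace_l2_of A)
      ultimately show "l2_map f (x + y) = l2_map f x + l2_map f y"
        by (intro l2_eqI) (simp add: coord_l2_map_bclinear[OF f] clinear_on_add[OF L] l2_ofD)
    next
      fix x :: "('i, 'a) l2" and k assume "x \<in> l2_of A"
      moreover from this have "k *\<^sub>C x \<in> l2_of A" by (intro csubspace_intros csubspace_l2_of A)
      ultimately show "l2_map f (k *\<^sub>C x) = k *\<^sub>C l2_map f x"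
        by (intro l2_eqI) (simp add: coord_l2_map_bclinear[OF f] clinear_on_scaleC[OF L] l2_ofD)
    qed
    show "norm (l2_map f x) \<le> c * norm x" if "x \<in> l2_of A" for x :: "('i, 'a) l2"
      using c l2_ofD[OF that] by (intro norm_l2_map_le) auto
  qed
qed

subsection \<open>Separability\<close>

lemma cspan_subset_closure_countable:
  fixes C :: "'a::complex_inner set"
  assumes C: "countable C"
  shows "\<exists>Q. countable Q \<and> cspan C \<subseteq> closure Q"
proof -
  obtain D :: "complex set" where D: "countable D" "\<And>X. open X \<Longrightarrow> X \<noteq> {} \<Longrightarrow> \<exists>d\<in>D. d \<in> X"
    using countable_dense_setE by blast
  have dense: "c \<in> closure D" for c
    unfolding closure_iff_nhds_not_empty
    by (metis D(2) IntI emptyE interior_eq interior_subset open_interior subsetD)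
  \<comment> \<open>Finite combinations with coefficients from the countable dense set, coded by
    lists so that countability is inherited from \<open>lists\<close>.\<close>
  define Q where "Q = (\<lambda>l. sum_list (map (\<lambda>(q, c). q *\<^sub>C c) l)) ` lists (D \<times> C)"
  have "countable Q" using C D(1) by (auto simp: Q_def)
  moreover have "x \<in> closure Q" if "x \<in> cspan C" for x
    using that
  proof (induction rule: complex_vector.span_induct_alt)
    case base
    have "0 \<in> Q" unfolding Q_def by (rule image_eqI[of _ _ "[]"]) auto
    then show ?case using closure_subset by blast
  next
    case (step a c y)
    obtain q where q: "\<And>n. q n \<in> D" "q \<longlonglongrightarrow> a" using dense[of a] by (auto simp: closure_sequential)
    obtain z where z: "\<And>n. z n \<in> Q" "z \<longlonglongrightarrow> y" using step by (auto simp: closure_sequential)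
    have "q n *\<^sub>C c + z n \<in> Q" for n
    proof -
      obtain l where "l \<in> lists (D \<times> C)" "z n = sum_list (map (\<lambda>(q, c). q *\<^sub>C c) l)"
        using z(1)[of n] by (auto simp: Q_def)
      then show ?thesis
        unfolding Q_def using q(1) step by (intro image_eqI[of _ _ "(q n, c) # l"]) auto
    qed
    moreover have "(\<lambda>n. q n *\<^sub>C c + z n) \<longlonglongrightarrow> a *\<^sub>C c + y"
      by (intro tendsto_add scaleC.tendsto q z tendsto_const)
    ultimately show ?case unfolding closure_sequential by (intro exI conjI allI)
  qed
  ultimately show ?thesis by blast
qed

lemma separable_if_subset_closure:
  fixes S :: "'a::metric_space set"
  assumes Q: "countable Q" "S \<subseteq> closure Q"
  shows "separable_space (top_of_set S)"
proof -
  \<comment> \<open>The points of \<open>Q\<close> need not lie in \<open>S\<close>, so nearby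
    points of \<open>S\<close> are chosen. Pairs without such a point receive an arbitrary value,
    hence the intersection with \<open>S\<close> in the definition of \<open>U\<close>.\<close>
  define f where "f p = (SOME s. s \<in> S \<and> dist (fst p) s < 1 / real (Suc (snd p)))" for p :: "'a \<times> nat"
  define U where "U = f ` (Q \<times> UNIV) \<inter> S"
  have "x \<in> closure U" if x: "x \<in> S" for x
    unfolding closure_approachable
  proof (intro allI impI)
    fix e :: real assume e: "e > 0"
    obtain n where n: "1 / real (Suc n) < e / 2" using e nat_approx_posE[of "e/2"] by auto
    obtain q where q: "q \<in> Q" "dist q x < 1 / real (Suc n)"
    proof -
      have "x \<in> closure Q" "0 < 1 / real (Suc n)" using Q(2) x by auto
      then show ?thesis using that unfolding closure_approachable by blast
    qed
    have "f (q, n) \<in> S \<and> dist q (f (q, n)) < 1 / real (Suc n)"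
      unfolding f_def fst_conv snd_conv by (rule someI[of _ x]) (use x q in auto)
    then show "\<exists>y\<in>U. dist y x < e"
      using q n dist_triangle[of "f (q, n)" x q]
      by (intro bexI[of _ "f (q, n)"]) (auto simp: U_def dist_commute)
  qed
  then show ?thesis
    unfolding separable_space_def using Q(1)
    by (intro exI[of _ U]) (auto simp: U_def closure_of_subtopology Int_absorb1)
qed

text \<open>A spanning set, unlike a dense subset, may lie outside \<open>S\<close>, so this form
  passes easily to subspaces and direct sums.\<close>

lemma separable_iff_ccspan:
  fixes S :: "'a::complex_inner set"
  shows "separable_space (top_of_set S) \<longleftrightarrow> (\<exists>C. countable C \<and> S \<subseteq> ccspan C)"
proof
  assume "separable_space (top_of_set S)"
  then obtain U where U: "countable U" "U \<subseteq> S" "top_of_set S closure_of U = S"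
    by (auto simp: separable_space_def)
  then have "S \<subseteq> closure U"
    using closure_mono[of "S \<inter> U" U] by (auto simp: closure_of_subtopology)
  also have "\<dots> \<subseteq> ccspan U" by (intro closure_minimal ccspan_superset) simp
  finally show "\<exists>C. countable C \<and> S \<subseteq> ccspan C" using U by blast
next
  assume "\<exists>C. countable C \<and> S \<subseteq> ccspan C"
  then obtain C Q where "S \<subseteq> ccspan C" "countable Q" "cspan C \<subseteq> closure Q"
    using cspan_subset_closure_countable by metis
  then have "S \<subseteq> closure Q"
    unfolding ccspan_def by (metis closed_closure closure_minimal order_trans)
  then show "separable_space (top_of_set S)"
    using \<open>countable Q\<close> by (intro separable_if_subset_closure)
qed

section \<open>Row isometries and processes\<close>

lemma word_Nil [simp]: "word X [] h = h"
  by (simp add: word_def)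

lemma word_Cons [simp]: "word X (k # \<alpha>) h = letter X k (word X \<alpha> h)"
  by (simp add: word_def)

locale row_isometry =
  fixes X :: "('d, 'h::complex_hilbert) process"
  assumes csubspace_hspace: "csubspace (hspace X)"
    and closed_hspace: "closed (hspace X)"
    and isometric_row: "isometric (l2_of (hspace X)) (hspace X) (row X)"
begin

abbreviation Vadj :: "'d \<Rightarrow> 'h \<Rightarrow> 'h"
  where "Vadj k \<equiv> adj (hspace X) (letter X k)"

lemmas hspace_closed_csubspace = csubspace_hspace closed_hspace

lemma l2_of_hspace: "csubspace (l2_of (hspace X))" "closed (l2_of (hspace X))"
  by (simp_all add: csubspace_l2_of closed_l2_of csubspace_hspace closed_hspace)

lemma row_in: "\<xi> \<in> l2_of (hspace X) \<Longrightarrow> row X \<xi> \<in> hspace X"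
  using isometric_row by (rule isometric_in)

lemma bclinear_on_row: "bclinear_on (l2_of (hspace X)) (row X)"
  using isometric_row by (rule isometric_bclinear_on)

lemma clinear_on_row: "clinear_on (l2_of (hspace X)) (row X)"
  using isometric_row by (rule isometric_clinear_on)

lemma cinner_row:
  "\<xi> \<in> l2_of (hspace X) \<Longrightarrow> \<eta> \<in> l2_of (hspace X) \<Longrightarrow> cinner (row X \<xi>) (row X \<eta>) = cinner \<xi> \<eta>"
  by (rule isometric_cinner[OF isometric_row l2_of_hspace(1)])

lemma single_in: "h \<in> hspace X \<Longrightarrow> single k h \<in> l2_of (hspace X)"
  by (rule single_in_l2_of[OF csubspace_hspace])

lemma letter_in: "h \<in> hspace X \<Longrightarrow> letter X k h \<in> hspace X"
  by (simp add: letter_def row_in single_in)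

lemma bclinear_on_letter: "bclinear_on (hspace X) (letter X k)"
  unfolding letter_def[abs_def]
  by (rule bclinear_on_compose[OF isometric_bclinear_on[OF isometric_single] bclinear_on_row])
    (auto simp: single_in)

lemma cinner_letter_row:
  "h \<in> hspace X \<Longrightarrow> \<xi> \<in> l2_of (hspace X) \<Longrightarrow> cinner (letter X k h) (row X \<xi>) = cinner h (coord \<xi> k)"
  by (simp add: letter_def cinner_row single_in cinner_single)

lemma cinner_letter:
  "h \<in> hspace X \<Longrightarrow> h' \<in> hspace X \<Longrightarrow>
    cinner (letter X k h) (letter X j h') = (if k = j then cinner h h' else 0)"
  unfolding letter_def[of X j] by (simp add: cinner_letter_row single_in coord_single)

lemma Vadj_in: "Vadj k y \<in> hspace X"
  by (rule adj_in[OF hspace_closed_csubspace bclinear_on_letter])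

lemma cinner_Vadj: "h \<in> hspace X \<Longrightarrow> cinner h (Vadj k y) = cinner (letter X k h) y"
  by (rule cinner_adj[OF hspace_closed_csubspace bclinear_on_letter])

lemma bclinear_on_Vadj: "bclinear_on A (Vadj k)"
  by (rule bclinear_on_adj[OF hspace_closed_csubspace bclinear_on_letter])

lemmas clinear_on_Vadj = bclinear_on_imp_clinear_on[OF bclinear_on_Vadj]

lemma Vadj_add: "Vadj k (x + y) = Vadj k x + Vadj k y"
  by (rule clinear_on_add[OF clinear_on_Vadj[of UNIV]]) auto

lemma Vadj_diff: "Vadj k (x - y) = Vadj k x - Vadj k y"
  by (rule clinear_on_diff[OF clinear_on_Vadj[of UNIV]]) auto

lemma Vadj_zero [simp]: "Vadj k 0 = 0"
  by (rule clinear_on_zero[OF clinear_on_Vadj[of UNIV]]) auto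

lemma Vadj_eqI:
  "v \<in> hspace X \<Longrightarrow> (\<And>h. h \<in> hspace X \<Longrightarrow> cinner h v = cinner (letter X k h) y) \<Longrightarrow> Vadj k y = v"
  by (rule adj_eqI[OF csubspace_hspace])

lemma Vadj_row: "\<xi> \<in> l2_of (hspace X) \<Longrightarrow> Vadj k (row X \<xi>) = coord \<xi> k"
  by (rule Vadj_eqI) (auto simp: l2_ofD cinner_letter_row)

definition row_star :: "'h \<Rightarrow> ('d, 'h) l2"
  where "row_star = adj (l2_of (hspace X)) (row X)"

lemma row_star_in: "row_star y \<in> l2_of (hspace X)"
  unfolding row_star_def by (rule adj_in[OF l2_of_hspace bclinear_on_row])

lemma cinner_row_star: "\<xi> \<in> l2_of (hspace X) \<Longrightarrow> cinner \<xi> (row_star y) = cinner (row X \<xi>) y"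
  unfolding row_star_def by (rule cinner_adj[OF l2_of_hspace bclinear_on_row])

lemma coord_row_star: "coord (row_star y) k = Vadj k y"
proof (rule Vadj_eqI[symmetric])
  show "coord (row_star y) k \<in> hspace X" using row_star_in by (rule l2_ofD)
  fix h assume h: "h \<in> hspace X"
  then show "cinner h (coord (row_star y) k) = cinner (letter X k h) y"
    using cinner_row_star[OF single_in[OF h, of k], of y] by (simp add: cinner_single letter_def)
qed

text \<open>The coordinates of \<open>row_star y\<close> are the \<open>V_k^* y\<close>, so
  \<open>row_star y\<close> vanishes.\<close>

lemma cinner_row_eq_0:
  assumes "\<And>k. Vadj k y = 0" "\<xi> \<in> l2_of (hspace X)"
  shows "cinner (row X \<xi>) y = 0"
proof -
  have "row_star y = 0" by (rule l2_eqI) (simp add: coord_row_star assms)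
  then show ?thesis using cinner_row_star[OF assms(2), of y] by simp
qed

text \<open>This is 1 - V V^*, which for the isometry V is the projection onto the kernel of V^*,
  the wandering subspace.\<close>

definition wandering :: "'h \<Rightarrow> 'h"
  where "wandering y = y - row X (row_star y)"

lemma wandering_in: "y \<in> hspace X \<Longrightarrow> wandering y \<in> hspace X"
  unfolding wandering_def
  by (rule complex_vector.subspace_diff[OF csubspace_hspace _ row_in[OF row_star_in]])

lemma Vadj_wandering: "Vadj k (wandering y) = 0"
  by (simp add: wandering_def Vadj_diff Vadj_row[OF row_star_in] coord_row_star)

lemma word_in: "h \<in> hspace X \<Longrightarrow> word X \<alpha> h \<in> hspace X"
  by (induction \<alpha>) (auto simp: letter_in)

lemma row_l2_of_subset:
  assumes S: "csubspace S" "closed S" "S \<subseteq> hspace X" and T: "csubspace T" "closed T"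
    and "\<And>k s. s \<in> S \<Longrightarrow> letter X k s \<in> T"
  shows "row X ` l2_of S \<subseteq> T"
  unfolding l2_of_eq_ccspan[OF S(1,2)]
proof (rule bclinear_on_image_ccspan[OF _ _ T])
  show "bclinear_on (ccspan (\<Union>i. single i ` S)) (row X)"
    using bclinear_on_subset[OF bclinear_on_row l2_of_mono[OF S(3)]]
    unfolding l2_of_eq_ccspan[OF S(1,2)] .
qed (use assms in \<open>auto simp: letter_def\<close>)

lemma generated_superset: "S \<subseteq> generated X S"
proof -
  have "word X [] ` S \<subseteq> ccspan (\<Union>\<alpha>. word X \<alpha> ` S)"
    by (rule order_trans[OF _ ccspan_superset]) blast
  then show ?thesis by (simp add: generated_def)
qed

lemma word_in_generated: "s \<in> S \<Longrightarrow> word X \<alpha> s \<in> generated X S"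
  unfolding generated_def by (rule subsetD[OF ccspan_superset]) blast

lemma csubspace_generated: "csubspace (generated X S)"
  and closed_generated: "closed (generated X S)"
  by (simp_all add: generated_def)

lemma generated_minimal:
  assumes "S \<subseteq> T" "csubspace T" "closed T" "\<And>k h. h \<in> T \<Longrightarrow> letter X k h \<in> T"
  shows "generated X S \<subseteq> T"
  unfolding generated_def
proof (rule ccspan_minimal)
  have "word X \<alpha> s \<in> T" if "s \<in> S" for \<alpha> s
    using that assms by (induction \<alpha>) auto
  then show "(\<Union>\<alpha>. word X \<alpha> ` S) \<subseteq> T" by auto
qed (rule assms)+

lemma generated_subset: "S \<subseteq> hspace X \<Longrightarrow> generated X S \<subseteq> hspace X"
  by (rule generated_minimal) (auto simp: csubspace_hspace closed_hspace letter_in)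

lemma letter_generated:
  assumes "S \<subseteq> hspace X" "h \<in> generated X S"
  shows "letter X k h \<in> generated X S"
proof -
  have "letter X k ` ccspan (\<Union>\<alpha>. word X \<alpha> ` S) \<subseteq> generated X S"
  proof (rule bclinear_on_image_ccspan)
    show "bclinear_on (ccspan (\<Union>\<alpha>. word X \<alpha> ` S)) (letter X k)"
      using bclinear_on_subset[OF bclinear_on_letter generated_subset[OF assms(1)]]
      by (simp add: generated_def)
    show "letter X k ` (\<Union>\<alpha>. word X \<alpha> ` S) \<subseteq> generated X S"
      using word_in_generated[of _ S "k # _"] by auto
  qed (simp_all add: csubspace_generated closed_generated)
  then show ?thesis using assms(2) by (auto simp: generated_def)
qed

lemma row_generated: "S \<subseteq> hspace X \<Longrightarrow> row X ` l2_of (generated X S) \<subseteq> generated X S"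
  by (intro row_l2_of_subset csubspace_generated closed_generated generated_subset letter_generated)

end

text \<open>Since the ranges of the letters are orthogonal, it suffices to compare one-sided Gram matrices.\<close>

lemma intertwiner:
  fixes R :: "('d, 'r::complex_hilbert) process" and S :: "('d, 's::complex_hilbert) process"
  assumes R: "row_isometry R" and S: "row_isometry S"
    and A: "A \<subseteq> hspace R" and s: "s ` A \<subseteq> hspace S"
    and gram: "\<And>x y \<alpha>. x \<in> A \<Longrightarrow> y \<in> A \<Longrightarrow> cinner (word S \<alpha> (s x)) (s y) = cinner (word R \<alpha> x) y"
  obtains U where "unitary (generated R A) (generated S (s ` A)) U"
    and "\<And>x \<alpha>. x \<in> A \<Longrightarrow> U (word R \<alpha> x) = word S \<alpha> (s x)"
    and "\<And>k h. h \<in> generated R A \<Longrightarrow> U (letter R k h) = letter S k (U h)"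
    and "\<And>\<xi>. \<xi> \<in> l2_of (generated R A) \<Longrightarrow> U (row R \<xi>) = row S (l2_map U \<xi>)"
proof -
  interpret R: row_isometry R by (rule R)
  interpret S: row_isometry S by (rule S)
  have inA: "x \<in> hspace R" "s x \<in> hspace S" if "x \<in> A" for x
    using that A s by auto
  have G: "cinner (word R \<alpha> x) (word R \<beta> y) = cinner (word S \<alpha> (s x)) (word S \<beta> (s y))"
    if xy: "x \<in> A" "y \<in> A" for \<alpha> \<beta> x y
  proof (induction \<alpha> arbitrary: \<beta>)
    case Nil
    show ?case
      using gram[OF xy(2,1), of \<beta>] by (metis cinner_commute word_Nil)
  next
    case (Cons k \<alpha>)
    show ?case
    proof (cases \<beta>)
      case Nil
      then show ?thesis using gram[OF xy, of "k # \<alpha>"] by simp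
    next
      \<comment> \<open>Two nonempty words: equal first letters cancel and different ones give 0, in
        both processes alike.\<close>
      case (Cons j \<gamma>)
      then show ?thesis
        by (simp add: R.cinner_letter S.cinner_letter R.word_in S.word_in inA xy Cons.IH)
    qed
  qed
  define a where "a p = word R (fst p) (snd p)" for p
  define b where "b p = word S (fst p) (s (snd p))" for p
  have "cinner (a p) (a q) = cinner (b p) (b q)" if "p \<in> UNIV \<times> A" "q \<in> UNIV \<times> A" for p q
    using that G by (auto simp: a_def b_def)
  then obtain U where U: "unitary (ccspan (a ` (UNIV \<times> A))) (ccspan (b ` (UNIV \<times> A))) U"
    and Ua: "\<And>p. p \<in> UNIV \<times> A \<Longrightarrow> U (a p) = b p"
    using unitary_from_gram[of "UNIV \<times> A" a b] by blast
  have eq: "ccspan (a ` (UNIV \<times> A)) = generated R A" "ccspan (b ` (UNIV \<times> A)) = generated S (s ` A)"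
    unfolding generated_def a_def b_def by (auto intro!: arg_cong[of _ _ ccspan] simp: image_def)
  have word: "U (word R \<alpha> x) = word S \<alpha> (s x)" if "x \<in> A" for x \<alpha>
    using Ua[of "(\<alpha>, x)"] that by (simp add: a_def b_def)
  have Ub: "bclinear_on (generated R A) U" and UL: "clinear_on (generated R A) U"
    and U_img: "U ` generated R A \<subseteq> generated S (s ` A)"
    using U by (auto simp: unitary_def eq intro: isometric_bclinear_on isometric_clinear_on)
  have letter: "U (letter R k h) = letter S k (U h)" if h: "h \<in> generated R A" for k h
  proof (rule bclinear_on_eq_ccspan[of "generated R A" _ _ "\<Union>\<alpha>. word R \<alpha> ` A"])
    show "bclinear_on (generated R A) (\<lambda>h. U (letter R k h))"
      using bclinear_on_subset[OF R.bclinear_on_letter R.generated_subset[OF A]] Ub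
      by (rule bclinear_on_compose) (use R.letter_generated[OF A] in auto)
    show "bclinear_on (generated R A) (\<lambda>h. letter S k (U h))"
      using Ub S.bclinear_on_letter
      by (rule bclinear_on_compose) (use U_img S.generated_subset[OF s] in auto)
    show "h \<in> ccspan (\<Union>\<alpha>. word R \<alpha> ` A)" using h by (simp add: generated_def)
    fix b assume "b \<in> (\<Union>\<alpha>. word R \<alpha> ` A)"
    then obtain \<alpha> x where "x \<in> A" "b = word R \<alpha> x" by auto
    then show "U (letter R k b) = letter S k (U b)"
      using word[of x "k # \<alpha>"] word[of x \<alpha>] by simp
  qed (use R.word_in_generated R.csubspace_generated R.closed_generated in auto)
  let ?M = "generated R A"
  have M: "csubspace ?M" "closed ?M" "0 \<in> ?M"
    by (simp_all add: R.csubspace_generated R.closed_generated csubspace_intros)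
  show thesis
  proof
    show "unitary (generated R A) (generated S (s ` A)) U" using U by (simp add: eq)
    show "U (word R \<alpha> x) = word S \<alpha> (s x)" if "x \<in> A" for x \<alpha> using word that .
    show "U (letter R k h) = letter S k (U h)" if "h \<in> ?M" for k h using letter that .
    show "U (row R \<xi>) = row S (l2_map U \<xi>)" if \<xi>: "\<xi> \<in> l2_of ?M" for \<xi>
    proof (rule bclinear_on_eq_ccspan[of "l2_of ?M" _ _ "\<Union>i. single i ` ?M"])
      show "bclinear_on (l2_of ?M) (\<lambda>\<xi>. U (row R \<xi>))"
        using bclinear_on_subset[OF R.bclinear_on_row l2_of_mono[OF R.generated_subset[OF A]]] Ub
          R.row_generated[OF A]
        by (rule bclinear_on_compose)
      show "bclinear_on (l2_of ?M) (\<lambda>\<xi>. row S (l2_map U \<xi>))"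
      proof (rule bclinear_on_compose[OF bclinear_on_l2_map[OF Ub M(1)] S.bclinear_on_row])
        show "l2_map U ` l2_of ?M \<subseteq> l2_of (hspace S)"
          using U_img S.generated_subset[OF s] by (auto intro!: l2_map_in[OF Ub])
      qed
      show "\<xi> \<in> ccspan (\<Union>i. single i ` ?M)" using \<xi> by (simp add: l2_of_eq_ccspan[OF M(1,2)])
      fix b :: "('d, 'r) l2" assume "b \<in> (\<Union>i. single i ` ?M)"
      then obtain k h where kh: "h \<in> ?M" "b = single k h" by auto
      then show "U (row R b) = row S (l2_map U b)"
        using letter[of h k] by (simp add: letter_def l2_map_single[OF UL M(3)])
    qed (use M in \<open>auto simp: csubspace_l2_of closed_l2_of single_in_l2_of\<close>)
  qed
qed

section \<open>The spaces \<open>reach\<close>, \<open>\<E>\<close> and \<open>\<E>_star\<close> of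
  a process\<close>

locale markov_process = row_isometry X for X :: "('d, 'h::complex_hilbert) process" +
  assumes csubspace_base: "csubspace (base X)"
    and closed_base: "closed (base X)"
    and base_subset: "base X \<subseteq> hspace X"
    and coinvariant_base: "coinvariant X (base X)"
    and hspace_eq: "hspace X = generated X (base X)"

lemma is_process_iff:
  "is_process X \<longleftrightarrow> separable_space (top_of_set (hspace X)) \<and> markov_process X"
  unfolding is_process_def markov_process_def row_isometry_def markov_process_axioms_def by blast

context markov_process
begin

lemmas base_closed_csubspace = csubspace_base closed_base

lemma base_in: "x \<in> base X \<Longrightarrow> x \<in> hspace X"
  using base_subset by blast

lemma Vadj_base: "x \<in> base X \<Longrightarrow> Vadj k x \<in> base X"
  using coinvariant_base by (auto simp: coinvariant_def)

lemma l2_of_base: "\<xi> \<in> l2_of (base X) \<Longrightarrow> \<xi> \<in> l2_of (hspace X)"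
  using l2_of_mono[OF base_subset] by blast

lemma hspace_induct:
  assumes T: "csubspace T" "closed T" "\<And>x \<alpha>. x \<in> base X \<Longrightarrow> word X \<alpha> x \<in> T"
  shows "hspace X \<subseteq> T"
  unfolding hspace_eq generated_def by (rule ccspan_minimal) (use T in auto)

text \<open>A nonempty word pairs with \<open>y\<close> through \<open>V_k^* y = 0\<close> and the
  empty one through the base, so \<open>y\<close> is orthogonal to a generating set. This is how
  minimality is used.\<close>

lemma orth_hspace:
  assumes y: "y \<in> hspace X" "\<And>x. x \<in> base X \<Longrightarrow> cinner x y = 0" "\<And>k. Vadj k y = 0"
  shows "y = 0"
proof -
  have "hspace X \<subseteq> {h. \<forall>z\<in>{y}. cinner z h = 0}"
  proof (rule hspace_induct[OF csubspace_orth closed_orth])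
    fix x \<alpha> assume x: "x \<in> base X"
    have "cinner (word X \<alpha> x) y = 0"
    proof (cases \<alpha>)
      case (Cons k \<beta>)
      have "cinner (word X \<beta> x) (Vadj k y) = cinner (word X \<alpha> x) y"
        using x by (simp add: Cons cinner_Vadj word_in base_in)
      then show ?thesis by (simp add: y(3))
    qed (simp add: x y)
    then show "word X \<alpha> x \<in> {h. \<forall>z\<in>{y}. cinner z h = 0}" by (simp add: cinner_eq_0_commute)
  qed
  then have "cinner y y = 0" using y(1) by auto
  then show ?thesis by simp
qed

definition reach :: "'h set"
  where "reach = {u \<in> hspace X. \<forall>k. Vadj k u \<in> base X}"

lemma reach_eq_Inter: "reach = hspace X \<inter> (\<Inter>k. {u \<in> hspace X. Vadj k u \<in> base X})"
  by (auto simp: reach_def)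

lemma csubspace_reach: "csubspace reach"
  unfolding reach_def
  by (rule csubspaceI)
    (auto simp: csubspace_hspace csubspace_base csubspace_intros Vadj_add
      clinear_on_scaleC[OF clinear_on_Vadj[of UNIV]])

lemma closed_reach: "closed reach"
proof -
  have "closed {u \<in> hspace X. Vadj k u \<in> base X}" for k
    by (rule closed_vimage_bclinear[OF bclinear_on_Vadj hspace_closed_csubspace closed_base])
  then show ?thesis unfolding reach_eq_Inter using closed_hspace by blast
qed

lemma base_reach: "base X \<subseteq> reach"
  by (auto simp: reach_def Vadj_base base_in)

lemma row_reach: "\<xi> \<in> l2_of (base X) \<Longrightarrow> row X \<xi> \<in> reach"
  using row_in[OF l2_of_base] l2_ofD by (auto simp: reach_def Vadj_row[OF l2_of_base])

text \<open>An element of \<open>reach\<close> orthogonal to the left-hand side is orthogonal to all \<open>V\<^sub>\<alpha> \<hh>\<close>.\<close>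

lemma ccspan_base_row: "ccspan (base X \<union> row X ` l2_of (base X)) = reach"
proof (rule closed_csubspace_eqI)
  let ?T = "ccspan (base X \<union> row X ` l2_of (base X))"
  show "?T \<subseteq> reach"
    using base_reach row_reach by (intro ccspan_minimal csubspace_reach closed_reach) auto
  fix z assume z: "z \<in> reach" and orth: "\<And>s. s \<in> ?T \<Longrightarrow> cinner s z = 0"
  have "base X \<union> row X ` l2_of (base X) \<subseteq> ?T" by (rule ccspan_superset)
  then have T: "base X \<subseteq> ?T" "row X ` l2_of (base X) \<subseteq> ?T" by simp_all
  show "z = 0"
  proof (rule orth_hspace)
    show "z \<in> hspace X" using z by (simp add: reach_def)
    show "cinner x z = 0" if "x \<in> base X" for x using that T orth by blast
    fix k
    have v: "Vadj k z \<in> base X" using z by (simp add: reach_def)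
    then have "letter X k (Vadj k z) \<in> ?T"
      unfolding letter_def by (intro subsetD[OF T(2)] imageI single_in_l2_of[OF csubspace_base])
    then have "cinner (letter X k (Vadj k z)) z = 0" by (rule orth)
    then have "cinner (Vadj k z) (Vadj k z) = 0" using v by (simp add: cinner_Vadj base_in)
    then show "Vadj k z = 0" by simp
  qed
qed (simp_all add: csubspace_reach)

lemma E_eq: "\<E> X = reach \<ominus> base X"
  by (simp add: \<E>_def ccspan_base_row)

text \<open>If \<open>u\<close> is in \<open>reach\<close>, then \<open>V_k^* u\<close> lies in the
  base, and orthogonality of \<open>u\<close> to \<open>V_k V_k^* u\<close> says that
  \<open>V_k^* u\<close> has norm 0.\<close>

lemma E_star_eq: "\<E>_star X = {u \<in> hspace X. \<forall>k. Vadj k u = 0}"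
proof
  show "\<E>_star X \<subseteq> {u \<in> hspace X. \<forall>k. Vadj k u = 0}"
  proof (intro subsetI CollectI conjI allI)
    fix u k assume "u \<in> \<E>_star X"
    then have u: "u \<in> reach" "\<And>\<xi>. \<xi> \<in> l2_of (base X) \<Longrightarrow> cinner (row X \<xi>) u = 0"
      by (auto simp: \<E>_star_def ccspan_base_row ominus_def)
    then show "u \<in> hspace X" by (simp add: reach_def)
    have v: "Vadj k u \<in> base X" using u by (simp add: reach_def)
    then have "cinner (Vadj k u) (Vadj k u) = 0"
      using u(2)[OF single_in_l2_of[OF csubspace_base v, of k]]
      by (simp add: cinner_Vadj base_in letter_def)
    then show "Vadj k u = 0" by simp
  qed
  show "{u \<in> hspace X. \<forall>k. Vadj k u = 0} \<subseteq> \<E>_star X"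
    using cinner_row_eq_0[OF _ l2_of_base] csubspace_base
    by (auto simp: \<E>_star_def ccspan_base_row ominus_def reach_def csubspace_intros)
qed

lemma csubspace_E: "csubspace (\<E> X)" and closed_E: "closed (\<E> X)"
  by (simp_all add: E_eq csubspace_ominus closed_ominus csubspace_reach closed_reach)

lemma csubspace_E_star: "csubspace (\<E>_star X)" and closed_E_star: "closed (\<E>_star X)"
  by (simp_all add: \<E>_star_def csubspace_ominus closed_ominus)

lemmas E_closed_csubspace = csubspace_E closed_E
lemmas E_star_closed_csubspace = csubspace_E_star closed_E_star

lemma E_in: "e \<in> \<E> X \<Longrightarrow> e \<in> hspace X"
  and E_reach: "e \<in> \<E> X \<Longrightarrow> e \<in> reach"
  and cinner_base_E: "e \<in> \<E> X \<Longrightarrow> x \<in> base X \<Longrightarrow> cinner x e = 0"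
  by (simp_all add: E_eq ominus_def reach_def)

lemma E_star_in: "e \<in> \<E>_star X \<Longrightarrow> e \<in> hspace X"
  and Vadj_E_star: "e \<in> \<E>_star X \<Longrightarrow> Vadj k e = 0"
  by (simp_all add: E_star_eq)

lemma cinner_row_E_star: "e \<in> \<E>_star X \<Longrightarrow> \<xi> \<in> l2_of (hspace X) \<Longrightarrow> cinner (row X \<xi>) e = 0"
  by (rule cinner_row_eq_0) (simp add: Vadj_E_star)

text \<open>Holds since \<open>\<E> X\<close> is the orthogonal complement of the base inside
  \<open>reach\<close>.\<close>

lemma proj_E_reach: "u \<in> reach \<Longrightarrow> proj (\<E> X) u = u - proj (base X) u"
proof (rule proj_eqI[OF csubspace_E])
  assume u: "u \<in> reach"
  have p: "proj (base X) u \<in> base X" by (rule proj_in[OF base_closed_csubspace])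
  then have "u - proj (base X) u \<in> reach"
    using u base_reach csubspace_reach by (intro complex_vector.subspace_diff) auto
  then show "u - proj (base X) u \<in> \<E> X"
    by (simp add: E_eq ominus_def cinner.diff_right cinner_proj[OF base_closed_csubspace])
  show "cinner s (u - proj (base X) u) = cinner s u" if "s \<in> \<E> X" for s
    using cinner_base_E[OF that p] by (simp add: cinner.diff_right cinner_eq_0_commute)
qed

lemma wandering_E_star: "y \<in> hspace X \<Longrightarrow> wandering y \<in> \<E>_star X"
  by (simp add: E_star_eq wandering_in Vadj_wandering)

lemma proj_E_star: "y \<in> hspace X \<Longrightarrow> proj (\<E>_star X) y = wandering y"
proof (rule proj_eqI[OF csubspace_E_star wandering_E_star])
  fix s assume "s \<in> \<E>_star X"
  then have "cinner s (row X (row_star y)) = 0"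
    using cinner_row_E_star[OF _ row_star_in] by (simp add: cinner_eq_0_commute)
  then show "cinner s (wandering y) = cinner s y" by (simp add: wandering_def cinner.diff_right)
qed

text \<open>A vector of \<open>\<E>_star X\<close> orthogonal to the projected base is orthogonal to
  the base itself, and all \<open>V_k^*\<close> kill it, so it is 0. Hence \<gamma> is determined by
  its values on projected base vectors.\<close>

lemma E_star_eq_ccspan: "\<E>_star X = ccspan (proj (\<E>_star X) ` base X)"
proof (rule closed_csubspace_eqI[symmetric])
  show "ccspan (proj (\<E>_star X) ` base X) \<subseteq> \<E>_star X"
    using proj_in[OF E_star_closed_csubspace] by (intro ccspan_minimal E_star_closed_csubspace) auto
  fix x assume x: "x \<in> \<E>_star X"
    and orth: "\<And>s. s \<in> ccspan (proj (\<E>_star X) ` base X) \<Longrightarrow> cinner s x = 0"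
  show "x = 0"
  proof (rule orth_hspace)
    fix b assume "b \<in> base X"
    then have "cinner (proj (\<E>_star X) b) x = 0"
      by (intro orth subsetD[OF ccspan_superset] imageI)
    then show "cinner b x = 0" by (simp add: cinner_proj'[OF E_star_closed_csubspace x])
  qed (simp_all add: x E_star_in Vadj_E_star)
qed (simp_all add: csubspace_E_star)

end

section \<open>The \<gamma>-extension\<close>

lemma csubspace_Times: "csubspace S \<Longrightarrow> csubspace T \<Longrightarrow> csubspace (S \<times> T)"
  by (rule csubspaceI) (auto simp: scaleC_prod_def zero_prod_def csubspace_intros)

text \<open>The unitary that identifies the full Fock space with one copy of the coefficient space
  plus one copy of the Fock space per letter: \<open>a\<close> goes to the empty word and component
  \<open>k\<close> of \<open>\<zeta>\<close> to the words beginning with \<open>k\<close>. It forms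
  the third component of the new row.\<close>

definition l2_Cons :: "'b \<Rightarrow> ('i, ('i list, 'b) l2) l2 \<Rightarrow> ('i list, 'b::complex_inner) l2"
  where "l2_Cons a \<zeta> = Abs_l2 (\<lambda>\<alpha>. case \<alpha> of [] \<Rightarrow> a | k # \<beta> \<Rightarrow> coord (coord \<zeta> k) \<beta>)"

text \<open>A nonempty word is a pair of first letter and rest, so the sum over words is an iterated
  sum plus the term at the empty word.\<close>

lemma has_sum_l2_Cons:
  "((\<lambda>\<alpha>. (norm (case \<alpha> of [] \<Rightarrow> a | k # \<beta> \<Rightarrow> coord (coord \<zeta> k) \<beta>))\<^sup>2) has_sum
    ((norm a)\<^sup>2 + (norm \<zeta>)\<^sup>2)) UNIV"
proof -
  let ?f = "\<lambda>\<alpha>. (norm (case \<alpha> of [] \<Rightarrow> a | k # \<beta> \<Rightarrow> coord (coord \<zeta> k) \<beta>))\<^sup>2"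
  have "((\<lambda>(k, \<beta>). (norm (coord (coord \<zeta> k) \<beta>))\<^sup>2) has_sum (norm \<zeta>)\<^sup>2) (UNIV \<times> UNIV)"
  proof (rule has_sum_SigmaI)
    show inner: "((\<lambda>\<beta>. case (k, \<beta>) of (k, \<beta>) \<Rightarrow> (norm (coord (coord \<zeta> k) \<beta>))\<^sup>2) has_sum
        (norm (coord \<zeta> k))\<^sup>2) UNIV" for k
      using summable_coord[of "coord \<zeta> k"] by (simp add: norm_l2_sq has_sum_infsum)
    show outer: "((\<lambda>k. (norm (coord \<zeta> k))\<^sup>2) has_sum (norm \<zeta>)\<^sup>2) UNIV"
      using summable_coord[of \<zeta>] by (simp add: norm_l2_sq[of \<zeta>] has_sum_infsum)
    show "(\<lambda>(k, \<beta>). (norm (coord (coord \<zeta> k) \<beta>))\<^sup>2) summable_on UNIV \<times> UNIV"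
      by (rule summable_on_SigmaI[OF inner summable_coord]) auto
  qed
  moreover have inj: "inj_on (\<lambda>(k, \<beta>). k # \<beta>) (UNIV \<times> UNIV)" by (auto simp: inj_on_def)
  moreover have "?f \<circ> (\<lambda>(k, \<beta>). k # \<beta>) = (\<lambda>(k, \<beta>). (norm (coord (coord \<zeta> k) \<beta>))\<^sup>2)"
    by auto
  ultimately have "(?f has_sum (norm \<zeta>)\<^sup>2) ((\<lambda>(k, \<beta>). k # \<beta>) ` (UNIV \<times> UNIV))"
    by (simp only: has_sum_reindex[OF inj])
  then have A: "(?f has_sum (?f [] + (norm \<zeta>)\<^sup>2)) (insert [] ((\<lambda>(k, \<beta>). k # \<beta>) ` (UNIV \<times> UNIV)))"
    by (intro has_sum_insert) auto
  have U: "insert [] ((\<lambda>(k, \<beta>). k # \<beta>) ` (UNIV \<times> UNIV)) = UNIV"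
    by (auto simp: image_iff) (metis neq_Nil_conv)
  show ?thesis using A unfolding U by simp
qed

lemma coord_l2_Cons:
  "coord (l2_Cons a \<zeta>) \<alpha> = (case \<alpha> of [] \<Rightarrow> a | k # \<beta> \<Rightarrow> coord (coord \<zeta> k) \<beta>)"
  using has_sum_l2_Cons[of a \<zeta>] by (simp add: l2_Cons_def coord_Abs_l2 has_sum_imp_summable)

lemma coord_l2_Cons_simps [simp]:
  "coord (l2_Cons a \<zeta>) [] = a" "coord (l2_Cons a \<zeta>) (k # \<beta>) = coord (coord \<zeta> k) \<beta>"
  by (simp_all add: coord_l2_Cons)

lemma norm_l2_Cons: "(norm (l2_Cons a \<zeta>))\<^sup>2 = (norm a)\<^sup>2 + (norm \<zeta>)\<^sup>2"
  using has_sum_l2_Cons[of a \<zeta>] by (simp add: norm_l2_sq[of "l2_Cons a \<zeta>"] coord_l2_Cons infsumI)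

lemma l2_list_eqI:
  "coord x [] = coord y [] \<Longrightarrow> (\<And>k \<beta>. coord x (k # \<beta>) = coord y (k # \<beta>)) \<Longrightarrow> x = y"
  by (rule l2_eqI) (metis neq_Nil_conv)

lemma l2_Cons_add: "l2_Cons (a + b) (\<zeta> + \<eta>) = l2_Cons a \<zeta> + l2_Cons b \<eta>"
  by (rule l2_list_eqI) simp_all

lemma l2_Cons_scaleC: "l2_Cons (c *\<^sub>C a) (c *\<^sub>C \<zeta>) = c *\<^sub>C l2_Cons a \<zeta>"
  by (rule l2_list_eqI) simp_all

lemma l2_Cons_zero: "l2_Cons a 0 = single [] a"
  by (rule l2_list_eqI) (simp_all add: coord_single)

lemma l2_Cons_single: "l2_Cons 0 (single k (single \<beta> d)) = single (k # \<beta>) d"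
  by (rule l2_list_eqI) (auto simp: coord_single)

lemma norm_fst_snd_le:
  fixes p :: "'a::real_normed_vector \<times> 'b::real_normed_vector"
  shows "norm (fst p) \<le> norm p" "norm (snd p) \<le> norm p"
  by (cases p, simp add: norm_fst_le norm_snd_le)+

lemma coord_l2_map_fst: "coord (l2_map fst \<Xi>) k = fst (coord \<Xi> k)"
  by (rule coord_l2_map[where c = 1]) (simp add: norm_fst_snd_le)

lemma coord_l2_map_snd: "coord (l2_map snd \<Xi>) k = snd (coord \<Xi> k)"
  by (rule coord_l2_map[where c = 1]) (simp add: norm_fst_snd_le)

lemma norm_l2_prod_sq:
  fixes \<Xi> :: "('i, 'a::complex_inner \<times> 'b::complex_inner) l2"
  shows "(norm \<Xi>)\<^sup>2 = (norm (l2_map fst \<Xi>))\<^sup>2 + (norm (l2_map snd \<Xi>))\<^sup>2"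
proof -
  have "(norm (coord \<Xi> i))\<^sup>2 = (norm (coord (l2_map fst \<Xi>) i))\<^sup>2 + (norm (coord (l2_map snd \<Xi>) i))\<^sup>2" for i
    by (simp add: coord_l2_map_fst coord_l2_map_snd norm_prod_def)
  then show ?thesis
    unfolding norm_l2_sq by (simp add: infsum_add summable_coord)
qed

lemma l2_map_prod_lin:
  "l2_map fst (\<Xi> + \<Xi>') = l2_map fst \<Xi> + l2_map fst \<Xi>'"
  "l2_map snd (\<Xi> + \<Xi>') = l2_map snd \<Xi> + l2_map snd \<Xi>'"
  "l2_map fst (c *\<^sub>C \<Xi>) = c *\<^sub>C l2_map fst \<Xi>"
  "l2_map snd (c *\<^sub>C \<Xi>) = c *\<^sub>C l2_map snd \<Xi>"
  by (auto intro!: l2_eqI simp: coord_l2_map_fst coord_l2_map_snd scaleC_prod_def)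

lemma l2_map_prod_single:
  "l2_map fst (single k p) = single k (fst p)" "l2_map snd (single k p) = single k (snd p)"
  by (auto intro!: l2_eqI simp: coord_l2_map_fst coord_l2_map_snd coord_single)

lemma fst_scaleC [simp]: "fst (c *\<^sub>C p) = c *\<^sub>C fst p"
  and snd_scaleC [simp]: "snd (c *\<^sub>C p) = c *\<^sub>C snd p"
  by (simp_all add: scaleC_prod_def)

lemma cinner_Pair [simp]: "cinner (a, b) (c, d) = cinner a c + cinner b d"
  by (simp add: cinner_prod_def)

lemma isometric_emb_g: "isometric A UNIV emb_g"
  by (auto simp: isometric_def clinear_on_def emb_g_def scaleC_prod_def zero_prod_def norm_prod_def)

lemma isometric_emb_K: "isometric A UNIV emb_K"
  by (auto simp: isometric_def clinear_on_def emb_K_def scaleC_prod_def zero_prod_def norm_prod_def)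

lemma bclinear_on_in_ccspan:
  assumes "bclinear_on UNIV f" "f ` B \<subseteq> C" "x \<in> ccspan B"
  shows "f x \<in> ccspan C"
proof -
  have "f ` ccspan B \<subseteq> ccspan C"
  proof (rule bclinear_on_image_ccspan)
    show "bclinear_on (ccspan B) f" by (rule bclinear_on_subset[OF assms(1)]) simp
    show "f ` B \<subseteq> ccspan C" using assms(2) ccspan_superset by (rule order_trans)
  qed simp_all
  then show ?thesis using assms(3) by auto
qed

section \<open>The row of the extension, its adjoints and its minimality\<close>

locale gamma_extension =
  G: markov_process G + K: markov_process K
  for G :: "('d, 'g::complex_hilbert) process" and K :: "('d, 'k::complex_hilbert) process" +
  fixes \<gamma> :: "'k \<Rightarrow> 'g"
  assumes contraction_gamma: "contraction (\<E>_star K) (\<E> G) \<gamma>"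
begin

abbreviation X :: "('d, 'g \<times> 'k \<times> ('d list, 'g) l2) process" where "X \<equiv> \<gamma>_extension G K \<gamma>"
abbreviation ga :: "'g \<Rightarrow> 'k" where "ga \<equiv> \<gamma>_adj K \<gamma>"
abbreviation D :: "'g \<Rightarrow> 'g" where "D \<equiv> defect_op G K \<gamma>"
abbreviation DD :: "'g set" where "DD \<equiv> defect_space G K \<gamma>"
abbreviation Pg :: "'g \<Rightarrow> 'g" where "Pg \<equiv> proj (base G)"
abbreviation PE :: "'g \<Rightarrow> 'g" where "PE \<equiv> proj (\<E> G)"
abbreviation Ps :: "'k \<Rightarrow> 'k" where "Ps \<equiv> proj (\<E>_star K)"

lemma gamma_in: "y \<in> \<E>_star K \<Longrightarrow> \<gamma> y \<in> \<E> G"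
  using contraction_gamma by (rule contraction_in)

lemma norm_gamma: "y \<in> \<E>_star K \<Longrightarrow> norm (\<gamma> y) \<le> norm y"
  using contraction_gamma by (simp add: contraction_def)

lemma bclinear_on_gamma: "bclinear_on (\<E>_star K) \<gamma>"
  using contraction_gamma by (rule contraction_bclinear_on)

lemma ga_in: "ga e \<in> \<E>_star K"
  unfolding \<gamma>_adj_def by (rule adj_in[OF K.E_star_closed_csubspace bclinear_on_gamma])

lemma cinner_ga: "y \<in> \<E>_star K \<Longrightarrow> cinner y (ga e) = cinner (\<gamma> y) e"
  unfolding \<gamma>_adj_def by (rule cinner_adj[OF K.E_star_closed_csubspace bclinear_on_gamma])

lemma cinner_ga': "y \<in> \<E>_star K \<Longrightarrow> cinner (ga e) y = cinner e (\<gamma> y)"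
  unfolding \<gamma>_adj_def by (rule cinner_adj'[OF K.E_star_closed_csubspace bclinear_on_gamma])

lemma norm_ga: "norm (ga e) \<le> norm e"
  using norm_adj_le[OF K.E_star_closed_csubspace bclinear_on_gamma, of 1 e] norm_gamma
  by (simp add: \<gamma>_adj_def)

lemma bclinear_on_ga: "bclinear_on A ga"
  unfolding \<gamma>_adj_def by (rule bclinear_on_adj[OF K.E_star_closed_csubspace bclinear_on_gamma])

lemma ga_add: "ga (x + y) = ga x + ga y"
  by (rule clinear_on_add[OF bclinear_on_imp_clinear_on[OF bclinear_on_ga[of UNIV]]]) auto

lemma ga_scaleC: "ga (c *\<^sub>C x) = c *\<^sub>C ga x"
  by (rule clinear_on_scaleC[OF bclinear_on_imp_clinear_on[OF bclinear_on_ga[of UNIV]]]) auto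

lemma ga_zero [simp]: "ga 0 = 0"
  by (rule clinear_on_zero[OF bclinear_on_imp_clinear_on[OF bclinear_on_ga[of UNIV]]]) auto

lemma sqrt_iteration_gamma: "sqrt_iteration (\<E> G) (\<lambda>e. \<gamma> (ga e))"
proof
  have "bclinear_on (\<E> G) (\<lambda>e. \<gamma> (ga e))"
    by (rule bclinear_on_compose[OF bclinear_on_ga bclinear_on_gamma]) (auto simp: ga_in)
  moreover have "norm (\<gamma> (ga e)) \<le> norm e" for e
    using norm_gamma[OF ga_in, of e] norm_ga[of e] by linarith
  ultimately show "contraction (\<E> G) (\<E> G) (\<lambda>e. \<gamma> (ga e))"
    by (auto simp: contraction_def bclinear_on_def gamma_in ga_in)
  show "inner (\<gamma> (ga x)) y = inner x (\<gamma> (ga y))" for x y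
    using cinner_ga[OF ga_in, of x y] cinner_ga'[OF ga_in, of x y]
    by (simp add: inner_eq_Re_cinner)
qed (rule G.E_closed_csubspace)+

lemma D_positive: "positive_on (\<E> G) D"
  and D_sq: "e \<in> \<E> G \<Longrightarrow> D (D e) = e - \<gamma> (ga e)"
  using sqrt_iteration.op_sqrt_props[OF sqrt_iteration_gamma] by (simp_all add: defect_op_def)

lemma D_in: "e \<in> \<E> G \<Longrightarrow> D e \<in> \<E> G"
  and bclinear_on_D: "bclinear_on (\<E> G) D"
  using D_positive by (auto simp: positive_on_def bclinear_on_def)

lemmas clinear_on_D = bclinear_on_imp_clinear_on[OF bclinear_on_D]

lemma D_zero [simp]: "D 0 = 0"
  by (rule clinear_on_zero[OF clinear_on_D]) (simp add: G.csubspace_E csubspace_intros)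

text \<open>The squared norm of \<open>D e\<close> is the quadratic form of 1 - \<gamma> \<gamma>^*
  at \<open>e\<close>. The column of \<open>ga\<close> and \<open>D\<close> is thus isometric, and
  the isometry of the new row rests on it.\<close>

lemma norm_D: "e \<in> \<E> G \<Longrightarrow> (norm (ga e))\<^sup>2 + (norm (D e))\<^sup>2 = (norm e)\<^sup>2"
proof -
  assume e: "e \<in> \<E> G"
  have "inner (D e) (D e) = inner e (e - \<gamma> (ga e))"
    using positive_on_inner[OF D_positive G.csubspace_E e D_in[OF e]] D_sq[OF e] by simp
  moreover have "inner (ga e) (ga e) = inner e (\<gamma> (ga e))"
    using cinner_ga'[OF ga_in, of e e] by (simp add: inner_eq_Re_cinner)
  ultimately show ?thesis by (simp add: power2_norm_eq_inner inner_simps)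
qed

lemma D_in_DD: "e \<in> \<E> G \<Longrightarrow> D e \<in> DD"
  unfolding defect_space_def by (rule subsetD[OF closure_subset]) blast

lemma csubspace_DD: "csubspace DD"
  unfolding defect_space_def
  by (intro csubspace_closure csubspace_image[OF clinear_on_D] G.csubspace_E)

lemma closed_DD: "closed DD"
  by (simp add: defect_space_def)

lemma DD_subset: "DD \<subseteq> \<E> G"
  unfolding defect_space_def by (intro closure_minimal G.closed_E) (auto simp: D_in)

lemma Pg_in: "Pg x \<in> base G" and PE_in: "PE x \<in> \<E> G" and Ps_in: "Ps y \<in> \<E>_star K"
  by (simp_all add: proj_in G.base_closed_csubspace G.E_closed_csubspace K.E_star_closed_csubspace)

lemma Pg_lin: "Pg (x + y) = Pg x + Pg y" "Pg (c *\<^sub>C x) = c *\<^sub>C Pg x"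
  using clinear_on_proj[OF G.base_closed_csubspace, of UNIV] by (simp_all add: clinear_on_def)

lemma PE_lin: "PE (x + y) = PE x + PE y" "PE (c *\<^sub>C x) = c *\<^sub>C PE x"
  using clinear_on_proj[OF G.E_closed_csubspace, of UNIV] by (simp_all add: clinear_on_def)

lemma Pg_zero [simp]: "Pg 0 = 0" and PE_zero [simp]: "PE 0 = 0"
  by (simp_all add: proj_id G.csubspace_base G.csubspace_E csubspace_intros)

lemma Pg_PE: "u \<in> G.reach \<Longrightarrow> u = Pg u + PE u"
  by (simp add: G.proj_E_reach)

lemma norm_Pg_PE: "u \<in> G.reach \<Longrightarrow> (norm (Pg u))\<^sup>2 + (norm (PE u))\<^sup>2 = (norm u)\<^sup>2"
  using norm_add_sq_orth[OF G.cinner_base_E[OF PE_in Pg_in], of u u] Pg_PE[of u] by simp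

lemma PE_base: "x \<in> base G \<Longrightarrow> PE x = 0"
  by (rule proj_zero[OF G.csubspace_E]) (metis G.cinner_base_E cinner_eq_0_commute)

lemma Pg_E: "e \<in> \<E> G \<Longrightarrow> Pg e = 0"
  by (rule proj_zero[OF G.csubspace_base]) (rule G.cinner_base_E)

lemma hspace_X: "hspace X = base G \<times> (hspace K \<times> l2_of DD)"
  by (auto simp: \<gamma>_extension_def)

lemma base_X: "base X = base G \<times> (base K \<times> {0})"
  by (auto simp: \<gamma>_extension_def)

text \<open>Nested coordinate maps replace the triple pattern, so that the norm identities for pairs
  and for \<open>l2_Cons\<close> apply.\<close>

lemma row_X:
  "row X \<Xi> = (let w = row G (l2_map fst \<Xi>) in
    (Pg w, ga (PE w) + row K (l2_map fst (l2_map snd \<Xi>)), l2_Cons (D (PE w)) (l2_map snd (l2_map snd \<Xi>))))"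
proof -
  have 1: "l2_map fst (l2_map snd \<Xi>) = l2_map (\<lambda>(x, y, z). y) \<Xi>"
  proof (rule l2_eqI)
    fix k
    have "norm (case coord \<Xi> i of (x, y, z) \<Rightarrow> y) \<le> 1 * norm (coord \<Xi> i)" for i
      using order_trans[OF norm_fst_snd_le(1)[of "snd (coord \<Xi> i)"] norm_fst_snd_le(2)]
      by (simp add: case_prod_beta)
    then have "coord (l2_map (\<lambda>(x, y, z). y) \<Xi>) k = (case coord \<Xi> k of (x, y, z) \<Rightarrow> y)"
      by (rule coord_l2_map)
    then show "coord (l2_map fst (l2_map snd \<Xi>)) k = coord (l2_map (\<lambda>(x, y, z). y) \<Xi>) k"
      by (simp add: coord_l2_map_fst coord_l2_map_snd case_prod_beta)
  qed
  have 2: "coord (l2_map snd (l2_map snd \<Xi>)) k = snd (snd (coord \<Xi> k))" for k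
    by (simp add: coord_l2_map_snd)
  show ?thesis by (simp add: \<gamma>_extension_def Let_def l2_Cons_def 1 2)
qed

lemma l2_of_hspace_X:
  fixes \<Xi> :: "('i, 'g \<times> 'k \<times> ('d list, 'g) l2) l2"
  assumes "\<Xi> \<in> l2_of (hspace X)"
  shows "l2_map fst \<Xi> \<in> l2_of (base G)" "l2_map fst (l2_map snd \<Xi>) \<in> l2_of (hspace K)"
    "l2_map snd (l2_map snd \<Xi>) \<in> l2_of (l2_of DD)"
  using l2_ofD[OF assms] unfolding hspace_X l2_of_def[of "base G"] l2_of_def[of "hspace K"]
    l2_of_def[of "l2_of DD"]
  by (simp_all add: coord_l2_map_fst coord_l2_map_snd mem_Times_iff)

lemma row_G_reach: "\<Xi> \<in> l2_of (hspace X) \<Longrightarrow> row G (l2_map fst \<Xi>) \<in> G.reach"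
  by (rule G.row_reach) (rule l2_of_hspace_X)

lemma isometric_row_X: "isometric (l2_of (hspace X)) (hspace X) (row X)"
  unfolding isometric_def
proof (intro conjI ballI clinear_onI)
  fix \<Xi> \<Xi>' :: "('d, 'g \<times> 'k \<times> ('d list, 'g) l2) l2"
  assume X: "\<Xi> \<in> l2_of (hspace X)" "\<Xi>' \<in> l2_of (hspace X)"
  show "row X (\<Xi> + \<Xi>') = row X \<Xi> + row X \<Xi>'"
    using l2_of_hspace_X[OF X(1)] l2_of_hspace_X[OF X(2)]
    by (simp add: row_X Let_def l2_map_prod_lin clinear_on_add[OF G.clinear_on_row] G.l2_of_base
        clinear_on_add[OF K.clinear_on_row] Pg_lin PE_lin ga_add clinear_on_add[OF clinear_on_D]
        PE_in l2_Cons_add)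
next
  fix \<Xi> :: "('d, 'g \<times> 'k \<times> ('d list, 'g) l2) l2" and c assume X: "\<Xi> \<in> l2_of (hspace X)"
  show "row X (c *\<^sub>C \<Xi>) = c *\<^sub>C row X \<Xi>"
    using l2_of_hspace_X[OF X]
    by (simp add: row_X Let_def l2_map_prod_lin clinear_on_scaleC[OF G.clinear_on_row] G.l2_of_base
        clinear_on_scaleC[OF K.clinear_on_row] Pg_lin PE_lin ga_scaleC
        clinear_on_scaleC[OF clinear_on_D] PE_in l2_Cons_scaleC scaleC_prod_def scaleC_add_right)
next
  show "row X ` l2_of (hspace X) \<subseteq> hspace X"
  proof (intro image_subsetI)
    fix \<Xi> :: "('d, 'g \<times> 'k \<times> ('d list, 'g) l2) l2" assume X: "\<Xi> \<in> l2_of (hspace X)"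
    note Xs = l2_of_hspace_X[OF X]
    have "ga e + row K (l2_map fst (l2_map snd \<Xi>)) \<in> hspace K" for e
      by (intro complex_vector.subspace_add K.csubspace_hspace K.E_star_in ga_in K.row_in Xs)
    moreover have "l2_Cons (D (PE w)) (l2_map snd (l2_map snd \<Xi>)) \<in> l2_of DD" for w
      using l2_ofD[OF l2_ofD[OF Xs(3)]] D_in_DD[OF PE_in]
      by (auto intro!: l2_ofI simp: coord_l2_Cons split: list.split)
    ultimately show "row X \<Xi> \<in> hspace X" by (simp add: row_X Let_def hspace_X Pg_in)
  qed
next
  fix \<Xi> :: "('d, 'g \<times> 'k \<times> ('d list, 'g) l2) l2" assume X: "\<Xi> \<in> l2_of (hspace X)"
  note Xs = l2_of_hspace_X[OF X]
  define w \<eta> \<zeta> where "w = row G (l2_map fst \<Xi>)" and "\<eta> = l2_map fst (l2_map snd \<Xi>)"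
    and "\<zeta> = l2_map snd (l2_map snd \<Xi>)"
  have w: "w \<in> G.reach" unfolding w_def by (rule row_G_reach[OF X])
  have nw: "norm w = norm (l2_map fst \<Xi>)"
    unfolding w_def using G.isometric_row G.l2_of_base[OF Xs(1)] by (simp add: isometric_def)
  have n\<eta>: "norm (row K \<eta>) = norm \<eta>"
    unfolding \<eta>_def using K.isometric_row Xs(2) by (simp add: isometric_def)
  \<comment> \<open>Values of \<open>ga\<close> lie in \<open>\<E>_star K\<close>, orthogonal to the
    range of the row of \<open>K\<close>, so the squared norms of the two parts of the second
    component add.\<close>
  have "cinner (ga (PE w)) (row K \<eta>) = 0"
    using K.cinner_row_E_star[OF ga_in Xs(2)] by (simp add: cinner_eq_0_commute \<eta>_def)
  then have "(norm (ga (PE w) + row K \<eta>))\<^sup>2 = (norm (ga (PE w)))\<^sup>2 + (norm \<eta>)\<^sup>2"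
    by (simp add: norm_add_sq_orth n\<eta>)
  then have "(norm (row X \<Xi>))\<^sup>2 = (norm (Pg w))\<^sup>2 + ((norm (ga (PE w)))\<^sup>2 + (norm \<eta>)\<^sup>2
      + ((norm (D (PE w)))\<^sup>2 + (norm \<zeta>)\<^sup>2))"
    by (simp add: row_X Let_def norm_prod_def norm_l2_Cons flip: w_def \<eta>_def \<zeta>_def)
  \<comment> \<open>The column identity and the orthogonal splitting \<open>w = Pg w + PE w\<close>
    recombine all parts coming from \<open>G\<close> into the norm of \<open>w\<close>.\<close>
  also have "\<dots> = (norm w)\<^sup>2 + ((norm \<eta>)\<^sup>2 + (norm \<zeta>)\<^sup>2)"
    using norm_D[OF PE_in, of w] norm_Pg_PE[OF w] by linarith
  also have "\<dots> = (norm \<Xi>)\<^sup>2"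
    by (simp add: norm_l2_prod_sq[of \<Xi>] norm_l2_prod_sq[of "l2_map snd \<Xi>"] nw \<eta>_def \<zeta>_def)
  finally show "norm (row X \<Xi>) = norm \<Xi>" by simp
qed

sublocale X: row_isometry X
proof
  show "csubspace (hspace X)"
    unfolding hspace_X
    by (intro csubspace_Times csubspace_l2_of G.csubspace_base K.csubspace_hspace csubspace_DD)
  show "closed (hspace X)"
    unfolding hspace_X
    by (intro closed_Times closed_l2_of G.closed_base K.closed_hspace closed_DD)
qed (rule isometric_row_X)

text \<open>The value of the identification of \<open>\<G>\<close> on \<open>\<gg> \<oplus> \<E>\<^sup>\<gg>\<close>.\<close>

definition \<Phi> :: "'g \<Rightarrow> 'g \<times> 'k \<times> ('d list, 'g) l2"
  where "\<Phi> u = (Pg u, ga (PE u), single [] (D (PE u)))"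

lemma row_K_zero [simp]: "row K 0 = 0"
  using clinear_on_zero[OF K.clinear_on_row complex_vector.subspace_0[OF K.l2_of_hspace(1)]] .

lemma row_G_zero [simp]: "row G 0 = 0"
  using clinear_on_zero[OF G.clinear_on_row complex_vector.subspace_0[OF G.l2_of_hspace(1)]] .

lemma letter_K_zero [simp]: "letter K k 0 = 0" and letter_G_zero [simp]: "letter G k 0 = 0"
  by (simp_all add: letter_def)

lemma row_X_emb_g: "row X (l2_map emb_g \<xi>) = \<Phi> (row G \<xi>)"
proof -
  let ?i = "emb_g :: 'g \<Rightarrow> 'g \<times> 'k \<times> ('d list, 'g) l2"
  have *: "coord (l2_map ?i \<xi>) k = (coord \<xi> k, 0, 0)" for k
    using coord_l2_map_bclinear[OF isometric_bclinear_on[OF isometric_emb_g], of \<xi> UNIV k]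
    by (simp add: l2_of_def emb_g_def)
  have "l2_map fst (l2_map ?i \<xi>) = \<xi>" "l2_map fst (l2_map snd (l2_map ?i \<xi>)) = 0"
    "l2_map snd (l2_map snd (l2_map ?i \<xi>)) = 0"
    by (rule l2_eqI, simp add: coord_l2_map_fst coord_l2_map_snd *)+
  then show ?thesis by (simp add: row_X Let_def \<Phi>_def l2_Cons_zero)
qed

lemma row_X_emb_K: "row X (l2_map emb_K \<xi>) = emb_K (row K \<xi>)"
proof -
  let ?i = "emb_K :: 'k \<Rightarrow> 'g \<times> 'k \<times> ('d list, 'g) l2"
  have *: "coord (l2_map ?i \<xi>) k = (0, coord \<xi> k, 0)" for k
    using coord_l2_map_bclinear[OF isometric_bclinear_on[OF isometric_emb_K], of \<xi> UNIV k]
    by (simp add: l2_of_def emb_K_def)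
  have "l2_map fst (l2_map ?i \<xi>) = 0" "l2_map fst (l2_map snd (l2_map ?i \<xi>)) = \<xi>"
    "l2_map snd (l2_map snd (l2_map ?i \<xi>)) = 0"
    by (rule l2_eqI, simp add: coord_l2_map_fst coord_l2_map_snd *)+
  then show ?thesis by (simp add: row_X Let_def emb_K_def l2_Cons_zero)
qed

lemma letter_X:
  "letter X k (x, y, z) = (let w = letter G k x in
    (Pg w, ga (PE w) + letter K k y, l2_Cons (D (PE w)) (single k z)))"
  by (simp add: letter_def row_X l2_map_prod_single)

lemma letter_emb_K: "letter X k (emb_K y) = emb_K (letter K k y)"
  by (simp add: letter_X emb_K_def Let_def l2_Cons_zero)

lemma word_emb_K: "word X \<alpha> (emb_K y) = emb_K (word K \<alpha> y)"
  by (induction \<alpha>) (simp_all add: letter_emb_K)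

text \<open>The third component of a letter is paired with 0. In the second one, \<open>y\<close>
  may be replaced by \<open>Ps y\<close> because \<open>ga\<close> has values in
  \<open>\<E>_star K\<close>, and then \<gamma>^* moves across as \<gamma>; this is where the extra
  vector in \<open>G\<close> comes from.\<close>

lemma Vadj_X:
  assumes x: "x \<in> base G" and y: "y \<in> hspace K"
  shows "X.Vadj k (x, y, 0) = (G.Vadj k (x + \<gamma> (Ps y)), K.Vadj k y, 0)"
proof (rule X.Vadj_eqI)
  have "\<gamma> (Ps y) \<in> G.reach" by (rule G.E_reach[OF gamma_in[OF Ps_in]])
  then have "x + \<gamma> (Ps y) \<in> G.reach"
    using x G.base_reach by (intro complex_vector.subspace_add G.csubspace_reach) auto
  then show "(G.Vadj k (x + \<gamma> (Ps y)), K.Vadj k y, 0) \<in> hspace X"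
    by (simp add: hspace_X G.reach_def K.Vadj_in csubspace_DD csubspace_l2_of csubspace_intros)
  fix h assume "h \<in> hspace X"
  then obtain x' y' z' where h: "h = (x', y', z')" "x' \<in> base G" "y' \<in> hspace K"
    by (auto simp: hspace_X)
  let ?w = "letter G k x'"
  have "cinner (ga (PE ?w)) y = cinner (ga (PE ?w)) (Ps y)"
    by (rule cinner_proj[OF K.E_star_closed_csubspace ga_in, symmetric])
  also have "\<dots> = cinner ?w (\<gamma> (Ps y))"
    by (simp add: cinner_ga'[OF Ps_in] cinner_proj'[OF G.E_closed_csubspace gamma_in[OF Ps_in]])
  finally have 1: "cinner (ga (PE ?w)) y = cinner ?w (\<gamma> (Ps y))" .
  have 2: "cinner (Pg ?w) x = cinner ?w x"
    by (rule cinner_proj'[OF G.base_closed_csubspace x])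
  show "cinner h (G.Vadj k (x + \<gamma> (Ps y)), K.Vadj k y, 0) = cinner (letter X k h) (x, y, 0)"
    by (simp add: h letter_X Let_def G.cinner_Vadj[OF G.base_in] K.cinner_Vadj cinner_add_right
        cinner_add_left 1 2)
qed

lemma gamma_Ps_zero [simp]: "Ps 0 = 0" "\<gamma> 0 = 0"
  by (simp_all add: proj_id K.csubspace_E_star csubspace_intros
      clinear_on_zero[OF bclinear_on_imp_clinear_on[OF bclinear_on_gamma]])

lemma Vadj_emb_g: "x \<in> base G \<Longrightarrow> X.Vadj k (emb_g x) = emb_g (G.Vadj k x)"
  by (simp add: emb_g_def Vadj_X K.csubspace_hspace csubspace_intros)

lemma Vadj_emb_K: "y \<in> hspace K \<Longrightarrow> X.Vadj k (emb_K y) = (G.Vadj k (\<gamma> (Ps y)), K.Vadj k y, 0)"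
  by (simp add: emb_K_def Vadj_X G.csubspace_base csubspace_intros)

lemma bclinear_on_Phi: "bclinear_on A \<Phi>"
\<comment> \<open>Each of the two projections is a contraction, so the squared norm at most doubles;
  the bound 2 is valid off \<open>reach\<close> as well.\<close>
proof (rule bclinear_onI[where c = 2])
  show "clinear_on A \<Phi>"
    by (rule clinear_onI)
      (simp_all add: \<Phi>_def Pg_lin PE_lin ga_add ga_scaleC clinear_on_add[OF clinear_on_D]
        clinear_on_scaleC[OF clinear_on_D] PE_in single_add single_scaleC scaleC_prod_def)
  fix u
  have "(norm (\<Phi> u))\<^sup>2 = (norm (Pg u))\<^sup>2 + ((norm (ga (PE u)))\<^sup>2 + (norm (D (PE u)))\<^sup>2)"
    by (simp add: \<Phi>_def norm_prod_def)
  also have "\<dots> = (norm (Pg u))\<^sup>2 + (norm (PE u))\<^sup>2" by (simp add: norm_D PE_in)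
  also have "\<dots> \<le> (norm u)\<^sup>2 + (norm u)\<^sup>2"
    by (intro add_mono power_mono norm_proj_le G.base_closed_csubspace G.E_closed_csubspace) auto
  also have "\<dots> \<le> (2 * norm u)\<^sup>2" by (simp add: power_mult_distrib)
  finally show "norm (\<Phi> u) \<le> 2 * norm u" by (rule power2_le_imp_le) simp
qed

lemma Phi_base: "x \<in> base G \<Longrightarrow> \<Phi> x = emb_g x"
  by (simp add: \<Phi>_def emb_g_def PE_base proj_id G.csubspace_base)

lemma Phi_E: "e \<in> \<E> G \<Longrightarrow> \<Phi> e = (0, ga e, single [] (D e))"
  by (simp add: \<Phi>_def Pg_E proj_id G.csubspace_E)

definition emb_D :: "('d list, 'g) l2 \<Rightarrow> 'g \<times> 'k \<times> ('d list, 'g) l2"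
  where "emb_D z = (0, 0, z)"

lemma isometric_emb_D: "isometric A UNIV emb_D"
  by (auto simp: isometric_def clinear_on_def emb_D_def scaleC_prod_def zero_prod_def norm_prod_def)

lemma letter_emb_D: "letter X k (emb_D (single \<beta> d)) = emb_D (single (k # \<beta>) d)"
  by (simp add: letter_X emb_D_def Let_def l2_Cons_single)

lemma base_X_subset: "base X \<subseteq> hspace X"
  unfolding base_X hspace_X
  using K.base_subset by (auto simp: csubspace_l2_of csubspace_DD csubspace_intros)

lemma emb_g_base: "x \<in> base G \<Longrightarrow> emb_g x \<in> base X"
  and emb_K_base: "y \<in> base K \<Longrightarrow> emb_K y \<in> base X"
  by (simp_all add: base_X emb_g_def emb_K_def G.csubspace_base K.csubspace_base csubspace_intros)

text \<open>All of \<open>K\<close> is reached by words on \<open>emb_K\<close>, and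
  \<open>\<Phi>\<close> maps \<open>reach\<close> into the span because it does so with rows of base
  vectors. Subtracting the \<open>K\<close>-part \<open>ga e\<close> from \<open>\<Phi> e\<close>
  isolates \<open>D e\<close> at the empty word; closure yields the whole defect space there, and
  letters move it to the other words.\<close>

lemma hspace_X_subset_generated: "hspace X \<subseteq> generated X (base X)"
proof -
  define M where "M = generated X (base X)"
  have M: "csubspace M" "closed M"
    by (simp_all add: M_def X.csubspace_generated X.closed_generated)
  have letter: "letter X k h \<in> M" if "h \<in> M" for k h
    using X.letter_generated[OF base_X_subset] that by (simp add: M_def)
  have word: "word X \<alpha> h \<in> M" if "h \<in> M" for \<alpha> h
    using that by (induction \<alpha>) (simp_all add: letter)
  have base: "base X \<subseteq> M" unfolding M_def by (rule X.generated_superset)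
  have K: "emb_K y \<in> M" if "y \<in> hspace K" for y
  proof -
    have "hspace K \<subseteq> {y \<in> UNIV. emb_K y \<in> M}"
    proof (rule K.hspace_induct)
      show "csubspace {y \<in> UNIV. emb_K y \<in> M}"
        by (rule csubspace_vimage[OF isometric_clinear_on[OF isometric_emb_K] _ M(1)]) simp
      show "closed {y \<in> UNIV. emb_K y \<in> M}"
        by (rule closed_vimage_bclinear[OF isometric_bclinear_on[OF isometric_emb_K] _ _ M(2)]) simp_all
      show "word K \<alpha> x \<in> {y \<in> UNIV. emb_K y \<in> M}" if "x \<in> base K" for x \<alpha>
        using word[of "emb_K x" \<alpha>] base emb_K_base[OF that] by (auto simp: word_emb_K)
    qed
    then show ?thesis using that by auto
  qed
  have g: "\<Phi> u \<in> M" if "u \<in> G.reach" for u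
  proof -
    have "G.reach \<subseteq> {u \<in> UNIV. \<Phi> u \<in> M}"
      unfolding G.ccspan_base_row[symmetric]
    proof (rule ccspan_minimal)
      show "csubspace {u \<in> UNIV. \<Phi> u \<in> M}"
        by (rule csubspace_vimage[OF bclinear_on_imp_clinear_on[OF bclinear_on_Phi] _ M(1)]) simp
      show "closed {u \<in> UNIV. \<Phi> u \<in> M}"
        by (rule closed_vimage_bclinear[OF bclinear_on_Phi _ _ M(2)]) simp_all
      have "\<Phi> (row G \<xi>) \<in> M" if "\<xi> \<in> l2_of (base G)" for \<xi>
      proof -
        have "l2_map emb_g \<xi> \<in> l2_of M"
          using base by (intro l2_map_in[OF isometric_bclinear_on[OF isometric_emb_g] _ that])
            (auto simp: emb_g_base)
        then show ?thesis
          using X.row_generated[OF base_X_subset] by (auto simp: M_def simp flip: row_X_emb_g)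
      qed
      moreover have "\<Phi> x \<in> M" if "x \<in> base G" for x
        using base emb_g_base[OF that] by (auto simp: Phi_base that)
      ultimately show "base G \<union> row G ` l2_of (base G) \<subseteq> {u \<in> UNIV. \<Phi> u \<in> M}" by auto
    qed
    then show ?thesis using that by auto
  qed
  have E: "emb_D (single [] (D e)) \<in> M" if "e \<in> \<E> G" for e
  proof -
    have "\<Phi> e - emb_K (ga e) \<in> M"
      by (intro complex_vector.subspace_diff M g K G.E_reach that K.E_star_in ga_in)
    then show ?thesis by (simp add: Phi_E[OF that] emb_K_def emb_D_def)
  qed
  have bl: "bclinear_on UNIV (\<lambda>d. emb_D (single [] d))"
    by (rule bclinear_on_compose[OF isometric_bclinear_on[OF isometric_single]
          isometric_bclinear_on[OF isometric_emb_D]]) auto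
  have "DD \<subseteq> {d \<in> UNIV. emb_D (single [] d) \<in> M}"
    unfolding defect_space_def
  proof (rule closure_minimal)
    show "closed {d \<in> UNIV. emb_D (single [] d) \<in> M}"
      by (rule closed_vimage_bclinear[OF bl _ _ M(2)]) simp_all
  qed (auto simp: E)
  then have "emb_D (single \<alpha> d) \<in> M" if "d \<in> DD" for \<alpha> d
    using that by (induction \<alpha>) (auto simp: letter simp flip: letter_emb_D)
  then have "l2_of DD \<subseteq> {z \<in> UNIV. emb_D z \<in> M}"
    unfolding l2_of_eq_ccspan[OF csubspace_DD closed_DD]
    by (intro ccspan_minimal csubspace_vimage[OF isometric_clinear_on[OF isometric_emb_D] _ M(1)]
        closed_vimage_bclinear[OF isometric_bclinear_on[OF isometric_emb_D] _ _ M(2)]) auto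
  then have D: "emb_D z \<in> M" if "z \<in> l2_of DD" for z using that by auto
  show ?thesis
  proof
    fix h assume "h \<in> hspace X"
    then obtain x y z where h: "h = (x, y, z)" "x \<in> base G" "y \<in> hspace K" "z \<in> l2_of DD"
      by (auto simp: hspace_X)
    have "emb_g x + (emb_K y + emb_D z) \<in> M"
      using base emb_g_base[OF h(2)] by (intro complex_vector.subspace_add M K D h) auto
    then show "h \<in> generated X (base X)" by (simp add: M_def h emb_g_def emb_K_def emb_D_def)
  qed
qed

sublocale X: markov_process X
proof
  show "csubspace (base X)"
    unfolding base_X
    by (intro csubspace_Times G.csubspace_base K.csubspace_base) simp
  show "closed (base X)"
    unfolding base_X by (intro closed_Times G.closed_base K.closed_base) simp
  show "base X \<subseteq> hspace X" by (rule base_X_subset)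
  show "hspace X = generated X (base X)"
    using X.generated_subset[OF base_X_subset] hspace_X_subset_generated by blast
  show "coinvariant X (base X)"
    unfolding coinvariant_def
  proof (intro allI image_subsetI)
    fix k h assume "h \<in> base X"
    then obtain x y where h: "h = (x, y, 0)" "x \<in> base G" "y \<in> base K"
      by (auto simp: base_X)
    \<comment> \<open>The term with \<gamma> is in \<open>\<E> G\<close> and so in
      \<open>reach\<close>, whose vectors the adjoints of \<open>G\<close> send into the base;
      coinvariance depends on this.\<close>
    have "G.Vadj k (x + \<gamma> (Ps y)) \<in> base G"
      using G.E_reach[OF gamma_in[OF Ps_in, of y]] h(2)
      by (simp add: G.Vadj_add G.reach_def G.Vadj_base G.csubspace_base csubspace_intros)
    then show "X.Vadj k h \<in> base X"
      using h by (simp add: Vadj_X K.base_in base_X K.Vadj_base)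
  qed
qed

lemma separable_X:
  assumes "countable (UNIV :: 'd set)" "separable_space (top_of_set (hspace G))"
    "separable_space (top_of_set (hspace K))"
  shows "separable_space (top_of_set (hspace X))"
proof -
  obtain A B where A: "countable A" "hspace G \<subseteq> ccspan A" and B: "countable B" "hspace K \<subseteq> ccspan B"
    using assms(2,3) unfolding separable_iff_ccspan by blast
  \<comment> \<open>The closed span of \<open>A\<close> contains the defect space, which lies inside
    the space of \<open>G\<close>; copies of \<open>A\<close> over the countably many words
    therefore take care of the third component.\<close>
  define C where "C = emb_g ` A \<union> emb_K ` B \<union> (\<Union>\<alpha>. (\<lambda>d. emb_D (single \<alpha> d)) ` A)"
  have D: "emb_D z \<in> ccspan C" if "z \<in> l2_of DD" for z
  proof -
    have "emb_D (single \<alpha> d) \<in> ccspan C" if "d \<in> DD" for \<alpha> d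
    proof (rule bclinear_on_in_ccspan[of "\<lambda>d. emb_D (single \<alpha> d)" A])
      show "bclinear_on UNIV (\<lambda>d. emb_D (single \<alpha> d))"
        by (rule bclinear_on_compose[OF isometric_bclinear_on[OF isometric_single]
              isometric_bclinear_on[OF isometric_emb_D]]) auto
      show "(\<lambda>d. emb_D (single \<alpha> d)) ` A \<subseteq> C" by (auto simp: C_def)
      show "d \<in> ccspan A" using that DD_subset G.E_in A(2) by blast
    qed
    then have "l2_of DD \<subseteq> {z \<in> UNIV. emb_D z \<in> ccspan C}"
      unfolding l2_of_eq_ccspan[OF csubspace_DD closed_DD]
      by (intro ccspan_minimal csubspace_vimage[OF isometric_clinear_on[OF isometric_emb_D]]
          closed_vimage_bclinear[OF isometric_bclinear_on[OF isometric_emb_D]]) auto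
    then show ?thesis using that by auto
  qed
  have "hspace X \<subseteq> ccspan C"
  proof
    fix h assume "h \<in> hspace X"
    then obtain x y z where h: "h = (x, y, z)" "x \<in> base G" "y \<in> hspace K" "z \<in> l2_of DD"
      by (auto simp: hspace_X)
    have "emb_g x \<in> ccspan C"
      using h(2) G.base_in A(2)
      by (intro bclinear_on_in_ccspan[OF isometric_bclinear_on[OF isometric_emb_g], of A]) (auto simp: C_def)
    moreover have "emb_K y \<in> ccspan C"
      using h(3) B(2)
      by (intro bclinear_on_in_ccspan[OF isometric_bclinear_on[OF isometric_emb_K], of B]) (auto simp: C_def)
    ultimately have "emb_g x + (emb_K y + emb_D z) \<in> ccspan C"
      by (intro complex_vector.subspace_add csubspace_ccspan D h)
    then show "h \<in> ccspan C" by (simp add: h emb_g_def emb_K_def emb_D_def)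
  qed
  moreover have "countable C"
  proof -
    have "countable (lists (UNIV :: 'd set))" by (rule countable_lists) (rule assms)
    then show ?thesis
      unfolding C_def using A(1) B(1) by (intro countable_Un countable_UN countable_image) simp_all
  qed
  ultimately show ?thesis unfolding separable_iff_ccspan by blast
qed

section \<open>The copy of \<open>G\<close> inside the extension\<close>

lemma cinner_word_X:
  "x \<in> base G \<Longrightarrow> y \<in> base G \<Longrightarrow>
    cinner (word X \<alpha> (emb_g x)) (emb_g y) = cinner (word G \<alpha> x) y"
proof (induction \<alpha> arbitrary: y)
  case Nil
  then show ?case by (simp add: emb_g_def)
next
  case (Cons k \<alpha>)
  \<comment> \<open>The first letter moves to the right as its adjoint, which on embedded base
    vectors of \<open>G\<close> is the adjoint of \<open>G\<close> itself.\<close>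
  have "cinner (word X (k # \<alpha>) (emb_g x)) (emb_g y) = cinner (word X \<alpha> (emb_g x)) (emb_g (G.Vadj k y))"
    using X.cinner_Vadj[OF X.word_in[OF X.base_in[OF emb_g_base[OF Cons.prems(1)]], of \<alpha>], of k "emb_g y"]
      Cons.prems by (simp add: Vadj_emb_g)
  also have "\<dots> = cinner (word G \<alpha> x) (G.Vadj k y)"
    using Cons by (simp add: G.Vadj_base)
  also have "\<dots> = cinner (word G (k # \<alpha>) x) y"
    using Cons.prems by (simp add: G.cinner_Vadj G.word_in G.base_in)
  finally show ?case .
qed

text \<open>Equality with \<open>\<Phi>\<close> follows by density: both maps agree on the base and,
  through the row identity, on rows of base vectors, and these span \<open>reach\<close>.\<close>

lemma subprocess_identification:
  obtains U where "unitary (hspace G) (generated X (emb_g ` base G)) U"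
    and "\<And>u. u \<in> G.reach \<Longrightarrow> U u = \<Phi> u"
    and "\<And>x \<alpha>. x \<in> hspace G \<Longrightarrow> U (word G \<alpha> x) = word X \<alpha> (U x)"
    and "\<And>\<xi>. \<xi> \<in> l2_of (hspace G) \<Longrightarrow> U (row G \<xi>) = row X (l2_map U \<xi>)"
proof -
  obtain U where U: "unitary (hspace G) (generated X (emb_g ` base G)) U"
    and w: "\<And>x \<alpha>. x \<in> base G \<Longrightarrow> U (word G \<alpha> x) = word X \<alpha> (emb_g x)"
    and l: "\<And>k h. h \<in> hspace G \<Longrightarrow> U (letter G k h) = letter X k (U h)"
    and r: "\<And>\<xi>. \<xi> \<in> l2_of (hspace G) \<Longrightarrow> U (row G \<xi>) = row X (l2_map U \<xi>)"
  proof (rule intertwiner[OF G.row_isometry_axioms X.row_isometry_axioms G.base_subset])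
    show "emb_g ` base G \<subseteq> hspace X" using emb_g_base X.base_in by blast
  qed (simp_all add: cinner_word_X flip: G.hspace_eq)
  have b: "U x = emb_g x" if "x \<in> base G" for x using w[OF that, of "[]"] by simp
  have Ub: "bclinear_on (hspace G) U" using U by (auto simp: unitary_def intro: isometric_bclinear_on)
  show thesis
  proof
    show "U u = \<Phi> u" if "u \<in> G.reach" for u
    proof (rule bclinear_on_eq_ccspan[OF Ub bclinear_on_Phi G.hspace_closed_csubspace])
      show "u \<in> ccspan (base G \<union> row G ` l2_of (base G))" using that by (simp add: G.ccspan_base_row)
      show "base G \<union> row G ` l2_of (base G) \<subseteq> hspace G"
        using G.base_in G.row_in[OF G.l2_of_base] by blast
      fix v assume "v \<in> base G \<union> row G ` l2_of (base G)"
      then consider "v \<in> base G" | \<xi> where "\<xi> \<in> l2_of (base G)" "v = row G \<xi>" by blast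
      then show "U v = \<Phi> v"
      proof cases
        case (2 \<xi>)
        have "l2_map U \<xi> = l2_map emb_g \<xi>"
          using 2(1) b l2_ofD[OF 2(1)]
          by (intro l2_eqI)
            (simp add: coord_l2_map_bclinear[OF Ub G.l2_of_base]
              coord_l2_map_bclinear[OF isometric_bclinear_on[OF isometric_emb_g[of "base G"]]])
        then show ?thesis using r[OF G.l2_of_base[OF 2(1)]] by (simp add: 2 row_X_emb_g)
      qed (simp add: b Phi_base)
    qed
    show "U (word G \<alpha> x) = word X \<alpha> (U x)" if "x \<in> hspace G" for x \<alpha>
      using that by (induction \<alpha>) (simp_all add: l G.word_in)
  qed (rule U, rule r)
qed

text \<open>In other words, U^* \<open>emb_K\<close> is \<gamma> on \<open>\<E>_star K\<close>, from
  which both compression formulas for \<gamma> follow. For a nonempty word, moving the first letter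
  across leaves only the \<open>G\<close>-part of the adjoint formula, since \<open>y\<close> is
  killed by the adjoints of \<open>K\<close>.\<close>

lemma cinner_U_emb_K:
  assumes U: "unitary (hspace G) (generated X (emb_g ` base G)) U"
    and reach: "\<And>u. u \<in> G.reach \<Longrightarrow> U u = \<Phi> u"
    and word: "\<And>x \<alpha>. x \<in> hspace G \<Longrightarrow> U (word G \<alpha> x) = word X \<alpha> (U x)"
    and y: "y \<in> \<E>_star K" and h: "h \<in> hspace G"
  shows "cinner (U h) (emb_K y) = cinner h (\<gamma> y)"
proof -
  have Ub: "bclinear_on (hspace G) U" using U by (auto simp: unitary_def intro: isometric_bclinear_on)
  \<comment> \<open>The difference whose vanishing is claimed; it is tested on the generators of the
    space of \<open>G\<close>.\<close>
  define v where "v = adj (hspace G) U (emb_K y) - \<gamma> y"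
  have b: "U x = emb_g x" if "x \<in> base G" for x
    using reach[of x] G.base_reach that by (auto simp: Phi_base)
  have Psy: "Ps y = y" using y by (simp add: proj_id K.csubspace_E_star)
  have v: "cinner h v = cinner (U h) (emb_K y) - cinner h (\<gamma> y)" if "h \<in> hspace G" for h
    using that by (simp add: v_def cinner.diff_right cinner_adj[OF G.hspace_closed_csubspace Ub])
  have "hspace G \<subseteq> {h. \<forall>z\<in>{v}. cinner z h = 0}"
  proof (rule G.hspace_induct[OF csubspace_orth closed_orth])
    fix x \<alpha> assume x: "x \<in> base G"
    have "cinner (word X \<alpha> (emb_g x)) (emb_K y) = cinner (word G \<alpha> x) (\<gamma> y)"
    proof (cases \<alpha>)
      case Nil
      then show ?thesis using G.cinner_base_E[OF gamma_in[OF y] x] by (simp add: emb_g_def emb_K_def)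
    next
      case (Cons k \<beta>)
      have g: "G.Vadj k (\<gamma> y) \<in> base G" using G.E_reach[OF gamma_in[OF y]] by (simp add: G.reach_def)
      have "cinner (word X \<alpha> (emb_g x)) (emb_K y) = cinner (word X \<beta> (emb_g x)) (X.Vadj k (emb_K y))"
        using X.word_in[OF X.base_in[OF emb_g_base[OF x]]] by (simp add: Cons X.cinner_Vadj)
      also have "X.Vadj k (emb_K y) = emb_g (G.Vadj k (\<gamma> y))"
        using K.E_star_in[OF y] K.Vadj_E_star[OF y] by (simp add: Vadj_emb_K Psy emb_g_def)
      also have "cinner (word X \<beta> (emb_g x)) \<dots> = cinner (word G \<beta> x) (G.Vadj k (\<gamma> y))"
        by (rule cinner_word_X[OF x g])
      also have "\<dots> = cinner (word G \<alpha> x) (\<gamma> y)"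
        using x by (simp add: Cons G.cinner_Vadj G.word_in G.base_in)
      finally show ?thesis .
    qed
    then have "cinner (word G \<alpha> x) v = 0"
      using x by (simp add: v word b G.word_in G.base_in)
    then show "word G \<alpha> x \<in> {h. \<forall>z\<in>{v}. cinner z h = 0}" by (simp add: cinner_eq_0_commute)
  qed
  then have "cinner h v = 0" using h by (auto simp: cinner_eq_0_commute)
  then show ?thesis using v[OF h] by simp
qed

end

section \<open>Subprocess, quotient process and exact sequence\<close>

lemma isometric_cong:
  "isometric A B f \<Longrightarrow> csubspace A \<Longrightarrow> (\<And>x. x \<in> A \<Longrightarrow> g x = f x) \<Longrightarrow> isometric A B g"
  unfolding isometric_def clinear_on_def by (auto simp: csubspace_intros)

lemma isometric_into: "isometric A UNIV f \<Longrightarrow> f ` A \<subseteq> B \<Longrightarrow> isometric A B f"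
  by (simp add: isometric_def)

context gamma_extension
begin

lemma ominus_base: "base X \<ominus> emb_g ` base G = emb_K ` base K"
proof
  show "base X \<ominus> emb_g ` base G \<subseteq> emb_K ` base K"
  proof
    fix p assume p: "p \<in> base X \<ominus> emb_g ` base G"
    then obtain x y where xy: "p = (x, y, 0)" "x \<in> base G" "y \<in> base K"
      by (auto simp: ominus_def base_X)
    have "cinner (emb_g x) p = 0" using p xy(2) by (simp add: ominus_def)
    then have "x = 0" by (simp add: xy emb_g_def)
    then show "p \<in> emb_K ` base K" using xy by (simp add: emb_K_def)
  qed
  show "emb_K ` base K \<subseteq> base X \<ominus> emb_g ` base G"
    by (auto simp: ominus_def emb_K_base) (simp add: emb_g_def emb_K_def)
qed

lemma generated_emb_K: "generated X (emb_K ` base K) = emb_K ` hspace K"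
proof
  have iso: "isometric A UNIV (emb_K :: 'k \<Rightarrow> 'g \<times> 'k \<times> ('d list, 'g) l2)" for A
    by (rule isometric_emb_K)
  show "generated X (emb_K ` base K) \<subseteq> emb_K ` hspace K"
  proof (rule X.generated_minimal)
    show "csubspace (emb_K ` hspace K :: ('g \<times> 'k \<times> ('d list, 'g) l2) set)"
      by (rule csubspace_image[OF isometric_clinear_on[OF iso] K.csubspace_hspace])
    show "closed (emb_K ` hspace K :: ('g \<times> 'k \<times> ('d list, 'g) l2) set)"
      by (rule closed_isometric_image[OF iso K.hspace_closed_csubspace])
  qed (use K.base_in K.letter_in in \<open>auto simp: letter_emb_K\<close>)
  have "hspace K \<subseteq> {y \<in> UNIV. emb_K y \<in> generated X (emb_K ` base K)}"
  proof (rule K.hspace_induct)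
    show "csubspace {y \<in> UNIV. emb_K y \<in> generated X (emb_K ` base K)}"
      by (rule csubspace_vimage[OF isometric_clinear_on[OF iso] _ X.csubspace_generated]) simp
    show "closed {y \<in> UNIV. emb_K y \<in> generated X (emb_K ` base K)}"
      by (rule closed_vimage_bclinear[OF isometric_bclinear_on[OF iso] _ _ X.closed_generated])
        simp_all
    show "word K \<alpha> x \<in> {y \<in> UNIV. emb_K y \<in> generated X (emb_K ` base K)}"
      if "x \<in> base K" for x \<alpha>
      using X.word_in_generated[of "emb_K x" "emb_K ` base K" \<alpha>] that by (simp add: word_emb_K)
  qed
  then show "emb_K ` hspace K \<subseteq> generated X (emb_K ` base K)" by auto
qed

lemma identifies_quotient: "identifies K (quotient_process X (emb_g ` base G)) emb_K"
  unfolding identifies_def quotient_process_def unitary_def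
  by (auto simp: ominus_base generated_emb_K row_X_emb_K intro!: isometric_into[OF isometric_emb_K])

lemma subprocess_base_emb_g: "subprocess_base X (emb_g ` base G)"
proof -
  have iso: "isometric A UNIV (emb_g :: 'g \<Rightarrow> 'g \<times> 'k \<times> ('d list, 'g) l2)" for A
    by (rule isometric_emb_g)
  show ?thesis
    unfolding subprocess_base_def coinvariant_def
    using csubspace_image[OF isometric_clinear_on[OF iso] G.csubspace_base]
      closed_isometric_image[OF iso G.base_closed_csubspace]
    by (auto simp: emb_g_base Vadj_emb_g G.Vadj_base)
qed

text \<open>Supplies the coisometry of \<open>proj_k\<close>, which is defined through the
  adjoint.\<close>

lemma adj_proj_k: "y \<in> base K \<Longrightarrow> adj (base X) proj_k y = emb_K y"
  by (rule adj_eqI[OF X.csubspace_base emb_K_base]) (auto simp: base_X proj_k_def emb_K_def)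

lemma isometric_emb_g_base: "isometric (base G) (base X) emb_g"
  by (rule isometric_into[OF isometric_emb_g]) (auto simp: emb_g_base)

lemma morphism_emb_g: "morphism G X emb_g"
  unfolding morphism_def
  using isometric_contraction[OF isometric_emb_g_base] by (simp add: Vadj_emb_g)

lemma contraction_proj_k: "contraction (base X) (base K) proj_k"
  unfolding contraction_def
proof (intro conjI ballI clinear_onI)
  show "norm (proj_k p) \<le> norm p" if "p \<in> base X" for p
    using that norm_fst_le norm_snd_le by (auto simp: base_X proj_k_def norm_prod_def zero_prod_def
        intro: real_le_rsqrt)
qed (auto simp: base_X proj_k_def scaleC_prod_def)

lemma morphism_proj_k: "morphism X K proj_k"
  unfolding morphism_def
  using contraction_proj_k by (auto simp: base_X Vadj_X K.base_in) (auto simp: proj_k_def)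

lemma short_exact_X:
  assumes "is_process G" "is_process X" "is_process K"
  shows "short_exact G emb_g X proj_k K"
proof -
  have "isometric (base K) (base X) (adj (base X) proj_k)"
    by (rule isometric_cong[OF isometric_into[OF isometric_emb_K] K.csubspace_base adj_proj_k])
      (auto simp: emb_K_base)
  moreover have "emb_g ` base G = {x \<in> base X. proj_k x = 0}"
    by (auto simp: base_X emb_g_def proj_k_def K.csubspace_base csubspace_intros image_iff)
  ultimately show ?thesis
    unfolding short_exact_def coisometric_def
    using assms isometric_emb_g_base morphism_emb_g morphism_proj_k contraction_proj_k by simp
qed

lemma gamma_identification_ex:
  "\<exists>U. \<gamma>_identification G K \<gamma> U \<and>
    (\<forall>x\<in>\<E>_star K. U (\<gamma> x) = proj (U ` \<E> G) (emb_K x) \<and> U (\<gamma> x) = proj (U ` hspace G) (emb_K x)) \<and>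
    (\<forall>e\<in>\<E> G. emb_K (ga e) = proj (emb_K ` \<E>_star K) (U e) \<and>
      emb_K (ga e) = proj (emb_K ` hspace K) (U e)) \<and>
    identifies G (subprocess X (emb_g ` base G)) U"
proof (rule subprocess_identification)
  fix U
  assume U: "unitary (hspace G) (generated X (emb_g ` base G)) U"
    and reach: "\<And>u. u \<in> G.reach \<Longrightarrow> U u = \<Phi> u"
    and word: "\<And>x \<alpha>. x \<in> hspace G \<Longrightarrow> U (word G \<alpha> x) = word X \<alpha> (U x)"
    and row: "\<And>\<xi>. \<xi> \<in> l2_of (hspace G) \<Longrightarrow> U (row G \<xi>) = row X (l2_map U \<xi>)"
  have iso: "isometric (hspace G) (generated X (emb_g ` base G)) U"
    using U by (simp add: unitary_def)
  have Ub: "U x = emb_g x" if "x \<in> base G" for x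
    using reach[of x] G.base_reach that by (auto simp: Phi_base)
  have UE: "U e = (0, ga e, single [] (D e))" if "e \<in> \<E> G" for e
    using reach[OF G.E_reach[OF that]] Phi_E[OF that] by simp
  \<comment> \<open>\<open>U (\<gamma> x)\<close> already lies in the image of the smallest
    admissible \<open>S\<close>, so one argument covers \<open>S = \<E> G\<close> and
    \<open>S = hspace G\<close>.\<close>
  have p1: "U (\<gamma> x) = proj (U ` S) (emb_K x)"
    if x: "x \<in> \<E>_star K" and S: "csubspace S" "S \<subseteq> hspace G" "\<E> G \<subseteq> S" for x S
  proof (rule proj_eqI[symmetric])
    show "csubspace (U ` S)"
      by (rule csubspace_image[OF clinear_on_subset[OF isometric_clinear_on[OF iso] S(2)] S(1)])
    show "U (\<gamma> x) \<in> U ` S" using gamma_in[OF x] S(3) by blast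
    fix s assume "s \<in> U ` S"
    then obtain h where h: "h \<in> hspace G" "s = U h" using S(2) by blast
    show "cinner s (U (\<gamma> x)) = cinner s (emb_K x)"
      using cinner_U_emb_K[OF U reach word x h(1)]
        isometric_cinner[OF iso G.csubspace_hspace h(1) G.E_in[OF gamma_in[OF x]]]
      by (simp add: h(2))
  qed
  \<comment> \<open>Only the second component of \<open>U e\<close> meets the copy of
    \<open>K\<close>, and it already lies in \<open>\<E>_star K\<close>.\<close>
  have p2: "emb_K (ga e) = proj (emb_K ` S) (U e)"
    if e: "e \<in> \<E> G" and S: "csubspace S" "\<E>_star K \<subseteq> S" for e S
  proof (rule proj_eqI[symmetric])
    show "csubspace (emb_K ` S :: ('g \<times> 'k \<times> ('d list, 'g) l2) set)"
      by (rule csubspace_image[OF isometric_clinear_on[OF isometric_emb_K] S(1)])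
    show "emb_K (ga e) \<in> emb_K ` S" using ga_in S(2) by blast
    show "cinner s (emb_K (ga e)) = cinner s (U e)" if "s \<in> emb_K ` S" for s
      using that by (auto simp: UE[OF e] emb_K_def)
  qed
  show ?thesis
  proof (intro exI conjI ballI)
    show "\<gamma>_identification G K \<gamma> U"
      unfolding \<gamma>_identification_def using U Ub word[OF G.E_in] UE by simp
    show "identifies G (subprocess X (emb_g ` base G)) U"
      unfolding identifies_def subprocess_def using U row Ub by (auto simp: image_iff)
  qed (use G.E_in K.E_star_in in \<open>auto intro!: p1 p2 G.csubspace_E G.csubspace_hspace
      K.csubspace_E_star K.csubspace_hspace\<close>)
qed

end

section \<open>Equivalence of two \<gamma>-extensions\<close>

lemma equivalent_gamma_extensions_iff:
  fixes G :: "('d, 'g::complex_hilbert) process" and K :: "('d, 'k::complex_hilbert) process"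
  assumes "gamma_extension G K \<gamma>1" "gamma_extension G K \<gamma>2"
  shows "(\<exists>j. extension_equivalence G emb_g (\<gamma>_extension G K \<gamma>1) proj_k
      emb_g (\<gamma>_extension G K \<gamma>2) proj_k j) \<longleftrightarrow> (\<forall>x\<in>\<E>_star K. \<gamma>1 x = \<gamma>2 x)"
proof -
  interpret A: gamma_extension G K \<gamma>1 by (rule assms)
  interpret B: gamma_extension G K \<gamma>2 by (rule assms)
  have base: "base A.X = base B.X" by (simp add: A.base_X B.base_X)
  show ?thesis
  proof
    assume eq: "\<forall>x\<in>\<E>_star K. \<gamma>1 x = \<gamma>2 x"
    \<comment> \<open>On the base, the adjoint formula involves \<gamma> only through its values on
      \<open>\<E>_star K\<close>, so the identity map intertwines.\<close>
    have "adj (hspace B.X) (letter B.X k) p = adj (hspace A.X) (letter A.X k) p"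
      if "p \<in> base A.X" for k p
      using that eq A.Ps_in by (auto simp: A.base_X A.Vadj_X B.Vadj_X A.K.base_in)
    then have "extension_equivalence G emb_g A.X proj_k emb_g B.X proj_k (\<lambda>p. p)"
      by (simp add: extension_equivalence_def isomorphism_def morphism_def contraction_def
          unitary_def isometric_def clinear_on_def base)
    then show "\<exists>j. extension_equivalence G emb_g A.X proj_k emb_g B.X proj_k j" by blast
  next
    assume "\<exists>j. extension_equivalence G emb_g A.X proj_k emb_g B.X proj_k j"
    then obtain j where m: "morphism A.X B.X j" and u: "isometric (base A.X) (base B.X) j"
      and jg: "\<And>x. x \<in> base G \<Longrightarrow> j (emb_g x) = emb_g x"
      and pj: "\<And>p. p \<in> base A.X \<Longrightarrow> proj_k (j p) = proj_k p"
      by (auto simp: extension_equivalence_def isomorphism_def unitary_def)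
    \<comment> \<open>Compatibility with the projections fixes the second component, and
      preservation of the norm then leaves no room for a first one.\<close>
    have jK: "j (emb_K y) = emb_K y" if y: "y \<in> base K" for y
    proof -
      have "j (emb_K y) \<in> base B.X" by (rule isometric_in[OF u A.emb_K_base[OF y]])
      then obtain a b where ab: "j (emb_K y) = (a, b, 0)" by (auto simp: B.base_X)
      have b: "b = y" using pj[OF A.emb_K_base[OF y], unfolded ab] by (simp add: proj_k_def emb_K_def)
      have "norm (j (emb_K y)) = norm (emb_K y :: 'g \<times> 'k \<times> ('d list, 'g) l2)"
        using u A.emb_K_base[OF y] by (simp add: isometric_def)
      then have "(norm (j (emb_K y)))\<^sup>2 = (norm (emb_K y :: 'g \<times> 'k \<times> ('d list, 'g) l2))\<^sup>2"
        by simp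
      then have "a = 0" unfolding ab b by (simp add: norm_prod_def emb_K_def)
      then show ?thesis unfolding ab b by (simp add: emb_K_def)
    qed
    have eq: "\<gamma>1 (A.Ps y) = \<gamma>2 (A.Ps y)" if y: "y \<in> base K" for y
    proof -
      \<comment> \<open>Obtained by comparing the \<open>G\<close>-components of the intertwining
        relation at \<open>emb_K y\<close>.\<close>
      have Vadj: "A.G.Vadj k (\<gamma>1 (A.Ps y)) = A.G.Vadj k (\<gamma>2 (A.Ps y))" for k
      proof -
        have g: "A.G.Vadj k (\<gamma>1 (A.Ps y)) \<in> base G"
          using A.G.E_reach[OF A.gamma_in[OF A.Ps_in]] by (simp add: A.G.reach_def)
        have "B.X.Vadj k (j (emb_K y)) = j (A.X.Vadj k (emb_K y))"
          using m A.emb_K_base[OF y] by (simp add: morphism_def)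
        also have "A.X.Vadj k (emb_K y) = emb_g (A.G.Vadj k (\<gamma>1 (A.Ps y))) + emb_K (A.K.Vadj k y)"
          unfolding A.Vadj_emb_K[OF A.K.base_in[OF y]] by (simp add: emb_g_def emb_K_def)
        also have "j \<dots> = emb_g (A.G.Vadj k (\<gamma>1 (A.Ps y))) + emb_K (A.K.Vadj k y)"
          using clinear_on_add[OF isometric_clinear_on[OF u] A.emb_g_base[OF g]
              A.emb_K_base[OF A.K.Vadj_base[OF y]]] jg[OF g] jK[OF A.K.Vadj_base[OF y]] by simp
        finally show ?thesis
          unfolding jK[OF y] B.Vadj_emb_K[OF A.K.base_in[OF y]] by (simp add: emb_g_def emb_K_def)
      qed
      let ?\<delta> = "\<gamma>1 (A.Ps y) - \<gamma>2 (A.Ps y)"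
      have E: "?\<delta> \<in> \<E> G"
        by (intro complex_vector.subspace_diff A.G.csubspace_E A.gamma_in B.gamma_in A.Ps_in)
      \<comment> \<open>As an element of \<open>\<E> G\<close> the difference is orthogonal to the
        base, and all adjoints of letters kill it.\<close>
      have "?\<delta> = 0"
        by (rule A.G.orth_hspace)
          (simp_all add: A.G.E_in[OF E] A.G.cinner_base_E[OF E] A.G.Vadj_diff Vadj)
      then show ?thesis by simp
    qed
    show "\<forall>x\<in>\<E>_star K. \<gamma>1 x = \<gamma>2 x"
    proof
      fix x assume x: "x \<in> \<E>_star K"
      show "\<gamma>1 x = \<gamma>2 x"
        by (rule bclinear_on_eq_ccspan[OF A.bclinear_on_gamma B.bclinear_on_gamma
              A.K.E_star_closed_csubspace, of "A.Ps ` base K"])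
          (use x A.K.E_star_eq_ccspan eq A.Ps_in in auto)
    qed
  qed
qed

section \<open>Extensions are \<gamma>-extensions\<close>

locale process_extension =
  G: markov_process G + H: markov_process H + K: markov_process K
  for G :: "('d, 'g::complex_hilbert) process" and H :: "('d, 'h::complex_hilbert) process"
    and K :: "('d, 'k::complex_hilbert) process" +
  fixes i :: "'g \<Rightarrow> 'h" and p :: "'h \<Rightarrow> 'k"
  assumes i_morphism: "morphism G H i" and i_isometric: "isometric (base G) (base H) i"
    and p_morphism: "morphism H K p" and p_coisometric: "coisometric (base H) (base K) p"
    and exact: "i ` base G = {x \<in> base H. p x = 0}"
begin

text \<open>The adjoint of \<open>p\<close>: the isometric section that places \<open>base K\<close>
  orthogonally to the image of \<open>i\<close>.\<close>

definition pa :: "'k \<Rightarrow> 'h" where "pa = adj (base H) p"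

lemma p_contraction: "contraction (base H) (base K) p" and pa_isometric: "isometric (base K) (base H) pa"
  using p_coisometric by (auto simp: coisometric_def pa_def)

lemma i_in: "x \<in> base G \<Longrightarrow> i x \<in> base H" and pa_in: "y \<in> base K \<Longrightarrow> pa y \<in> base H"
  and p_in: "b \<in> base H \<Longrightarrow> p b \<in> base K" and p_i: "x \<in> base G \<Longrightarrow> p (i x) = 0"
  using i_isometric pa_isometric p_contraction exact by (auto simp: isometric_def contraction_def)

lemma cinner_pa: "b \<in> base H \<Longrightarrow> cinner b (pa y) = cinner (p b) y"
  and cinner_pa': "b \<in> base H \<Longrightarrow> cinner (pa y) b = cinner y (p b)"
  unfolding pa_def
  by (rule cinner_adj[OF H.base_closed_csubspace contraction_bclinear_on[OF p_contraction]], assumption)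
    (rule cinner_adj'[OF H.base_closed_csubspace contraction_bclinear_on[OF p_contraction]])

text \<open>Isometry of \<open>pa\<close> means that \<open>p (pa y)\<close> and \<open>y\<close>
  have the same inner products with all of \<open>base K\<close>, in particular with their
  difference.\<close>

lemma p_pa: "y \<in> base K \<Longrightarrow> p (pa y) = y"
proof -
  assume y: "y \<in> base K"
  let ?z = "p (pa y) - y"
  have z: "?z \<in> base K"
    using y by (intro complex_vector.subspace_diff K.csubspace_base p_in pa_in)
  have "cinner (p (pa y)) ?z = cinner y ?z"
    using cinner_pa[OF pa_in[OF y], of ?z]
      isometric_cinner[OF pa_isometric K.csubspace_base y z] by simp
  then have "cinner ?z ?z = 0" by (subst cinner.diff_left) simp
  then show ?thesis by simp
qed

text \<open>The residual \<open>b - pa (p b)\<close> is killed by \<open>p\<close>, and exactness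
  puts it into the image of \<open>i\<close>.\<close>

lemma base_decompose: "b \<in> base H \<Longrightarrow> \<exists>x\<in>base G. b = i x + pa (p b)"
proof -
  assume b: "b \<in> base H"
  have d: "b - pa (p b) \<in> base H"
    using b by (intro complex_vector.subspace_diff H.csubspace_base pa_in p_in)
  have "p (b - pa (p b)) = p b - p (pa (p b))"
    using p_contraction b
    by (intro clinear_on_diff[OF _ H.csubspace_base] pa_in p_in) (simp_all add: contraction_def)
  then have "p (b - pa (p b)) = 0" by (simp add: p_pa p_in b)
  then have "b - pa (p b) \<in> i ` base G" using d exact by simp
  then obtain x where "x \<in> base G" "b - pa (p b) = i x" by blast
  then show ?thesis by (intro bexI[of _ x]) (auto simp: algebra_simps)
qed

lemma Vadj_i: "x \<in> base G \<Longrightarrow> H.Vadj k (i x) = i (G.Vadj k x)"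
  using i_morphism by (simp add: morphism_def)

lemma p_Vadj: "b \<in> base H \<Longrightarrow> p (H.Vadj k b) = K.Vadj k (p b)"
  using p_morphism by (simp add: morphism_def)

lemma cinner_word_i:
  "x \<in> base G \<Longrightarrow> y \<in> base G \<Longrightarrow> cinner (word H \<alpha> (i x)) (i y) = cinner (word G \<alpha> x) y"
proof (induction \<alpha> arbitrary: y)
  case Nil
  then show ?case using isometric_cinner[OF i_isometric G.csubspace_base] by simp
next
  case (Cons k \<alpha>)
  then show ?case
    using H.cinner_Vadj[OF H.word_in[OF H.base_in[OF i_in[OF Cons.prems(1)]], of \<alpha>], of k "i y"]
      G.cinner_Vadj[OF G.word_in[OF G.base_in[OF Cons.prems(1)], of \<alpha>], of k y]
    by (simp add: Vadj_i G.Vadj_base)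
qed

text \<open>Stated for all \<open>b\<close> in \<open>base H\<close> because the image of
  \<open>pa\<close> is in general not coinvariant and the induction leaves it; the step works since
  \<open>p\<close> intertwines the adjoints.\<close>

lemma cinner_word_pa:
  "x \<in> base K \<Longrightarrow> b \<in> base H \<Longrightarrow> cinner (word H \<alpha> (pa x)) b = cinner (word K \<alpha> x) (p b)"
proof (induction \<alpha> arbitrary: b)
  case Nil
  then show ?case by (simp add: cinner_pa')
next
  case (Cons k \<alpha>)
  then show ?case
    using H.cinner_Vadj[OF H.word_in[OF H.base_in[OF pa_in[OF Cons.prems(1)]], of \<alpha>], of k b]
      K.cinner_Vadj[OF K.word_in[OF K.base_in[OF Cons.prems(1)], of \<alpha>], of k "p b"]
    by (simp add: p_Vadj H.Vadj_base)
qed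

lemma lifts_ex:
  "\<exists>UG. isometric (hspace G) (hspace H) UG \<and> (\<forall>x\<in>base G. UG x = i x) \<and>
    (\<forall>k. \<forall>h\<in>hspace G. UG (letter G k h) = letter H k (UG h))"
  "\<exists>UK. isometric (hspace K) (hspace H) UK \<and> (\<forall>x\<in>base K. \<forall>\<alpha>. UK (word K \<alpha> x) = word H \<alpha> (pa x)) \<and>
    (\<forall>k. \<forall>h\<in>hspace K. UK (letter K k h) = letter H k (UK h)) \<and>
    (\<forall>\<xi>\<in>l2_of (hspace K). UK (row K \<xi>) = row H (l2_map UK \<xi>))"
proof -
  have s: "i ` base G \<subseteq> hspace H" "pa ` base K \<subseteq> hspace H"
    using i_in pa_in H.base_in by auto
  obtain UG where "unitary (hspace G) (generated H (i ` base G)) UG"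
    and w: "\<And>x \<alpha>. x \<in> base G \<Longrightarrow> UG (word G \<alpha> x) = word H \<alpha> (i x)"
    and "\<And>k h. h \<in> hspace G \<Longrightarrow> UG (letter G k h) = letter H k (UG h)"
    by (rule intertwiner[OF G.row_isometry_axioms H.row_isometry_axioms G.base_subset s(1)])
      (simp_all add: cinner_word_i flip: G.hspace_eq)
  moreover have "UG x = i x" if "x \<in> base G" for x using w[OF that, of "[]"] by simp
  ultimately show "\<exists>UG. isometric (hspace G) (hspace H) UG \<and> (\<forall>x\<in>base G. UG x = i x) \<and>
      (\<forall>k. \<forall>h\<in>hspace G. UG (letter G k h) = letter H k (UG h))"
    using H.generated_subset[OF s(1)] by (intro exI[of _ UG]) (auto simp: unitary_def isometric_def)
  obtain UK where "unitary (hspace K) (generated H (pa ` base K)) UK"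
    and "\<And>x \<alpha>. x \<in> base K \<Longrightarrow> UK (word K \<alpha> x) = word H \<alpha> (pa x)"
    and "\<And>k h. h \<in> hspace K \<Longrightarrow> UK (letter K k h) = letter H k (UK h)"
    and "\<And>\<xi>. \<xi> \<in> l2_of (hspace K) \<Longrightarrow> UK (row K \<xi>) = row H (l2_map UK \<xi>)"
    by (rule intertwiner[OF K.row_isometry_axioms H.row_isometry_axioms K.base_subset s(2)])
      (simp_all add: cinner_word_pa pa_in p_pa flip: K.hspace_eq)
  then show "\<exists>UK. isometric (hspace K) (hspace H) UK \<and> (\<forall>x\<in>base K. \<forall>\<alpha>. UK (word K \<alpha> x) = word H \<alpha> (pa x)) \<and>
      (\<forall>k. \<forall>h\<in>hspace K. UK (letter K k h) = letter H k (UK h)) \<and>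
      (\<forall>\<xi>\<in>l2_of (hspace K). UK (row K \<xi>) = row H (l2_map UK \<xi>))"
    using H.generated_subset[OF s(2)] by (intro exI[of _ UK]) (auto simp: unitary_def isometric_def)
qed

end

section \<open>The contraction extracted from an extension\<close>

locale lifted_extension = process_extension G H K i p
  for G :: "('d, 'g::complex_hilbert) process" and H :: "('d, 'h::complex_hilbert) process"
    and K :: "('d, 'k::complex_hilbert) process" and i p +
  fixes UG :: "'g \<Rightarrow> 'h" and UK :: "'k \<Rightarrow> 'h"
  assumes UG_isometric: "isometric (hspace G) (hspace H) UG"
    and UG_base: "x \<in> base G \<Longrightarrow> UG x = i x"
    and UG_letter: "h \<in> hspace G \<Longrightarrow> UG (letter G k h) = letter H k (UG h)"
    and UK_isometric: "isometric (hspace K) (hspace H) UK"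
    and UK_word: "y \<in> base K \<Longrightarrow> UK (word K \<alpha> y) = word H \<alpha> (pa y)"
    and UK_letter: "h' \<in> hspace K \<Longrightarrow> UK (letter K k h') = letter H k (UK h')"
    and UK_row: "\<xi> \<in> l2_of (hspace K) \<Longrightarrow> UK (row K \<xi>) = row H (l2_map UK \<xi>)"
begin

lemma UG_in: "h \<in> hspace G \<Longrightarrow> UG h \<in> hspace H" and UK_in: "h' \<in> hspace K \<Longrightarrow> UK h' \<in> hspace H"
  using UG_isometric UK_isometric by (auto simp: isometric_def)

lemmas bclinear_on_UG = isometric_bclinear_on[OF UG_isometric]
lemmas bclinear_on_UK = isometric_bclinear_on[OF UK_isometric]

lemma UK_base: "y \<in> base K \<Longrightarrow> UK y = pa y"
  using UK_word[of y "[]"] by simp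

definition gam :: "'k \<Rightarrow> 'g" where "gam v = adj (hspace G) UG (UK v)"

lemma gam_in_hspace: "gam v \<in> hspace G"
  unfolding gam_def by (rule adj_in[OF G.hspace_closed_csubspace bclinear_on_UG])

lemma cinner_gam: "h \<in> hspace G \<Longrightarrow> cinner h (gam v) = cinner (UG h) (UK v)"
  unfolding gam_def by (rule cinner_adj[OF G.hspace_closed_csubspace bclinear_on_UG])

text \<open>On generators the pairing goes through \<open>p (i x) = 0\<close>, by
  \<open>cinner_word_pa\<close>.\<close>

lemma orth_UK: "v \<in> hspace K \<Longrightarrow> x \<in> base G \<Longrightarrow> cinner (i x) (UK v) = 0"
proof -
  assume v: "v \<in> hspace K" and x: "x \<in> base G"
  have "hspace K \<subseteq> {v \<in> hspace K. UK v \<in> {z. \<forall>y\<in>{i x}. cinner y z = 0}}"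
  proof (rule K.hspace_induct)
    show "csubspace {v \<in> hspace K. UK v \<in> {z. \<forall>y\<in>{i x}. cinner y z = 0}}"
      by (rule csubspace_vimage[OF isometric_clinear_on[OF UK_isometric] K.csubspace_hspace csubspace_orth])
    show "closed {v \<in> hspace K. UK v \<in> {z. \<forall>y\<in>{i x}. cinner y z = 0}}"
      by (rule closed_vimage_bclinear[OF bclinear_on_UK K.hspace_closed_csubspace closed_orth])
    fix y \<alpha> assume y: "y \<in> base K"
    have "cinner (UK (word K \<alpha> y)) (i x) = 0"
      using x y by (simp add: UK_word cinner_word_pa i_in p_i)
    then show "word K \<alpha> y \<in> {v \<in> hspace K. UK v \<in> {z. \<forall>y\<in>{i x}. cinner y z = 0}}"
      using y by (simp add: K.word_in K.base_in cinner_eq_0_commute)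
  qed
  then show ?thesis using v by auto
qed

text \<open>\<open>UK\<close> intertwines the rows and maps the base of \<open>K\<close> into that
  of \<open>H\<close>, so it sends the generators of \<open>reach\<close> to
  \<open>reach\<close>.\<close>

lemma UK_reach: "v \<in> K.reach \<Longrightarrow> UK v \<in> H.reach"
proof -
  have "K.reach \<subseteq> {v \<in> hspace K. UK v \<in> H.reach}"
    unfolding K.ccspan_base_row[symmetric]
  proof (rule ccspan_minimal)
    show "csubspace {v \<in> hspace K. UK v \<in> H.reach}"
      by (rule csubspace_vimage[OF isometric_clinear_on[OF UK_isometric] K.csubspace_hspace H.csubspace_reach])
    show "closed {v \<in> hspace K. UK v \<in> H.reach}"
      by (rule closed_vimage_bclinear[OF bclinear_on_UK K.hspace_closed_csubspace H.closed_reach])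
    have "UK (row K \<xi>) \<in> H.reach" if \<xi>: "\<xi> \<in> l2_of (base K)" for \<xi>
    proof -
      have "l2_map UK \<xi> \<in> l2_of (base H)"
        by (rule l2_map_in[OF bclinear_on_subset[OF bclinear_on_UK K.base_subset] _ \<xi>])
          (auto simp: UK_base pa_in)
      then show ?thesis using \<xi> by (simp add: UK_row K.l2_of_base H.row_reach)
    qed
    then show "base K \<union> row K ` l2_of (base K) \<subseteq> {v \<in> hspace K. UK v \<in> H.reach}"
      using H.base_reach pa_in by (auto simp: K.base_in UK_base K.row_in K.l2_of_base)
  qed
  then show "v \<in> K.reach \<Longrightarrow> UK v \<in> H.reach" by auto
qed

text \<open>\<open>V_k^* UK e\<close> is in \<open>base H\<close> because \<open>UK e\<close> is in
  \<open>reach\<close>. Its image under \<open>p\<close> has norm 0, since the pairing with itself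
  ends in the adjoint of \<open>K\<close> at \<open>e\<close>, which is 0. By exactness the vector
  comes from \<open>base G\<close>, and isometry of \<open>UG\<close> identifies its
  preimage.\<close>

lemma Vadj_UK_E_star:
  assumes e: "e \<in> \<E>_star K"
  shows "G.Vadj k (gam e) \<in> base G" "H.Vadj k (UK e) = i (G.Vadj k (gam e))"
proof -
  let ?b = "H.Vadj k (UK e)"
  have "e \<in> K.reach"
    using e K.csubspace_base by (simp add: K.reach_def K.E_star_in K.Vadj_E_star csubspace_intros)
  then have b: "?b \<in> base H" using UK_reach by (simp add: H.reach_def)
  then have pb: "p ?b \<in> base K" by (rule p_in)
  have "cinner (p ?b) (p ?b) = cinner (pa (p ?b)) ?b" using b by (simp add: cinner_pa')
  also have "\<dots> = cinner (UK (letter K k (p ?b))) (UK e)"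
    using pb by (simp add: H.cinner_Vadj H.base_in pa_in UK_letter K.base_in UK_base)
  also have "\<dots> = cinner (letter K k (p ?b)) e"
    using pb e by (intro isometric_cinner[OF UK_isometric K.csubspace_hspace] K.letter_in K.base_in
        K.E_star_in)
  also have "\<dots> = cinner (p ?b) (K.Vadj k e)" using pb by (simp add: K.cinner_Vadj K.base_in)
  also have "\<dots> = 0" using e by (simp add: K.Vadj_E_star)
  finally have "p ?b = 0" by simp
  then have "?b \<in> i ` base G" using b exact by simp
  then obtain g where g: "g \<in> base G" "?b = i g" by blast
  have "G.Vadj k (gam e) = g"
  proof (rule G.Vadj_eqI)
    fix h assume h: "h \<in> hspace G"
    have "cinner (letter G k h) (gam e) = cinner (UG h) ?b"
      using h by (simp add: cinner_gam G.letter_in UG_letter H.cinner_Vadj UG_in)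
    also have "\<dots> = cinner h g"
      using isometric_cinner[OF UG_isometric G.csubspace_hspace h G.base_in[OF g(1)]] g
      by (simp add: UG_base)
    finally show "cinner h g = cinner (letter G k h) (gam e)" by simp
  qed (rule G.base_in[OF g(1)])
  then show "G.Vadj k (gam e) \<in> base G" "?b = i (G.Vadj k (gam e))" using g by simp_all
qed

lemma gam_contraction: "contraction (\<E>_star K) (\<E> G) gam"
  unfolding contraction_def
proof (intro conjI ballI image_subsetI)
  have "bclinear_on (hspace K) (\<lambda>v. adj (hspace G) UG (UK v))"
    by (rule bclinear_on_compose[OF bclinear_on_UK
          bclinear_on_adj[OF G.hspace_closed_csubspace bclinear_on_UG, of UNIV]]) auto
  then show "clinear_on (\<E>_star K) gam"
    unfolding gam_def[abs_def]
    by (rule clinear_on_subset[OF bclinear_on_imp_clinear_on]) (auto simp: K.E_star_in)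
  fix e assume e: "e \<in> \<E>_star K"
  show "gam e \<in> \<E> G"
    unfolding G.E_eq ominus_def
    using e by (auto simp: G.reach_def gam_in_hspace Vadj_UK_E_star cinner_gam G.base_in UG_base
        orth_UK K.E_star_in)
  have "norm (gam e) \<le> 1 * norm (UK e)"
    unfolding gam_def
    using UG_isometric
    by (intro norm_adj_le[OF G.hspace_closed_csubspace bclinear_on_UG]) (simp_all add: isometric_def)
  also have "\<dots> = norm e" using UK_isometric K.E_star_in[OF e] by (simp add: isometric_def)
  finally show "norm (gam e) \<le> norm e" .
qed

sublocale gamma_extension G K gam
  by unfold_locales (rule gam_contraction)

text \<open>Write \<open>y\<close> as \<open>Ps y\<close> plus the row of its adjoints.
  \<open>UK\<close> sends the first part to a vector whose adjoints are expressed by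
  \<open>gam\<close>, and the second to a row in \<open>H\<close> whose coordinates can be read off.
  The result has the shape of the adjoint formula in the \<gamma>-extension.\<close>

lemma Vadj_pa:
  assumes y: "y \<in> base K"
  shows "H.Vadj k (pa y) = i (G.Vadj k (gam (Ps y))) + pa (K.Vadj k y)"
proof -
  have yH: "y \<in> hspace K" using y by (rule K.base_in)
  let ?r = "K.row_star y"
  have "y = Ps y + row K ?r" using K.proj_E_star[OF yH] by (simp add: K.wandering_def)
  then have "UK y = UK (Ps y) + UK (row K ?r)"
    using clinear_on_add[OF isometric_clinear_on[OF UK_isometric] K.E_star_in[OF Ps_in]
        K.row_in[OF K.row_star_in], of y y] by simp
  moreover have r: "l2_map UK ?r \<in> l2_of (hspace H)"
    by (rule l2_map_in[OF bclinear_on_UK _ K.row_star_in]) (auto simp: UK_in)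
  moreover have "coord (l2_map UK ?r) k = pa (K.Vadj k y)"
    by (simp add: coord_l2_map_bclinear[OF bclinear_on_UK K.row_star_in] K.coord_row_star
        UK_base K.Vadj_base y)
  ultimately show ?thesis
    using Vadj_UK_E_star(2)[OF Ps_in, of k y]
    by (simp add: H.Vadj_add UK_row[OF K.row_star_in] H.Vadj_row UK_base[OF y, symmetric])
qed

text \<open>The map is \<open>i\<close> plus \<open>pa\<close>: it is unitary since the two images
  are orthogonal and exhaust \<open>base H\<close>, and it intertwines because
  \<open>Vadj_pa\<close> reproduces the adjoint formula of the extension.\<close>

lemma extension_equivalence_gam:
  "extension_equivalence G emb_g X proj_k i H p (\<lambda>(x, y, z). i x + pa y)"
proof -
  let ?j = "\<lambda>(x, y, z). i x + pa y"
  have li: "clinear_on (base G) i" and lp: "clinear_on (base K) pa"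
    using i_isometric pa_isometric by (auto simp: isometric_def)
  have zero: "i 0 = 0" "pa 0 = 0"
    using clinear_on_zero[OF li] clinear_on_zero[OF lp]
    by (simp_all add: G.csubspace_base K.csubspace_base csubspace_intros)
  have orth: "cinner (i x) (pa y) = 0" if "x \<in> base G" for x y
    using that by (simp add: cinner_pa i_in p_i)
  have iso: "isometric (base X) (base H) ?j"
    unfolding isometric_def
  proof (intro conjI ballI clinear_onI)
    show "?j ` base X \<subseteq> base H"
      by (auto simp: base_X i_in pa_in H.csubspace_base csubspace_intros)
    fix q assume "q \<in> base X"
    then obtain x y where q: "q = (x, y, 0)" "x \<in> base G" "y \<in> base K" by (auto simp: base_X)
    have "(norm (?j q))\<^sup>2 = (norm q)\<^sup>2"
      using norm_add_sq_orth[OF orth[OF q(2), of y]] i_isometric pa_isometric q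
      by (simp add: norm_prod_def isometric_def)
    then show "norm (?j q) = norm q" by simp
  qed (auto simp: base_X scaleC_prod_def clinear_on_add[OF li] clinear_on_add[OF lp]
      clinear_on_scaleC[OF li] clinear_on_scaleC[OF lp] scaleC_add_right)
  have surj: "?j ` base X = base H"
  proof
    show "base H \<subseteq> ?j ` base X"
    proof
      fix b assume b: "b \<in> base H"
      then obtain x where "x \<in> base G" "b = i x + pa (p b)" using base_decompose by blast
      then show "b \<in> ?j ` base X"
        using p_in[OF b] by (intro image_eqI[of _ _ "(x, p b, 0)"]) (auto simp: base_X)
    qed
  qed (use iso in \<open>simp add: isometric_def\<close>)
  have int: "H.Vadj k (?j q) = ?j (X.Vadj k q)" if qX: "q \<in> base X" for k q
  proof -
    obtain x y where q: "q = (x, y, 0)" "x \<in> base G" "y \<in> base K" using qX by (auto simp: base_X)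
    have "H.Vadj k (?j q) = i (G.Vadj k x) + (i (G.Vadj k (gam (Ps y))) + pa (K.Vadj k y))"
      by (simp add: q H.Vadj_add Vadj_i Vadj_pa)
    also have "\<dots> = i (G.Vadj k x + G.Vadj k (gam (Ps y))) + pa (K.Vadj k y)"
      by (simp add: clinear_on_add[OF li G.Vadj_base[OF q(2)] Vadj_UK_E_star(1)[OF Ps_in]])
    also have "\<dots> = ?j (X.Vadj k q)"
      using q by (simp add: Vadj_X K.base_in G.Vadj_add)
    finally show ?thesis .
  qed
  have lp': "clinear_on (base H) p" using p_contraction by (simp add: contraction_def)
  show ?thesis
    unfolding extension_equivalence_def isomorphism_def morphism_def unitary_def
  proof (intro conjI allI ballI)
    show "contraction (base X) (base H) ?j" using iso by (rule isometric_contraction)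
    show "?j (emb_g x) = i x" if "x \<in> base G" for x by (simp add: emb_g_def zero)
    show "p (?j q) = proj_k q" if "q \<in> base X" for q
      using that by (auto simp: base_X proj_k_def clinear_on_add[OF lp'] i_in pa_in p_i p_pa)
  qed (rule iso surj int, assumption?)+
qed

end

theorem theorem4p3:
  fixes G :: "('d::countable, 'g::complex_hilbert) process"
    and K :: "('d, 'k::complex_hilbert) process"
  assumes G: "is_process G" and K: "is_process K"
  shows
    "(\<forall>\<gamma>. contraction (\<E>_star K) (\<E> G) \<gamma> \<longrightarrow>
      (let X = \<gamma>_extension G K \<gamma> in
        is_process X \<and>
        (\<exists>U. \<gamma>_identification G K \<gamma> U \<and>
          (\<forall>x\<in>\<E>_star K.
            U (\<gamma> x) = proj (U ` \<E> G) (emb_K x) \<and>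
            U (\<gamma> x) = proj (U ` hspace G) (emb_K x)) \<and>
          (\<forall>e\<in>\<E> G.
            emb_K (\<gamma>_adj K \<gamma> e) = proj (emb_K ` \<E>_star K) (U e) \<and>
            emb_K (\<gamma>_adj K \<gamma> e) = proj (emb_K ` hspace K) (U e)) \<and>
          subprocess_base X (emb_g ` base G) \<and>
          identifies G (subprocess X (emb_g ` base G)) U \<and>
          identifies K (quotient_process X (emb_g ` base G)) emb_K) \<and>
        short_exact G emb_g X proj_k K)) \<and>
    (\<forall>(H' :: ('d, 'h::complex_hilbert) process) i' p'. short_exact G i' H' p' K \<longrightarrow>
      (\<exists>\<gamma> j. contraction (\<E>_star K) (\<E> G) \<gamma> \<and>
        extension_equivalence G emb_g (\<gamma>_extension G K \<gamma>) proj_k i' H' p' j)) \<and>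
    (\<forall>\<gamma>1 \<gamma>2. contraction (\<E>_star K) (\<E> G) \<gamma>1 \<longrightarrow> contraction (\<E>_star K) (\<E> G) \<gamma>2 \<longrightarrow>
      ((\<exists>j. extension_equivalence G emb_g (\<gamma>_extension G K \<gamma>1) proj_k
              emb_g (\<gamma>_extension G K \<gamma>2) proj_k j) \<longleftrightarrow>
        (\<forall>x\<in>\<E>_star K. \<gamma>1 x = \<gamma>2 x)))"
proof -
  interpret G: markov_process G using G by (simp add: is_process_iff)
  interpret K: markov_process K using K by (simp add: is_process_iff)
  have ext: "gamma_extension G K \<gamma>" if "contraction (\<E>_star K) (\<E> G) \<gamma>" for \<gamma>
    using that by unfold_locales
  show ?thesis
  proof (intro conjI allI impI)
    fix \<gamma> assume "contraction (\<E>_star K) (\<E> G) \<gamma>"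
    then interpret gamma_extension G K \<gamma> by (rule ext)
    \<comment> \<open>Countability of the alphabet makes the set of words countable, as separability
      of the shift part requires.\<close>
    have proc: "is_process X"
      using separable_X G K X.markov_process_axioms by (simp add: is_process_iff)
    show "let X = \<gamma>_extension G K \<gamma> in
        is_process X \<and>
        (\<exists>U. \<gamma>_identification G K \<gamma> U \<and>
          (\<forall>x\<in>\<E>_star K.
            U (\<gamma> x) = proj (U ` \<E> G) (emb_K x) \<and>
            U (\<gamma> x) = proj (U ` hspace G) (emb_K x)) \<and>
          (\<forall>e\<in>\<E> G.
            emb_K (\<gamma>_adj K \<gamma> e) = proj (emb_K ` \<E>_star K) (U e) \<and>
            emb_K (\<gamma>_adj K \<gamma> e) = proj (emb_K ` hspace K) (U e)) \<and>
          subprocess_base X (emb_g ` base G) \<and>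
          identifies G (subprocess X (emb_g ` base G)) U \<and>
          identifies K (quotient_process X (emb_g ` base G)) emb_K) \<and>
        short_exact G emb_g X proj_k K"
      unfolding Let_def
      using proc gamma_identification_ex subprocess_base_emb_g identifies_quotient
        short_exact_X[OF G proc K] by blast
  next
    fix H' :: "('d, 'h) process" and i' p'
    assume se: "short_exact G i' H' p' K"
    then interpret H: markov_process H' by (simp add: short_exact_def is_process_iff)
    interpret process_extension G H' K i' p'
      using se by unfold_locales (auto simp: short_exact_def)
    \<comment> \<open>The lifts of \<open>G\<close> and \<open>K\<close> into the large space of the
      given extension are fixed here, so that \<open>gam\<close> becomes available as the required
      contraction.\<close>
    obtain UG UK where "lifted_extension G H' K i' p' UG UK"
    proof -
      from lifts_ex(1) obtain UG where 1: "isometric (hspace G) (hspace H') UG"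
        "\<forall>x\<in>base G. UG x = i' x" "\<forall>k. \<forall>h\<in>hspace G. UG (letter G k h) = letter H' k (UG h)"
        by blast
      from lifts_ex(2) obtain UK where 2: "isometric (hspace K) (hspace H') UK"
        "\<forall>x\<in>base K. \<forall>\<alpha>. UK (word K \<alpha> x) = word H' \<alpha> (pa x)"
        "\<forall>k. \<forall>h\<in>hspace K. UK (letter K k h) = letter H' k (UK h)"
        "\<forall>\<xi>\<in>l2_of (hspace K). UK (row K \<xi>) = row H' (l2_map UK \<xi>)"
        by blast
      have "lifted_extension G H' K i' p' UG UK"
        using 1 2 by unfold_locales auto
      then show thesis by (rule that)
    qed
    then interpret lifted_extension G H' K i' p' UG UK .
    show "\<exists>\<gamma> j. contraction (\<E>_star K) (\<E> G) \<gamma> \<and>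
        extension_equivalence G emb_g (\<gamma>_extension G K \<gamma>) proj_k i' H' p' j"
      using gam_contraction extension_equivalence_gam by blast
  next
    fix \<gamma>1 \<gamma>2 assume "contraction (\<E>_star K) (\<E> G) \<gamma>1" "contraction (\<E>_star K) (\<E> G) \<gamma>2"
    then show "(\<exists>j. extension_equivalence G emb_g (\<gamma>_extension G K \<gamma>1) proj_k
              emb_g (\<gamma>_extension G K \<gamma>2) proj_k j) \<longleftrightarrow>
        (\<forall>x\<in>\<E>_star K. \<gamma>1 x = \<gamma>2 x)"
      by (intro equivalent_gamma_extensions_iff ext)
  qed
qed

end
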